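(* Let $\acute N$ be a radical screen transversal lightlike submanifold of a golden semi-Riemannian manifold $(\breve N,\breve g,\breve P)$. Then the radical distribution $\mathrm{Rad}\,T\acute N$ is integrable if and only if $$A_{\breve PU}W-A_{\breve PW}U=A^*_WU-A^*_UW$$ for all $W,U\in\Gamma(\mathrm{Rad}\,T\acute N)$.
   Context: Golden semi-Riemannian manifold: a semi-Riemannian manifold $(\breve N,\breve g)$ with a $(1,1)$-tensor field $\breve P$ such that $\breve P^2=\breve P+I$ and $\breve g(\breve PW,U)=\breve g(W,\breve PU)$ for all vector fields $W,U$; moreover $\breve\nabla_W\breve PU=\breve P\breve\nabla_WU$, where $\breve\nabla$ is the Levi-Civita connection of $\breve g$. Lightlike submanifold: $\acute N$ is an immersed submanifold whose induced metric $g$ is degenerate, with $\mathrm{Rad}\,T\acute N=T\acute N\cap T\acute N^\perp$ a distribution of constant rank $r\ge1$. Fix a screen distribution $S(T\acute N)$ (a semi-Riemannian, i.e. nondegenerate, complement of $\mathrm{Rad}\,T\acute N$ in $T\acute N$), a screen transversal bundle $S(T\acute N^\perp)$ (a nondegenerate complement of $\mathrm{Rad}\,T\acute N$ in $T\acute N^\perp$), and the associated lightlike transversal bundle $\mathrm{ltr}(T\acute N)$, locally spanned by null sections $N_i$ orthogonal to $S(T\acute N)$, to $S(T\acute N^\perp)$ and to each other, with $\breve g(N_i,\xi_j)=\delta_{ij}$ for a local basis $\{\xi_j\}$ of $\mathrm{Rad}\,T\acute N$. Thus $T\breve N|_{\acute N}=S(T\acute N)\perp[\mathrm{Rad}\,T\acute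 N\oplus \mathrm{ltr}(T\acute N)]\perp S(T\acute N^\perp)$. Gauss–Weingarten formulas, for $W,U\in\Gamma(T\acute N)$, $Z\in\Gamma(S(T\acute N^\perp))$ and $\xi\in\Gamma(\mathrm{Rad}\,T\acute N)$: $\breve\nabla_WU=\nabla_WU+h^\ell(W,U)+h^s(W,U)$, $\breve\nabla_WZ=-A_ZW+\nabla^s_WZ+D^\ell(W,Z)$, and $\nabla_W\xi=-A^*_\xi W+\nabla^{*t}_W\xi$, where $\nabla_WU,A_ZW\in\Gamma(T\acute N)$; $h^\ell(W,U),D^\ell(W,Z)\in\Gamma(\mathrm{ltr}(T\acute N))$; $h^s(W,U),\nabla^s_WZ\in\Gamma(S(T\acute N^\perp))$; $A^*_\xi W\in\Gamma(S(T\acute N))$ and $\nabla^{*t}_W\xi\in\Gamma(\mathrm{Rad}\,T\acute N)$. $\acute N$ is a screen transversal lightlike submanifold if $\breve P\,\mathrm{Rad}\,T\acute N\subset S(T\acute N^\perp)$. It is radical screen transversal if in addition $\breve P(S(T\acute N))=S(T\acute N)$. *)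

theory Defs
  imports "HOL-Analysis.Analysis"
begin

section \<open>Smooth maps between Euclidean spaces\<close>

text \<open>Intended for open sets only: on an open set of a finite-dimensional space, being of class
  \<open>C\<^sup>k\<^sup>+\<^sup>1\<close> means being differentiable with all directional derivatives of class \<open>C\<^sup>k\<close>.\<close>

primrec Ck_on :: "nat \<Rightarrow> 'e::euclidean_space set \<Rightarrow> ('e \<Rightarrow> 'f::real_normed_vector) \<Rightarrow> bool" where
  "Ck_on 0 = (\<lambda>S f. continuous_on S f)"
| "Ck_on (Suc k) = (\<lambda>S f. (\<forall>x\<in>S. f differentiable (at x)) \<and>
      (\<forall>v. Ck_on k S (\<lambda>x. frechet_derivative f (at x) v)))"

definition smooth_on :: "'e::euclidean_space set \<Rightarrow> ('e \<Rightarrow> 'f::real_normed_vector) \<Rightarrow> bool" where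
  "smooth_on S f \<longleftrightarrow> (\<forall>k. Ck_on k S f)"


section \<open>Smooth manifolds\<close>

text \<open>A smooth manifold is a Hausdorff, second countable type together with a smooth atlas.
  The model space is a Euclidean space \<open>'e\<close>, so that \<open>DIM('e)\<close> is the dimension.
  A chart is a pair of its domain and its coordinate map.\<close>

type_synonym ('a, 'e) chart = "'a set \<times> ('a \<Rightarrow> 'e)"

abbreviation chart_inv :: "('a, 'e) chart \<Rightarrow> 'e \<Rightarrow> 'a" where
  "chart_inv c \<equiv> inv_into (fst c) (snd c)"

definition smooth_atlas ::
  "('a::{t2_space,second_countable_topology}, 'e::euclidean_space) chart set \<Rightarrow> bool" where
  "smooth_atlas A \<longleftrightarrow>
     (\<forall>c\<in>A. open (fst c) \<and> open (snd c ` fst c) \<and>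
        homeomorphism (fst c) (snd c ` fst c) (snd c) (chart_inv c)) \<and>
     (\<Union>c\<in>A. fst c) = UNIV \<and>
     (\<forall>c\<in>A. \<forall>d\<in>A. smooth_on (snd c ` (fst c \<inter> fst d)) (snd d \<circ> chart_inv c))"

text \<open>Each point gets a preferred chart, and the tangent space at \<open>p\<close> is identified with the model
  space \<open>'e\<close> by means of the preferred chart at \<open>p\<close>. Hence a tangent vector at \<open>p\<close> is an element
  of \<open>'e\<close>, a vector field is a function \<open>'a \<Rightarrow> 'e\<close>, and a subbundle is a family of subspaces of
  \<open>'e\<close>. Since the preferred chart may jump from point to point, smoothness of such objects is always
  expressed after passing to the components \<open>components A c p v\<close> of the tangent vector
  \<open>v\<close> at \<open>p\<close> in a fixed chart \<open>c\<close>.\<close>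

definition chart_at :: "('a, 'e) chart set \<Rightarrow> 'a \<Rightarrow> ('a, 'e) chart" where
  "chart_at A p = (SOME c. c \<in> A \<and> p \<in> fst c)"

definition components ::
  "('a, 'e::euclidean_space) chart set \<Rightarrow> ('a, 'e) chart \<Rightarrow> 'a \<Rightarrow> 'e \<Rightarrow> 'e" where
  "components A c p v =
     frechet_derivative (snd c \<circ> chart_inv (chart_at A p)) (at (snd (chart_at A p) p)) v"

definition smooth_map ::
  "('b::topological_space, 'n::euclidean_space) chart set \<Rightarrow>
   ('a::topological_space, 'm::euclidean_space) chart set \<Rightarrow> ('b \<Rightarrow> 'a) \<Rightarrow> bool" where
  "smooth_map B A \<iota> \<longleftrightarrow> continuous_on UNIV \<iota> \<and>
     (\<forall>c\<in>B. \<forall>d\<in>A. smooth_on (snd c ` (fst c \<inter> \<iota> -` fst d)) (snd d \<circ> \<iota> \<circ> chart_inv c))"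

definition differential ::
  "('b, 'n::euclidean_space) chart set \<Rightarrow> ('a, 'm::euclidean_space) chart set \<Rightarrow>
   ('b \<Rightarrow> 'a) \<Rightarrow> 'b \<Rightarrow> 'n \<Rightarrow> 'm" where
  "differential B A \<iota> p v =
     frechet_derivative (snd (chart_at A (\<iota> p)) \<circ> \<iota> \<circ> chart_inv (chart_at B p))
       (at (snd (chart_at B p) p)) v"

definition immersion ::
  "('b::topological_space, 'n::euclidean_space) chart set \<Rightarrow>
   ('a::topological_space, 'm::euclidean_space) chart set \<Rightarrow> ('b \<Rightarrow> 'a) \<Rightarrow> bool" where
  "immersion B A \<iota> \<longleftrightarrow> smooth_map B A \<iota> \<and> (\<forall>p. inj (differential B A \<iota> p))"

definition smooth_function :: "('a, 'e::euclidean_space) chart set \<Rightarrow> ('a \<Rightarrow> real) \<Rightarrow> bool" where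
  "smooth_function A f \<longleftrightarrow> (\<forall>c\<in>A. smooth_on (snd c ` fst c) (f \<circ> chart_inv c))"

definition derivation ::
  "('a, 'e::euclidean_space) chart set \<Rightarrow> ('a \<Rightarrow> 'e) \<Rightarrow> ('a \<Rightarrow> real) \<Rightarrow> 'a \<Rightarrow> real" where
  "derivation A X f p =
     frechet_derivative (f \<circ> chart_inv (chart_at A p)) (at (snd (chart_at A p) p)) (X p)"

text \<open>Smooth sections over the open set \<open>U\<close> of the pullback bundle of the tangent bundle along
  \<open>\<iota>\<close>; for the identity map these are the vector fields over \<open>U\<close>.\<close>

definition smooth_section_on ::
  "('b, 'n::euclidean_space) chart set \<Rightarrow> ('a, 'm::euclidean_space) chart set \<Rightarrow> ('b \<Rightarrow> 'a) \<Rightarrow>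
   'b set \<Rightarrow> ('b \<Rightarrow> 'm) \<Rightarrow> bool" where
  "smooth_section_on B A \<iota> U V \<longleftrightarrow>
     (\<forall>c\<in>B. \<forall>d\<in>A. smooth_on (snd c ` (fst c \<inter> \<iota> -` fst d \<inter> U))
        ((\<lambda>q. components A d (\<iota> q) (V q)) \<circ> chart_inv c))"

abbreviation smooth_section ::
  "('b, 'n::euclidean_space) chart set \<Rightarrow> ('a, 'm::euclidean_space) chart set \<Rightarrow> ('b \<Rightarrow> 'a) \<Rightarrow>
   ('b \<Rightarrow> 'm) \<Rightarrow> bool" where
  "smooth_section B A \<iota> \<equiv> smooth_section_on B A \<iota> UNIV"

abbreviation vector_field :: "('a, 'e::euclidean_space) chart set \<Rightarrow> ('a \<Rightarrow> 'e) \<Rightarrow> bool" where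
  "vector_field A \<equiv> smooth_section A A (\<lambda>p. p)"

text \<open>The usual coordinate formula, evaluated at \<open>p\<close> in the preferred chart at \<open>p\<close>.\<close>

definition lie_bracket ::
  "('a, 'e::euclidean_space) chart set \<Rightarrow> ('a \<Rightarrow> 'e) \<Rightarrow> ('a \<Rightarrow> 'e) \<Rightarrow> 'a \<Rightarrow> 'e" where
  "lie_bracket A X Y p =
     (let c = chart_at A p; rep = (\<lambda>Z. (\<lambda>q. components A c q (Z q)) \<circ> chart_inv c) in
        frechet_derivative (rep Y) (at (snd c p)) (X p) -
        frechet_derivative (rep X) (at (snd c p)) (Y p))"

definition smooth_subbundle ::
  "('b::topological_space, 'n::euclidean_space) chart set \<Rightarrow>
   ('a, 'm::euclidean_space) chart set \<Rightarrow> ('b \<Rightarrow> 'a) \<Rightarrow> nat \<Rightarrow> ('b \<Rightarrow> 'm set) \<Rightarrow> bool" where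
  "smooth_subbundle B A \<iota> k E \<longleftrightarrow>
     (\<forall>p. subspace (E p) \<and> dim (E p) = k) \<and>
     (\<forall>p. \<exists>U s. open U \<and> p \<in> U \<and> (\<forall>j<k. smooth_section_on B A \<iota> U (s j)) \<and>
        (\<forall>q\<in>U. E q = span ((\<lambda>j. s j q) ` {..<k})))"

abbreviation distribution ::
  "('b::topological_space, 'n::euclidean_space) chart set \<Rightarrow> nat \<Rightarrow> ('b \<Rightarrow> 'n set) \<Rightarrow> bool" where
  "distribution B \<equiv> smooth_subbundle B B (\<lambda>p. p)"

text \<open>\<open>L\<close> is an integral manifold of \<open>D\<close>: around each of its points there is a chart of the
  maximal atlas in which \<open>L\<close> is a slice by a linear subspace \<open>F\<close>, and the tangent space
  of \<open>L\<close> (which is \<open>F\<close> in this chart) is the fibre of \<open>D\<close>.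
  A distribution is integrable if there is an integral manifold through each point; this
  local notion is not affected by demanding embedded integral manifolds, as any
  immersed integral manifold is locally embedded.\<close>

definition integral_manifold ::
  "('b::{t2_space,second_countable_topology}, 'n::euclidean_space) chart set \<Rightarrow>
   ('b \<Rightarrow> 'n set) \<Rightarrow> 'b set \<Rightarrow> bool" where
  "integral_manifold B D L \<longleftrightarrow>
     (\<forall>p\<in>L. \<exists>c F. smooth_atlas (insert c B) \<and> p \<in> fst c \<and> subspace F \<and>
        L \<inter> fst c = {q \<in> fst c. snd c q \<in> F} \<and>
        (\<forall>q\<in>L \<inter> fst c. components B c q ` D q = F))"

definition integrable_distribution ::
  "('b::{t2_space,second_countable_topology}, 'n::euclidean_space) chart set \<Rightarrow>
   ('b \<Rightarrow> 'n set) \<Rightarrow> bool" where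
  "integrable_distribution B D \<longleftrightarrow> (\<forall>p. \<exists>L. p \<in> L \<and> integral_manifold B D L)"


section \<open>Golden semi-Riemannian manifolds\<close>

definition nondegenerate_on :: "'m::real_vector set \<Rightarrow> ('m \<Rightarrow> 'm \<Rightarrow> real) \<Rightarrow> bool" where
  "nondegenerate_on V b \<longleftrightarrow> (\<forall>v\<in>V. (\<forall>w\<in>V. b v w = 0) \<longrightarrow> v = 0)"

definition form_index :: "('m::euclidean_space \<Rightarrow> 'm \<Rightarrow> real) \<Rightarrow> nat" where
  "form_index b = Max (dim ` {V. subspace V \<and> (\<forall>v\<in>V. v \<noteq> 0 \<longrightarrow> b v v < 0)})"

definition semi_riemannian_metric ::
  "('a, 'm::euclidean_space) chart set \<Rightarrow> ('a \<Rightarrow> 'm \<Rightarrow> 'm \<Rightarrow> real) \<Rightarrow> bool" where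
  "semi_riemannian_metric A g \<longleftrightarrow>
     (\<forall>p. bilinear (g p) \<and> (\<forall>v w. g p v w = g p w v) \<and> nondegenerate_on UNIV (g p)) \<and>
     (\<forall>X Y. vector_field A X \<longrightarrow> vector_field A Y \<longrightarrow>
        smooth_function A (\<lambda>p. g p (X p) (Y p))) \<and>
     (\<exists>\<nu>. \<forall>p. form_index (g p) = \<nu>)"

definition affine_connection ::
  "('a, 'm::euclidean_space) chart set \<Rightarrow>
   (('a \<Rightarrow> 'm) \<Rightarrow> ('a \<Rightarrow> 'm) \<Rightarrow> 'a \<Rightarrow> 'm) \<Rightarrow> bool" where
  "affine_connection A nabla \<longleftrightarrow>
     (\<forall>X Y. vector_field A X \<longrightarrow> vector_field A Y \<longrightarrow> vector_field A (nabla X Y)) \<and>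
     (\<forall>X X' Y p. vector_field A X \<longrightarrow> vector_field A X' \<longrightarrow> vector_field A Y \<longrightarrow>
        nabla (\<lambda>q. X q + X' q) Y p = nabla X Y p + nabla X' Y p) \<and>
     (\<forall>f X Y p. smooth_function A f \<longrightarrow> vector_field A X \<longrightarrow> vector_field A Y \<longrightarrow>
        nabla (\<lambda>q. f q *\<^sub>R X q) Y p = f p *\<^sub>R nabla X Y p) \<and>
     (\<forall>X Y Y' p. vector_field A X \<longrightarrow> vector_field A Y \<longrightarrow> vector_field A Y' \<longrightarrow>
        nabla X (\<lambda>q. Y q + Y' q) p = nabla X Y p + nabla X Y' p) \<and>
     (\<forall>f X Y p. smooth_function A f \<longrightarrow> vector_field A X \<longrightarrow> vector_field A Y \<longrightarrow>
        nabla X (\<lambda>q. f q *\<^sub>R Y q) p = derivation A X f p *\<^sub>R Y p + f p *\<^sub>R nabla X Y p)"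

definition levi_civita_connection ::
  "('a, 'm::euclidean_space) chart set \<Rightarrow> ('a \<Rightarrow> 'm \<Rightarrow> 'm \<Rightarrow> real) \<Rightarrow>
   (('a \<Rightarrow> 'm) \<Rightarrow> ('a \<Rightarrow> 'm) \<Rightarrow> 'a \<Rightarrow> 'm) \<Rightarrow> bool" where
  "levi_civita_connection A g nabla \<longleftrightarrow>
     affine_connection A nabla \<and>
     (\<forall>X Y p. vector_field A X \<longrightarrow> vector_field A Y \<longrightarrow>
        nabla X Y p - nabla Y X p = lie_bracket A X Y p) \<and>
     (\<forall>X Y Z p. vector_field A X \<longrightarrow> vector_field A Y \<longrightarrow> vector_field A Z \<longrightarrow>
        derivation A X (\<lambda>q. g q (Y q) (Z q)) p
          = g p (nabla X Y p) (Z p) + g p (Y p) (nabla X Z p))"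

definition golden_semi_riemannian_manifold ::
  "('a::{t2_space,second_countable_topology}, 'm::euclidean_space) chart set \<Rightarrow>
   ('a \<Rightarrow> 'm \<Rightarrow> 'm \<Rightarrow> real) \<Rightarrow> ('a \<Rightarrow> 'm \<Rightarrow> 'm) \<Rightarrow>
   (('a \<Rightarrow> 'm) \<Rightarrow> ('a \<Rightarrow> 'm) \<Rightarrow> 'a \<Rightarrow> 'm) \<Rightarrow> bool" where
  "golden_semi_riemannian_manifold A g P nabla \<longleftrightarrow>
     smooth_atlas A \<and> semi_riemannian_metric A g \<and> levi_civita_connection A g nabla \<and>
     (\<forall>p. linear (P p)) \<and>
     (\<forall>X. vector_field A X \<longrightarrow> vector_field A (\<lambda>p. P p (X p))) \<and>
     (\<forall>p v. P p (P p v) = P p v + v) \<and>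
     (\<forall>W U p. vector_field A W \<longrightarrow> vector_field A U \<longrightarrow>
        g p (P p (W p)) (U p) = g p (W p) (P p (U p))) \<and>
     (\<forall>W U p. vector_field A W \<longrightarrow> vector_field A U \<longrightarrow>
        nabla W (\<lambda>q. P q (U q)) p = P p (nabla W U p))"


section \<open>Lightlike submanifolds\<close>

text \<open>The submanifold is the manifold with atlas \<open>B\<close>, immersed by \<open>\<iota>\<close> into the manifold with
  atlas \<open>A\<close>. Vector fields on the submanifold are functions \<open>'b \<Rightarrow> 'n\<close>, while all subbundles of the
  restricted ambient tangent bundle, including the tangent bundle of the submanifold,
  are families of subspaces of \<open>'m\<close>.\<close>

definition tangent_space ::
  "('b, 'n::euclidean_space) chart set \<Rightarrow> ('a, 'm::euclidean_space) chart set \<Rightarrow>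
   ('b \<Rightarrow> 'a) \<Rightarrow> 'b \<Rightarrow> 'm set" where
  "tangent_space B A \<iota> p = range (differential B A \<iota> p)"

definition normal_space ::
  "('b, 'n::euclidean_space) chart set \<Rightarrow> ('a, 'm::euclidean_space) chart set \<Rightarrow>
   ('a \<Rightarrow> 'm \<Rightarrow> 'm \<Rightarrow> real) \<Rightarrow> ('b \<Rightarrow> 'a) \<Rightarrow> 'b \<Rightarrow> 'm set" where
  "normal_space B A g \<iota> p = {v. \<forall>w \<in> tangent_space B A \<iota> p. g (\<iota> p) v w = 0}"

definition Rad ::
  "('b, 'n::euclidean_space) chart set \<Rightarrow> ('a, 'm::euclidean_space) chart set \<Rightarrow>
   ('a \<Rightarrow> 'm \<Rightarrow> 'm \<Rightarrow> real) \<Rightarrow> ('b \<Rightarrow> 'a) \<Rightarrow> 'b \<Rightarrow> 'm set" where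
  "Rad B A g \<iota> p = tangent_space B A \<iota> p \<inter> normal_space B A g \<iota> p"

text \<open>The radical distribution as a distribution on the submanifold itself.\<close>

definition radical_distribution ::
  "('b, 'n::euclidean_space) chart set \<Rightarrow> ('a, 'm::euclidean_space) chart set \<Rightarrow>
   ('a \<Rightarrow> 'm \<Rightarrow> 'm \<Rightarrow> real) \<Rightarrow> ('b \<Rightarrow> 'a) \<Rightarrow> 'b \<Rightarrow> 'n set" where
  "radical_distribution B A g \<iota> p = differential B A \<iota> p -` Rad B A g \<iota> p"

definition direct_sum :: "'m::real_vector set \<Rightarrow> 'm set \<Rightarrow> 'm set \<Rightarrow> bool" where
  "direct_sum V E F \<longleftrightarrow> subspace E \<and> subspace F \<and> E \<inter> F = {0} \<and> V = span (E \<union> F)"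

definition screen_distribution ::
  "('b::topological_space, 'n::euclidean_space) chart set \<Rightarrow> ('a, 'm::euclidean_space) chart set \<Rightarrow>
   ('a \<Rightarrow> 'm \<Rightarrow> 'm \<Rightarrow> real) \<Rightarrow> ('b \<Rightarrow> 'a) \<Rightarrow> ('b \<Rightarrow> 'm set) \<Rightarrow> bool" where
  "screen_distribution B A g \<iota> S \<longleftrightarrow>
     (\<exists>k. smooth_subbundle B A \<iota> k S) \<and>
     (\<forall>p. direct_sum (tangent_space B A \<iota> p) (Rad B A g \<iota> p) (S p) \<and>
          nondegenerate_on (S p) (g (\<iota> p)))"

definition screen_transversal_bundle ::
  "('b::topological_space, 'n::euclidean_space) chart set \<Rightarrow> ('a, 'm::euclidean_space) chart set \<Rightarrow>
   ('a \<Rightarrow> 'm \<Rightarrow> 'm \<Rightarrow> real) \<Rightarrow> ('b \<Rightarrow> 'a) \<Rightarrow> ('b \<Rightarrow> 'm set) \<Rightarrow> bool" where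
  "screen_transversal_bundle B A g \<iota> St \<longleftrightarrow>
     (\<exists>k. smooth_subbundle B A \<iota> k St) \<and>
     (\<forall>p. direct_sum (normal_space B A g \<iota> p) (Rad B A g \<iota> p) (St p) \<and>
          nondegenerate_on (St p) (g (\<iota> p)))"

definition lightlike_transversal_bundle ::
  "('b::topological_space, 'n::euclidean_space) chart set \<Rightarrow> ('a, 'm::euclidean_space) chart set \<Rightarrow>
   ('a \<Rightarrow> 'm \<Rightarrow> 'm \<Rightarrow> real) \<Rightarrow> ('b \<Rightarrow> 'a) \<Rightarrow> nat \<Rightarrow>
   ('b \<Rightarrow> 'm set) \<Rightarrow> ('b \<Rightarrow> 'm set) \<Rightarrow> ('b \<Rightarrow> 'm set) \<Rightarrow> bool" where
  "lightlike_transversal_bundle B A g \<iota> r S St ltr \<longleftrightarrow>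
     (\<forall>p. \<exists>U \<xi> N. open U \<and> p \<in> U \<and>
        (\<forall>i<r. smooth_section_on B A \<iota> U (\<xi> i) \<and> smooth_section_on B A \<iota> U (N i)) \<and>
        (\<forall>q\<in>U. Rad B A g \<iota> q = span ((\<lambda>i. \<xi> i q) ` {..<r}) \<and>
                ltr q = span ((\<lambda>i. N i q) ` {..<r}) \<and>
                (\<forall>i<r. \<forall>j<r. g (\<iota> q) (N i q) (\<xi> j q) = (if i = j then 1 else 0)) \<and>
                (\<forall>i<r. \<forall>j<r. g (\<iota> q) (N i q) (N j q) = 0) \<and>
                (\<forall>i<r. \<forall>v\<in>S q \<union> St q. g (\<iota> q) (N i q) v = 0)))"

definition lightlike_submanifold ::
  "('b::{t2_space,second_countable_topology}, 'n::euclidean_space) chart set \<Rightarrow>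
   ('a::{t2_space,second_countable_topology}, 'm::euclidean_space) chart set \<Rightarrow>
   ('a \<Rightarrow> 'm \<Rightarrow> 'm \<Rightarrow> real) \<Rightarrow> ('b \<Rightarrow> 'a) \<Rightarrow>
   ('b \<Rightarrow> 'm set) \<Rightarrow> ('b \<Rightarrow> 'm set) \<Rightarrow> ('b \<Rightarrow> 'm set) \<Rightarrow> bool" where
  "lightlike_submanifold B A g \<iota> S St ltr \<longleftrightarrow>
     smooth_atlas B \<and> immersion B A \<iota> \<and>
     (\<exists>r\<ge>1. distribution B r (radical_distribution B A g \<iota>) \<and>
        lightlike_transversal_bundle B A g \<iota> r S St ltr) \<and>
     screen_distribution B A g \<iota> S \<and> screen_transversal_bundle B A g \<iota> St"

definition screen_transversal_lightlike_submanifold ::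
  "('b::{t2_space,second_countable_topology}, 'n::euclidean_space) chart set \<Rightarrow>
   ('a::{t2_space,second_countable_topology}, 'm::euclidean_space) chart set \<Rightarrow>
   ('a \<Rightarrow> 'm \<Rightarrow> 'm \<Rightarrow> real) \<Rightarrow> ('a \<Rightarrow> 'm \<Rightarrow> 'm) \<Rightarrow> ('b \<Rightarrow> 'a) \<Rightarrow>
   ('b \<Rightarrow> 'm set) \<Rightarrow> ('b \<Rightarrow> 'm set) \<Rightarrow> ('b \<Rightarrow> 'm set) \<Rightarrow> bool" where
  "screen_transversal_lightlike_submanifold B A g P \<iota> S St ltr \<longleftrightarrow>
     lightlike_submanifold B A g \<iota> S St ltr \<and>
     (\<forall>p. P (\<iota> p) ` Rad B A g \<iota> p \<subseteq> St p)"

definition radical_screen_transversal_lightlike_submanifold ::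
  "('b::{t2_space,second_countable_topology}, 'n::euclidean_space) chart set \<Rightarrow>
   ('a::{t2_space,second_countable_topology}, 'm::euclidean_space) chart set \<Rightarrow>
   ('a \<Rightarrow> 'm \<Rightarrow> 'm \<Rightarrow> real) \<Rightarrow> ('a \<Rightarrow> 'm \<Rightarrow> 'm) \<Rightarrow> ('b \<Rightarrow> 'a) \<Rightarrow>
   ('b \<Rightarrow> 'm set) \<Rightarrow> ('b \<Rightarrow> 'm set) \<Rightarrow> ('b \<Rightarrow> 'm set) \<Rightarrow> bool" where
  "radical_screen_transversal_lightlike_submanifold B A g P \<iota> S St ltr \<longleftrightarrow>
     screen_transversal_lightlike_submanifold B A g P \<iota> S St ltr \<and>
     (\<forall>p. P (\<iota> p) ` S p = S p)"


section \<open>Gauss--Weingarten formulas\<close>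

definition pushforward ::
  "('b, 'n::euclidean_space) chart set \<Rightarrow> ('a, 'm::euclidean_space) chart set \<Rightarrow>
   ('b \<Rightarrow> 'a) \<Rightarrow> ('b \<Rightarrow> 'n) \<Rightarrow> 'b \<Rightarrow> 'm" where
  "pushforward B A \<iota> W p = differential B A \<iota> p (W p)"

text \<open>The ambient connection acts on sections along \<open>\<iota>\<close> as the pullback connection \<open>D\<close>:
  the unique connection on the pullback of the ambient tangent bundle that agrees with
  the ambient connection on the restrictions of ambient vector fields.\<close>

definition pullback_connection ::
  "('b, 'n::euclidean_space) chart set \<Rightarrow> ('a, 'm::euclidean_space) chart set \<Rightarrow> ('b \<Rightarrow> 'a) \<Rightarrow>
   (('a \<Rightarrow> 'm) \<Rightarrow> ('a \<Rightarrow> 'm) \<Rightarrow> 'a \<Rightarrow> 'm) \<Rightarrow>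
   (('b \<Rightarrow> 'n) \<Rightarrow> ('b \<Rightarrow> 'm) \<Rightarrow> 'b \<Rightarrow> 'm) \<Rightarrow> bool" where
  "pullback_connection B A \<iota> nabla D \<longleftrightarrow>
     (\<forall>W V. vector_field B W \<longrightarrow> smooth_section B A \<iota> V \<longrightarrow> smooth_section B A \<iota> (D W V)) \<and>
     (\<forall>W W' V p. vector_field B W \<longrightarrow> vector_field B W' \<longrightarrow> smooth_section B A \<iota> V \<longrightarrow>
        D (\<lambda>q. W q + W' q) V p = D W V p + D W' V p) \<and>
     (\<forall>f W V p. smooth_function B f \<longrightarrow> vector_field B W \<longrightarrow> smooth_section B A \<iota> V \<longrightarrow>
        D (\<lambda>q. f q *\<^sub>R W q) V p = f p *\<^sub>R D W V p) \<and>
     (\<forall>W V V' p. vector_field B W \<longrightarrow> smooth_section B A \<iota> V \<longrightarrow> smooth_section B A \<iota> V' \<longrightarrow>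
        D W (\<lambda>q. V q + V' q) p = D W V p + D W V' p) \<and>
     (\<forall>f W V p. smooth_function B f \<longrightarrow> vector_field B W \<longrightarrow> smooth_section B A \<iota> V \<longrightarrow>
        D W (\<lambda>q. f q *\<^sub>R V q) p = derivation B W f p *\<^sub>R V p + f p *\<^sub>R D W V p) \<and>
     (\<forall>W X Y p. vector_field B W \<longrightarrow> vector_field A X \<longrightarrow> vector_field A Y \<longrightarrow>
        X (\<iota> p) = pushforward B A \<iota> W p \<longrightarrow>
        D W (\<lambda>q. Y (\<iota> q)) p = nabla X Y (\<iota> p))"

text \<open>The component in \<open>E\<close> with respect to a direct sum of \<open>E\<close> and \<open>F\<close>.\<close>

definition projection_along :: "'m::real_vector set \<Rightarrow> 'm set \<Rightarrow> 'm \<Rightarrow> 'm" where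
  "projection_along E F v = (THE e. e \<in> E \<and> v - e \<in> F)"

definition tangential_part ::
  "('b, 'n::euclidean_space) chart set \<Rightarrow> ('a, 'm::euclidean_space) chart set \<Rightarrow> ('b \<Rightarrow> 'a) \<Rightarrow>
   ('b \<Rightarrow> 'm set) \<Rightarrow> ('b \<Rightarrow> 'm set) \<Rightarrow> 'b \<Rightarrow> 'm \<Rightarrow> 'm" where
  "tangential_part B A \<iota> St ltr p =
     projection_along (tangent_space B A \<iota> p) (span (ltr p \<union> St p))"

text \<open>\<open>\<nabla>\<^sub>W U\<close>, the tangential part in the Gauss formula, as a section along \<open>\<iota>\<close>.\<close>

definition induced_connection ::
  "('b, 'n::euclidean_space) chart set \<Rightarrow> ('a, 'm::euclidean_space) chart set \<Rightarrow> ('b \<Rightarrow> 'a) \<Rightarrow>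
   (('b \<Rightarrow> 'n) \<Rightarrow> ('b \<Rightarrow> 'm) \<Rightarrow> 'b \<Rightarrow> 'm) \<Rightarrow> ('b \<Rightarrow> 'm set) \<Rightarrow> ('b \<Rightarrow> 'm set) \<Rightarrow>
   ('b \<Rightarrow> 'n) \<Rightarrow> ('b \<Rightarrow> 'n) \<Rightarrow> 'b \<Rightarrow> 'm" where
  "induced_connection B A \<iota> D St ltr W U p =
     tangential_part B A \<iota> St ltr p (D W (pushforward B A \<iota> U) p)"

text \<open>\<open>A\<^sub>Z W\<close> for a section \<open>Z\<close> of the screen transversal bundle.\<close>

definition shape_operator ::
  "('b, 'n::euclidean_space) chart set \<Rightarrow> ('a, 'm::euclidean_space) chart set \<Rightarrow> ('b \<Rightarrow> 'a) \<Rightarrow>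
   (('b \<Rightarrow> 'n) \<Rightarrow> ('b \<Rightarrow> 'm) \<Rightarrow> 'b \<Rightarrow> 'm) \<Rightarrow> ('b \<Rightarrow> 'm set) \<Rightarrow> ('b \<Rightarrow> 'm set) \<Rightarrow>
   ('b \<Rightarrow> 'm) \<Rightarrow> ('b \<Rightarrow> 'n) \<Rightarrow> 'b \<Rightarrow> 'm" where
  "shape_operator B A \<iota> D St ltr Z W p = - tangential_part B A \<iota> St ltr p (D W Z p)"

text \<open>\<open>A\<^sup>*\<^sub>\<xi> W\<close> for a section \<open>\<xi>\<close> of the radical distribution.\<close>

definition screen_shape_operator ::
  "('b, 'n::euclidean_space) chart set \<Rightarrow> ('a, 'm::euclidean_space) chart set \<Rightarrow>
   ('a \<Rightarrow> 'm \<Rightarrow> 'm \<Rightarrow> real) \<Rightarrow> ('b \<Rightarrow> 'a) \<Rightarrow>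
   (('b \<Rightarrow> 'n) \<Rightarrow> ('b \<Rightarrow> 'm) \<Rightarrow> 'b \<Rightarrow> 'm) \<Rightarrow>
   ('b \<Rightarrow> 'm set) \<Rightarrow> ('b \<Rightarrow> 'm set) \<Rightarrow> ('b \<Rightarrow> 'm set) \<Rightarrow>
   ('b \<Rightarrow> 'n) \<Rightarrow> ('b \<Rightarrow> 'n) \<Rightarrow> 'b \<Rightarrow> 'm" where
  "screen_shape_operator B A g \<iota> D S St ltr \<xi> W p =
     - projection_along (S p) (Rad B A g \<iota> p) (induced_connection B A \<iota> D St ltr W \<xi> p)"

definition radical_section ::
  "('b, 'n::euclidean_space) chart set \<Rightarrow> ('a, 'm::euclidean_space) chart set \<Rightarrow>
   ('a \<Rightarrow> 'm \<Rightarrow> 'm \<Rightarrow> real) \<Rightarrow> ('b \<Rightarrow> 'a) \<Rightarrow> ('b \<Rightarrow> 'n) \<Rightarrow> bool" where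
  "radical_section B A g \<iota> W \<longleftrightarrow>
     vector_field B W \<and> (\<forall>p. W p \<in> radical_distribution B A g \<iota> p)"

end

theory Submission
  imports Defs
begin

text \<open>
The equation at a point \<open>p\<close> is a condition on the bracket of the radical fields \<open>W\<close> and \<open>U\<close>. Let
\<open>d\<iota> [W, U] = s + \<rho>\<close> with \<open>s\<close> in the screen distribution and \<open>\<rho>\<close> in the radical. The pullback connection
\<open>D\<close> is torsion free (\<open>torsion_free\<close>), and \<open>P\<close> is parallel for it (\<open>parallel_endomorphism\<close>), so
\<open>D\<^sub>W (P U) - D\<^sub>U (P W) = P s + P \<rho>\<close>. Here \<open>P s\<close> lies in the screen distribution again, and \<open>P \<rho>\<close> lies in the screen
transversal bundle and has no tangential part. Shape operators are negatives of tangential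
parts, hence the left side of the equation is \<open>- P s\<close>. Its right side is the screen part of
\<open>D\<^sub>W U - D\<^sub>U W = s + \<rho>\<close>, that is \<open>s\<close>. Finally \<open>- P s = s\<close> means \<open>P (P s) = P s + s = 0\<close>, which forces \<open>s = 0\<close> since a
golden structure is invertible. So the equation holds at all points for all radical fields if and
only if the radical distribution is involutive, and Frobenius' theorem (\<open>frobenius\<close>) concludes.
The argument compares tangential parts of arbitrary ambient vectors linearly; this rests on
\<open>transversal_decomposition\<close>, which shows that the sum of the transversal bundles is a complement of
the tangent space in the ambient tangent space.

The two properties of \<open>D\<close> follow from its axioms by expanding sections along \<open>\<iota>\<close> in a coordinate
frame of the ambient manifold. As the axioms concern global sections, frames and coefficients are
cut off with bump functions. What is left of the torsion is the symmetry of the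
second derivatives of \<open>\<iota>\<close> in coordinates (\<open>pushed_bracket\<close>).

For Frobenius' theorem, the hard direction is the existence of a leaf through a given point.
An involutive distribution has locally a frame of commuting fields \<open>x \<mapsto> M x u\<close> that is a graph over a
fixed subspace, and the leaf is parametrised by a solution of the total differential equation
\<open>D\<Phi>(z) = M (\<Phi> z)\<close>. It is found by solving the equation along the rays from the origin, which is a fixed point
problem for a contraction; the commutation of the fields then gives the derivative in all
directions (\<open>leaf_exists\<close>), and the equation itself gives smoothness. Subtracting the leaf from
the coordinates straightens it to a slice.
\<close>

section \<open>Maps of class \<open>C\<^sup>k\<close>\<close>

abbreviation fderiv where "fderiv f x \<equiv> frechet_derivative f (at x)"

text \<open>The defining equations of \<open>Ck_on\<close> are equations between functions of the set and the map. The
simplifier gets them in fully applied form instead.\<close>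

lemma Ck_on_0 [simp]: "Ck_on 0 S f \<longleftrightarrow> continuous_on S f"
  by simp

lemma Ck_on_Suc [simp]:
  "Ck_on (Suc k) S f \<longleftrightarrow> (\<forall>x\<in>S. f differentiable (at x)) \<and>
     (\<forall>v. Ck_on k S (\<lambda>x. fderiv f x v))"
  by simp

declare Ck_on.simps [simp del]

lemma frechet_derivative_worksI:
  "f differentiable at x \<Longrightarrow> (f has_derivative fderiv f x) (at x)"
  using frechet_derivative_works by blast

lemma Ck_on_cong:
  assumes "open S" "Ck_on k S f" "\<And>x. x \<in> S \<Longrightarrow> f x = g x"
  shows "Ck_on k S g"
  using assms(2,3)
proof (induction k arbitrary: f g)
  case 0
  then show ?case using continuous_on_eq by auto
next
  case (Suc k)
  have D: "(g has_derivative fderiv f x) (at x)" if "x \<in> S" for x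
    using Suc.prems that \<open>open S\<close>
    by (metis Ck_on_Suc frechet_derivative_works has_derivative_transform_within_open)
  have E: "fderiv f x = fderiv g x" if "x \<in> S" for x
    using frechet_derivative_at[OF D[OF that]] .
  show ?case unfolding Ck_on_Suc
  proof (intro conjI ballI allI)
    show "g differentiable at x" if "x \<in> S" for x
      using D[OF that] by (auto simp: differentiable_def)
    show "Ck_on k S (\<lambda>x. fderiv g x v)" for v
      by (rule Suc.IH[of "\<lambda>x. fderiv f x v"]) (use Suc.prems E in auto)
  qed
qed

lemma Ck_on_SucI:
  assumes "open S" "\<And>x. x \<in> S \<Longrightarrow> (f has_derivative f' x) (at x)"
    and "\<And>v. Ck_on k S (\<lambda>x. f' x v)"
  shows "Ck_on (Suc k) S f"
  unfolding Ck_on_Suc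
proof (intro conjI ballI allI)
  show "f differentiable at x" if "x \<in> S" for x
    using assms(2)[OF that] by (auto simp: differentiable_def)
  show "Ck_on k S (\<lambda>x. fderiv f x v)" for v
    by (rule Ck_on_cong[OF \<open>open S\<close> assms(3)]) (simp add: frechet_derivative_at[OF assms(2), symmetric])
qed

lemma Ck_on_continuous:
  assumes "Ck_on k S f"
  shows "continuous_on S f"
proof (cases k)
  case (Suc n)
  then have "f differentiable_on S"
    using assms by (simp add: differentiable_on_def differentiable_at_withinI)
  then show ?thesis by (rule differentiable_imp_continuous_on)
qed (use assms in simp)

lemma Ck_on_SucD: "Ck_on (Suc k) S f \<Longrightarrow> Ck_on k S f"
proof (induction k arbitrary: f)
  case 0
  then show ?case unfolding Ck_on_0 by (rule Ck_on_continuous)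
qed auto

lemma Ck_on_subset: "Ck_on k S f \<Longrightarrow> T \<subseteq> S \<Longrightarrow> Ck_on k T f"
  by (induction k arbitrary: f) (auto intro: continuous_on_subset)

lemma Ck_on_local:
  assumes "\<And>x. x \<in> S \<Longrightarrow> \<exists>T. open T \<and> x \<in> T \<and> Ck_on k T f"
  shows "Ck_on k S f"
  using assms
proof (induction k arbitrary: f)
  case 0
  then show ?case
    by (metis Ck_on_0 continuous_at_imp_continuous_on continuous_on_eq_continuous_at)
next
  case (Suc k)
  show ?case unfolding Ck_on_Suc
  proof (intro conjI ballI allI)
    fix x assume "x \<in> S" then show "f differentiable at x"
      using Suc.prems by force
  next
    fix v show "Ck_on k S (\<lambda>x. fderiv f x v)"
      using Suc.prems by (intro Suc.IH) force
  qed
qed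

lemma Ck_on_const [simp, intro]: "Ck_on k S (\<lambda>x. c)"
  by (induction k arbitrary: c) (auto simp: Ck_on_Suc)

lemma Ck_on_linear:
  assumes "bounded_linear f"
  shows "Ck_on k S f"
proof (cases k)
  case 0
  then show ?thesis using linear_continuous_on[OF assms] by auto
next
  case (Suc k)
  have "fderiv f x = f" for x
    using frechet_derivative_at[OF bounded_linear_imp_has_derivative[OF assms]] by simp
  then show ?thesis
    unfolding Suc by (simp add: bounded_linear_imp_differentiable[OF assms])
qed

lemma Ck_on_bounded_linear:
  assumes "bounded_linear L" "open S" "Ck_on k S f"
  shows "Ck_on k S (\<lambda>x. L (f x))"
  using assms(3)
proof (induction k arbitrary: f)
  case 0
  then show ?case using assms by (auto intro: bounded_linear.continuous_on)
next
  case (Suc k)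
  show ?case
  proof (rule Ck_on_SucI[OF \<open>open S\<close>])
    show "((\<lambda>x. L (f x)) has_derivative (\<lambda>v. L (fderiv f x v))) (at x)" if "x \<in> S" for x
      using Suc.prems that by (auto intro!: bounded_linear.has_derivative[OF assms(1)] simp: frechet_derivative_worksI)
  qed (use Suc in auto)
qed

lemma Ck_on_add:
  assumes "open S" "Ck_on k S f" "Ck_on k S g"
  shows "Ck_on k S (\<lambda>x. f x + g x)"
  using assms(2,3)
proof (induction k arbitrary: f g)
  case 0
  then show ?case by (auto intro: continuous_intros)
next
  case (Suc k)
  show ?case
  proof (rule Ck_on_SucI[OF \<open>open S\<close>])
    show "((\<lambda>x. f x + g x) has_derivative (\<lambda>v. fderiv f x v + fderiv g x v)) (at x)" if "x \<in> S" for x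
      using Suc.prems that by (auto intro!: has_derivative_add simp: frechet_derivative_worksI)
  qed (use Suc in auto)
qed

lemma Ck_on_sum:
  assumes "open S" "\<And>i. i \<in> I \<Longrightarrow> Ck_on k S (f i)"
  shows "Ck_on k S (\<lambda>x. \<Sum>i\<in>I. f i x)"
  using assms(2)
  by (induction I rule: infinite_finite_induct) (auto intro: Ck_on_add[OF \<open>open S\<close>])

lemma Ck_on_bilinear:
  assumes "bounded_bilinear b" "open S" "Ck_on k S f" "Ck_on k S g"
  shows "Ck_on k S (\<lambda>x. b (f x) (g x))"
  using assms(3,4)
proof (induction k arbitrary: f g)
  case 0
  then show ?case using assms by (auto intro: bounded_bilinear.continuous_on)
next
  case (Suc k)
  show ?case
  proof (rule Ck_on_SucI[OF \<open>open S\<close>])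
    show "((\<lambda>x. b (f x) (g x)) has_derivative
       (\<lambda>v. b (f x) (fderiv g x v) + b (fderiv f x v) (g x))) (at x)" if "x \<in> S" for x
      using Suc.prems that by (auto intro!: bounded_bilinear.FDERIV[OF assms(1)] simp: frechet_derivative_worksI)
    show "Ck_on k S (\<lambda>x. b (f x) (fderiv g x v) + b (fderiv f x v) (g x))" for v
      using Suc.prems Ck_on_SucD[OF Suc.prems(1)] Ck_on_SucD[OF Suc.prems(2)]
      by (intro Ck_on_add[OF \<open>open S\<close>] Suc.IH) auto
  qed
qed

lemma linear_euclidean_expansion:
  fixes v :: "'e::euclidean_space"
  assumes "linear f"
  shows "f v = (\<Sum>i\<in>Basis. (v \<bullet> i) *\<^sub>R f i)"
proof -
  have "f (\<Sum>i\<in>Basis. (v \<bullet> i) *\<^sub>R i) = (\<Sum>i\<in>Basis. (v \<bullet> i) *\<^sub>R f i)"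
    using assms by (simp add: linear_sum linear_scale)
  then show ?thesis by (simp add: euclidean_representation)
qed

lemma frechet_derivative_expansion:
  assumes "f differentiable at x"
  shows "fderiv f x v = (\<Sum>i\<in>Basis. (v \<bullet> i) *\<^sub>R fderiv f x i)"
  using assms by (intro linear_euclidean_expansion linear_frechet_derivative)

lemma Ck_on_compose:
  assumes "open S" "open T" "Ck_on k T g" "Ck_on k S f" "f ` S \<subseteq> T"
  shows "Ck_on k S (\<lambda>x. g (f x))"
  using assms(3,4)
proof (induction k arbitrary: g)
  case 0
  then show ?case using assms(5) by (auto intro: continuous_on_compose2)
next
  case (Suc k)
  have fT: "f x \<in> T" if "x \<in> S" for x using that assms(5) by auto
  show ?case
  proof (rule Ck_on_SucI[OF \<open>open S\<close>])
    fix x assume "x \<in> S"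
    then have f: "(f has_derivative fderiv f x) (at x)"
      and g: "g differentiable at (f x)"
      using Suc.prems fT by (auto simp: frechet_derivative_worksI)
    show "((\<lambda>x. g (f x)) has_derivative
        (\<lambda>v. \<Sum>i\<in>Basis. (fderiv f x v \<bullet> i) *\<^sub>R fderiv g (f x) i)) (at x)"
      using has_derivative_compose[OF f g[THEN frechet_derivative_worksI]]
      unfolding frechet_derivative_expansion[OF g, of "frechet_derivative f _ _"] .
  next
    fix v
    show "Ck_on k S (\<lambda>x. \<Sum>i\<in>Basis. (fderiv f x v \<bullet> i) *\<^sub>R fderiv g (f x) i)"
      using Suc.prems Ck_on_SucD[OF Suc.prems(2)] \<open>open S\<close>
      by (intro Ck_on_sum Ck_on_bilinear[OF bounded_bilinear_scaleR]
          Ck_on_bounded_linear[OF bounded_linear_inner_left] Suc.IH) auto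
  qed
qed

text \<open>Operator-valued maps are smooth once they are smooth at each vector: with a basis of a
finite-dimensional source, the operator is a sum of rank one operators that depend linearly
on the values at the basis vectors.\<close>

lemma Ck_on_blinfunI:
  fixes f :: "'e::euclidean_space \<Rightarrow> 'd::euclidean_space \<Rightarrow>\<^sub>L 'f::real_normed_vector"
  assumes "open S" "\<And>v. Ck_on k S (\<lambda>x. f x v)"
  shows "Ck_on k S f"
proof -
  define L :: "'d \<Rightarrow> 'f \<Rightarrow> 'd \<Rightarrow>\<^sub>L 'f" where "L = (\<lambda>i w. blinfun_scaleR_left w o\<^sub>L blinfun_inner_left i)"
  have L: "bounded_linear (L i)" for i
    unfolding L_def
    by (rule bounded_linear_compose[OF bounded_bilinear.bounded_linear_left[OF bounded_bilinear_blinfun_compose]])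
       (rule bounded_linear_blinfun_scaleR_left)
  have "f x = (\<Sum>i\<in>Basis. L i (f x i))" for x
  proof (rule blinfun_eqI)
    fix v
    have "f x v = (\<Sum>i\<in>Basis. (v \<bullet> i) *\<^sub>R f x i)"
      by (rule linear_euclidean_expansion) (simp add: blinfun.bounded_linear_right bounded_linear.linear)
    then show "f x v = (\<Sum>i\<in>Basis. L i (f x i)) v"
      by (simp add: blinfun.sum_left L_def inner_commute)
  qed
  moreover have "Ck_on k S (\<lambda>x. \<Sum>i\<in>Basis. L i (f x i))"
    using assms by (intro Ck_on_sum Ck_on_bounded_linear[OF L])
  ultimately show ?thesis by (simp add: Ck_on_cong[OF \<open>open S\<close>])
qed

section \<open>Pointwise smoothness\<close>

text \<open>On a manifold, smoothness is tested chart by chart and point by point. A notion attached to a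
point makes the domains of coordinate expressions disappear from the statements: only equality
near the point matters.\<close>

definition smooth_near :: "('e::euclidean_space \<Rightarrow> 'f::real_normed_vector) \<Rightarrow> 'e \<Rightarrow> bool" where
  "smooth_near f x \<longleftrightarrow> (\<exists>T. open T \<and> x \<in> T \<and> smooth_on T f)"

lemma smooth_on_iff_near:
  assumes "open S"
  shows "smooth_on S f \<longleftrightarrow> (\<forall>x\<in>S. smooth_near f x)"
proof
  assume "smooth_on S f" then show "\<forall>x\<in>S. smooth_near f x"
    using assms unfolding smooth_near_def by blast
next
  assume "\<forall>x\<in>S. smooth_near f x"
  then show "smooth_on S f"
    unfolding smooth_on_def smooth_near_def by (intro allI Ck_on_local) blast
qed

lemma smooth_near_cong:
  assumes "smooth_near f x" "\<forall>\<^sub>F y in nhds x. f y = g y"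
  shows "smooth_near g x"
proof -
  obtain T where T: "open T" "x \<in> T" "smooth_on T f" using assms smooth_near_def by auto
  obtain U where U: "open U" "x \<in> U" "\<forall>y\<in>U. f y = g y" using assms(2) unfolding eventually_nhds by auto
  have "smooth_on (T \<inter> U) g"
    unfolding smooth_on_def
  proof
    show "Ck_on k (T \<inter> U) g" for k
      by (rule Ck_on_cong[OF _ Ck_on_subset[of k T f]]) (use T U in \<open>auto simp: smooth_on_def\<close>)
  qed
  then show ?thesis unfolding smooth_near_def using T U by (intro exI[of _ "T \<inter> U"]) auto
qed

lemma smooth_near_eventually: "smooth_near f x \<Longrightarrow> \<forall>\<^sub>F y in nhds x. smooth_near f y"
  unfolding smooth_near_def eventually_nhds by blast

lemma smooth_on_differentiable: "smooth_on S f \<Longrightarrow> x \<in> S \<Longrightarrow> f differentiable at x"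
  unfolding smooth_on_def by (drule spec[of _ "Suc 0"]) (simp only: Ck_on_Suc)

lemma smooth_on_derivative_const:
  "smooth_on S f \<Longrightarrow> smooth_on S (\<lambda>x. fderiv f x v)"
  unfolding smooth_on_def
proof
  show "Ck_on k S (\<lambda>x. fderiv f x v)" if "\<forall>k. Ck_on k S f" for k
    using that[rule_format, of "Suc k"] by (simp only: Ck_on_Suc)
qed

lemma smooth_near_differentiable: "smooth_near f x \<Longrightarrow> f differentiable at x"
  unfolding smooth_near_def using smooth_on_differentiable by blast

lemma smooth_near_has_derivative:
  "smooth_near f x \<Longrightarrow> (f has_derivative fderiv f x) (at x)"
  using smooth_near_differentiable frechet_derivative_works by blast

lemma smooth_near_isCont: "smooth_near f x \<Longrightarrow> isCont f x"
  using smooth_near_differentiable differentiable_imp_continuous_within by blast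

lemma smooth_near_derivative_const:
  "smooth_near f x \<Longrightarrow> smooth_near (\<lambda>y. fderiv f y v) x"
  unfolding smooth_near_def using smooth_on_derivative_const by blast

lemma smooth_near_const [simp, intro]: "smooth_near (\<lambda>x. c) x"
  unfolding smooth_near_def smooth_on_def by (intro exI[of _ UNIV]) simp

lemma smooth_near_linear: "bounded_linear f \<Longrightarrow> smooth_near f x"
  unfolding smooth_near_def smooth_on_def by (intro exI[of _ UNIV]) (simp add: Ck_on_linear)

lemma smooth_near_ident [simp, intro]: "smooth_near (\<lambda>x. x) x"
  by (rule smooth_near_linear) (rule bounded_linear_ident)

lemma smooth_near_bilinear:
  assumes "bounded_bilinear b" "smooth_near f x" "smooth_near g x"
  shows "smooth_near (\<lambda>y. b (f y) (g y)) x"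
proof -
  obtain T U where "open T" "x \<in> T" "smooth_on T f" "open U" "x \<in> U" "smooth_on U g"
    using assms smooth_near_def by metis
  then show ?thesis
    unfolding smooth_near_def smooth_on_def
    by (intro exI[of _ "T \<inter> U"]) (auto intro!: Ck_on_bilinear[OF assms(1)] intro: Ck_on_subset)
qed

lemma smooth_near_add:
  assumes "smooth_near f x" "smooth_near g x"
  shows "smooth_near (\<lambda>y. f y + g y) x"
proof -
  obtain T U where "open T" "x \<in> T" "smooth_on T f" "open U" "x \<in> U" "smooth_on U g"
    using assms smooth_near_def by metis
  then show ?thesis
    unfolding smooth_near_def smooth_on_def
    by (intro exI[of _ "T \<inter> U"]) (auto intro!: Ck_on_add intro: Ck_on_subset)
qed

lemma smooth_near_compose:
  assumes "smooth_near g (f x)" "smooth_near f x"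
  shows "smooth_near (\<lambda>y. g (f y)) x"
proof -
  obtain T where T: "open T" "x \<in> T" "smooth_on T f" using assms smooth_near_def by metis
  obtain U where U: "open U" "f x \<in> U" "smooth_on U g" using assms smooth_near_def by metis
  have c: "continuous_on T f" using T Ck_on_continuous smooth_on_def by blast
  have "open (T \<inter> f -` U)" using c T U by (simp add: continuous_on_open_vimage inf_commute)
  moreover have "Ck_on k (T \<inter> f -` U) (\<lambda>y. g (f y))" for k
    by (rule Ck_on_compose[OF calculation U(1), of k g f])
      (use T U in \<open>auto simp: smooth_on_def intro: Ck_on_subset[of k T f]\<close>)
  then have "smooth_on (T \<inter> f -` U) (\<lambda>y. g (f y))" unfolding smooth_on_def by blast
  ultimately show ?thesis
    unfolding smooth_near_def using T U by blast
qed

lemma smooth_near_bounded_linear: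
  "bounded_linear L \<Longrightarrow> smooth_near f x \<Longrightarrow> smooth_near (\<lambda>y. L (f y)) (x :: 'e::euclidean_space)"
  unfolding smooth_near_def smooth_on_def using Ck_on_bounded_linear by blast

lemma smooth_near_scaleR:
  "smooth_near f x \<Longrightarrow> smooth_near g x \<Longrightarrow> smooth_near (\<lambda>y. f y *\<^sub>R g y) x"
  by (rule smooth_near_bilinear[OF bounded_bilinear_scaleR])

lemma smooth_near_minus: "smooth_near f x \<Longrightarrow> smooth_near (\<lambda>y. - f y) x"
  by (rule smooth_near_bounded_linear[OF bounded_linear_minus[OF bounded_linear_ident]])

lemma smooth_near_diff:
  "smooth_near f x \<Longrightarrow> smooth_near g x \<Longrightarrow> smooth_near (\<lambda>y. f y - g y) x"
  using smooth_near_add[OF _ smooth_near_minus, of f x g] by simp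

lemma smooth_near_sum:
  "(\<And>i. i \<in> I \<Longrightarrow> smooth_near (f i) x) \<Longrightarrow> smooth_near (\<lambda>y. \<Sum>i\<in>I. f i y) x"
  by (induction I rule: infinite_finite_induct) (auto intro: smooth_near_add)

lemma smooth_near_blinfunI:
  fixes f :: "'e::euclidean_space \<Rightarrow> 'd::euclidean_space \<Rightarrow>\<^sub>L 'f::real_normed_vector"
  assumes "\<And>v. smooth_near (\<lambda>x. f x v) x"
  shows "smooth_near f x"
proof -
  have "\<exists>T. open T \<and> x \<in> T \<and> smooth_on T (\<lambda>x. f x i)" for i
    using assms smooth_near_def by metis
  then obtain T where T: "\<And>i. open (T i)" "\<And>i. x \<in> T i" "\<And>i. smooth_on (T i) (\<lambda>x. f x i)" by metis
  define U where "U = (\<Inter>i\<in>Basis. T i)"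
  have U: "open U" "x \<in> U" using T by (auto simp: U_def)
  have i: "Ck_on k U (\<lambda>x. f x i)" if "i \<in> Basis" for i k
    using T(3)[of i] that unfolding smooth_on_def U_def by (blast intro: Ck_on_subset)
  have "Ck_on k U (\<lambda>x. f x v)" for v k
  proof -
    have "f x v = (\<Sum>i\<in>Basis. (v \<bullet> i) *\<^sub>R f x i)" for x
      by (rule linear_euclidean_expansion) (simp add: blinfun.bounded_linear_right bounded_linear.linear)
    then show ?thesis
      using i U by (auto intro!: Ck_on_sum Ck_on_bounded_linear[OF bounded_linear_scaleR_right])
  qed
  then have "smooth_on U f"
    unfolding smooth_on_def by (intro allI Ck_on_blinfunI[OF U(1)])
  then show ?thesis
    unfolding smooth_near_def using U by blast
qed

text \<open>The coordinate expression of a pushed forward vector field has this form, with base point and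
vector both varying.\<close>

lemma smooth_near_derivative:
  assumes "smooth_near f (a x)" "smooth_near a x" "smooth_near w x"
  shows "smooth_near (\<lambda>y. fderiv f (a y) (w y)) x"
proof (rule smooth_near_cong)
  show "smooth_near (\<lambda>y. \<Sum>i\<in>Basis. (w y \<bullet> i) *\<^sub>R fderiv f (a y) i) x"
  proof (intro smooth_near_sum smooth_near_scaleR)
    fix i
    show "smooth_near (\<lambda>y. fderiv f (a y) i) x"
      by (rule smooth_near_compose[of "\<lambda>z. fderiv f z i" a,
          OF smooth_near_derivative_const[OF assms(1)] assms(2)])
    show "smooth_near (\<lambda>y. w y \<bullet> i) x"
      by (rule smooth_near_bounded_linear[OF bounded_linear_inner_left assms(3)])
  qed
  have "\<forall>\<^sub>F y in nhds x. smooth_near f (a y)"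
    using eventually_compose_filterlim[OF smooth_near_eventually[OF assms(1)]]
      smooth_near_isCont[OF assms(2)] by (simp add: isCont_def tendsto_at_iff_tendsto_nhds)
  then show "\<forall>\<^sub>F y in nhds x. (\<Sum>i\<in>Basis. (w y \<bullet> i) *\<^sub>R fderiv f (a y) i)
      = fderiv f (a y) (w y)"
    by (rule eventually_mono) (metis frechet_derivative_expansion smooth_near_differentiable)
qed

section \<open>Symmetry of second derivatives\<close>

text \<open>The second difference of \<open>f\<close> over the parallelogram spanned by \<open>h v\<close> and \<open>h w\<close> is
symmetric in \<open>v\<close> and \<open>w\<close>; two applications of the mean value theorem turn it into the mixed
second derivative at some point of the parallelogram.\<close>

lemma second_difference_mvt:
  fixes f :: "'e::euclidean_space \<Rightarrow> real"
  assumes "0 < h" and sm: "\<And>y. norm (y - x) \<le> h * (norm v + norm w) \<Longrightarrow> smooth_near f y"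
  shows "\<exists>y. norm (y - x) \<le> h * (norm v + norm w) \<and>
    f (x + h *\<^sub>R v + h *\<^sub>R w) - f (x + h *\<^sub>R v) - f (x + h *\<^sub>R w) + f x
      = h * h * fderiv (\<lambda>z. fderiv f z v) y w"
proof -
  have near: "norm (x + s *\<^sub>R v + t *\<^sub>R w - x) \<le> h * (norm v + norm w)"
    if "0 \<le> s" "s \<le> h" "0 \<le> t" "t \<le> h" for s t
  proof -
    have "norm (x + s *\<^sub>R v + t *\<^sub>R w - x) = norm (s *\<^sub>R v + t *\<^sub>R w)"
      by (simp add: algebra_simps)
    also have "\<dots> \<le> norm (s *\<^sub>R v) + norm (t *\<^sub>R w)" by (rule norm_triangle_ineq)
    also have "\<dots> \<le> h * norm v + h * norm w" using that by (intro add_mono) (auto intro: mult_right_mono)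
    finally show ?thesis by (simp add: algebra_simps)
  qed
  have sm': "smooth_near f (x + s *\<^sub>R v + t *\<^sub>R w)"
    if "0 \<le> s" "s \<le> h" "0 \<le> t" "t \<le> h" for s t
    using near[OF that] sm by blast
  define Df where "Df = (\<lambda>z. fderiv f z v)"
  have d: "((\<lambda>s. f (x + s *\<^sub>R v + t *\<^sub>R w)) has_field_derivative Df (x + s *\<^sub>R v + t *\<^sub>R w)) (at s)"
    if "0 \<le> s" "s \<le> h" "0 \<le> t" "t \<le> h" for s t
  proof -
    have f: "(f has_derivative fderiv f (x + s *\<^sub>R v + t *\<^sub>R w)) (at (x + s *\<^sub>R v + t *\<^sub>R w))"
      by (rule smooth_near_has_derivative[OF sm'[OF that]])
    have "((\<lambda>s. f (x + s *\<^sub>R v + t *\<^sub>R w)) has_derivative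
       (\<lambda>r. fderiv f (x + s *\<^sub>R v + t *\<^sub>R w) (r *\<^sub>R v))) (at s)"
      by (rule has_derivative_compose[of "\<lambda>s. x + s *\<^sub>R v + t *\<^sub>R w" "\<lambda>r. r *\<^sub>R v", OF _ f])
        (auto intro!: derivative_eq_intros)
    then show ?thesis
      using linear_scale[OF linear_frechet_derivative[OF smooth_near_differentiable[OF sm'[OF that]]]]
      unfolding has_field_derivative_def Df_def by (simp add: mult_commute_abs)
  qed
  have "\<exists>s. 0 < s \<and> s < h \<and>
      (f (x + h *\<^sub>R v + h *\<^sub>R w) - f (x + h *\<^sub>R v + 0 *\<^sub>R w)) - (f (x + 0 *\<^sub>R v + h *\<^sub>R w) - f (x + 0 *\<^sub>R v + 0 *\<^sub>R w))
      = (h - 0) * (Df (x + s *\<^sub>R v + h *\<^sub>R w) - Df (x + s *\<^sub>R v + 0 *\<^sub>R w))"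
    by (rule MVT2) (use \<open>0 < h\<close> d[of _ h] d[of _ 0] in \<open>auto intro!: DERIV_diff\<close>)
  then obtain s where s: "0 < s" "s < h"
    and eq1: "f (x + h *\<^sub>R v + h *\<^sub>R w) - f (x + h *\<^sub>R v) - f (x + h *\<^sub>R w) + f x
      = h * (Df (x + s *\<^sub>R v + h *\<^sub>R w) - Df (x + s *\<^sub>R v + 0 *\<^sub>R w))"
    by (auto simp: algebra_simps)
  have d2: "((\<lambda>t. Df (x + s *\<^sub>R v + t *\<^sub>R w)) has_field_derivative
      fderiv Df (x + s *\<^sub>R v + t *\<^sub>R w) w) (at t)" if "0 \<le> t" "t \<le> h" for t
  proof -
    have sD: "smooth_near Df (x + s *\<^sub>R v + t *\<^sub>R w)"
      unfolding Df_def using s that by (intro smooth_near_derivative_const sm') auto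
    have "((\<lambda>t. Df (x + s *\<^sub>R v + t *\<^sub>R w)) has_derivative
       (\<lambda>r. fderiv Df (x + s *\<^sub>R v + t *\<^sub>R w) (r *\<^sub>R w))) (at t)"
      by (rule has_derivative_compose[of "\<lambda>t. x + s *\<^sub>R v + t *\<^sub>R w" "\<lambda>r. r *\<^sub>R w", OF _ smooth_near_has_derivative[OF sD]])
        (auto intro!: derivative_eq_intros)
    then show ?thesis
      using linear_scale[OF linear_frechet_derivative[OF smooth_near_differentiable[OF sD]]]
      unfolding has_field_derivative_def by (simp add: mult_commute_abs)
  qed
  have "\<exists>t. 0 < t \<and> t < h \<and> Df (x + s *\<^sub>R v + h *\<^sub>R w) - Df (x + s *\<^sub>R v + 0 *\<^sub>R w)
     = (h - 0) * fderiv Df (x + s *\<^sub>R v + t *\<^sub>R w) w"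
    by (rule MVT2) (use \<open>0 < h\<close> d2 in auto)
  then obtain t where t: "0 < t" "t < h" "Df (x + s *\<^sub>R v + h *\<^sub>R w) - Df (x + s *\<^sub>R v + 0 *\<^sub>R w)
     = h * fderiv Df (x + s *\<^sub>R v + t *\<^sub>R w) w"
    by auto
  show ?thesis
    by (rule exI[of _ "x + s *\<^sub>R v + t *\<^sub>R w"]) (use near[of s t] s t eq1 in \<open>auto simp: Df_def\<close>)
qed

lemma second_derivative_symmetric_real:
  fixes f :: "'e::euclidean_space \<Rightarrow> real"
  assumes "smooth_near f x"
  shows "fderiv (\<lambda>z. fderiv f z v) x w
       = fderiv (\<lambda>z. fderiv f z w) x v"
proof -
  define A where "A = (\<lambda>v w y. fderiv (\<lambda>z. fderiv f z v) y w)"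
  have cont: "isCont (A v w) x" for v w
    unfolding A_def by (intro smooth_near_isCont smooth_near_derivative_const assms)
  obtain e where e: "e > 0" "\<And>y. dist y x < e \<Longrightarrow> smooth_near f y"
    using smooth_near_eventually[OF assms] unfolding eventually_nhds_metric by blast
  have "\<bar>A v w x - A w v x\<bar> < 2 * r" if "r > 0" for r
  proof -
    obtain d1 where d1: "d1 > 0" "\<And>y. dist y x < d1 \<Longrightarrow> \<bar>A v w y - A v w x\<bar> < r"
      using cont[of v w] \<open>r > 0\<close> unfolding continuous_at_eps_delta dist_real_def by blast
    obtain d2 where d2: "d2 > 0" "\<And>y. dist y x < d2 \<Longrightarrow> \<bar>A w v y - A w v x\<bar> < r"
      using cont[of w v] \<open>r > 0\<close> unfolding continuous_at_eps_delta dist_real_def by blast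
    define d where "d = min e (min d1 d2)"
    define h where "h = d / (2 * (norm v + norm w + 1))"
    have d: "d > 0" using e d1 d2 by (simp add: d_def)
    have n: "0 < norm v + norm w + 1" using norm_ge_zero[of v] norm_ge_zero[of w] by linarith
    have h: "h > 0" unfolding h_def using d n by simp
    have "h * (norm v + norm w) \<le> h * (norm v + norm w + 1)"
      using h by (intro mult_left_mono) auto
    also have "\<dots> = d / 2" unfolding h_def using n by (simp add: field_simps)
    finally have hd: "h * (norm v + norm w) < d" using d by linarith
    have sm: "smooth_near f y" if "norm (y - x) \<le> h * (norm v + norm w)" for y
      using that hd e by (auto simp: dist_norm d_def)
    obtain y where y: "norm (y - x) \<le> h * (norm v + norm w)"
      "f (x + h *\<^sub>R v + h *\<^sub>R w) - f (x + h *\<^sub>R v) - f (x + h *\<^sub>R w) + f x = h * h * A v w y"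
      using second_difference_mvt[OF h sm] unfolding A_def by blast
    have sm': "smooth_near f y" if "norm (y - x) \<le> h * (norm w + norm v)" for y
      using sm that by (simp add: add.commute)
    obtain z where z: "norm (z - x) \<le> h * (norm w + norm v)"
      "f (x + h *\<^sub>R w + h *\<^sub>R v) - f (x + h *\<^sub>R w) - f (x + h *\<^sub>R v) + f x = h * h * A w v z"
      using second_difference_mvt[OF h sm'] unfolding A_def by blast
    have "h * h * A v w y = h * h * A w v z"
      using y(2) z(2) by (simp add: algebra_simps)
    then have "A v w y = A w v z" using h by simp
    moreover have "\<bar>A v w y - A v w x\<bar> < r" "\<bar>A w v z - A w v x\<bar> < r"
      using y(1) z(1) hd d1 d2 by (auto simp: dist_norm d_def add.commute)
    ultimately show ?thesis by linarith
  qed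
  from this[of "\<bar>A v w x - A w v x\<bar> / 2"] have "A v w x = A w v x" by force
  then show ?thesis unfolding A_def .
qed

lemma frechet_derivative_bounded_linear:
  assumes "bounded_linear L" "f differentiable at x"
  shows "fderiv (\<lambda>y. L (f y)) x v = L (fderiv f x v)"
  using frechet_derivative_at[OF bounded_linear.has_derivative[OF assms(1) frechet_derivative_worksI[OF assms(2)]]]
  by metis

lemma frechet_derivative_cong:
  assumes "\<forall>\<^sub>F y in nhds x. f y = g y"
  shows "fderiv f x = fderiv g x"
proof -
  have *: "eventually (\<lambda>y. f y = g y) (at x within UNIV)" "f x = g x"
    using assms eventually_nhds_x_imp_x by (auto simp: eventually_at_filter elim: eventually_mono)
  have "(f has_derivative D) (at x) \<longleftrightarrow> (g has_derivative D) (at x)" for D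
    using * has_derivative_transform_eventually[of f D x UNIV g]
      has_derivative_transform_eventually[of g D x UNIV f]
    by (auto simp: eq_commute)
  then show ?thesis unfolding frechet_derivative_def by simp
qed

lemma second_derivative_symmetric:
  fixes f :: "'e::euclidean_space \<Rightarrow> 'f::euclidean_space"
  assumes "smooth_near f x"
  shows "fderiv (\<lambda>z. fderiv f z v) x w
       = fderiv (\<lambda>z. fderiv f z w) x v"
proof (rule euclidean_eqI)
  fix i :: 'f assume "i \<in> Basis"
  have *: "fderiv (\<lambda>z. fderiv f z v) x w \<bullet> i =
     fderiv (\<lambda>z. fderiv (\<lambda>y. f y \<bullet> i) z v) x w" for v w
  proof -
    have "fderiv (\<lambda>z. fderiv f z v) x w \<bullet> i =
      fderiv (\<lambda>z. fderiv f z v \<bullet> i) x w"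
      by (intro frechet_derivative_bounded_linear[symmetric] bounded_linear_inner_left
          smooth_near_differentiable smooth_near_derivative_const assms)
    also have "fderiv (\<lambda>z. fderiv f z v \<bullet> i) x =
        fderiv (\<lambda>z. fderiv (\<lambda>y. f y \<bullet> i) z v) x"
      by (intro frechet_derivative_cong eventually_mono[OF smooth_near_eventually[OF assms]])
        (simp add: frechet_derivative_bounded_linear[OF bounded_linear_inner_left] smooth_near_differentiable)
    finally show ?thesis .
  qed
  show "fderiv (\<lambda>z. fderiv f z v) x w \<bullet> i =
      fderiv (\<lambda>z. fderiv f z w) x v \<bullet> i"
    unfolding * by (intro second_derivative_symmetric_real
        smooth_near_bounded_linear[OF bounded_linear_inner_left] assms)
qed

text \<open>The first summand has a fixed direction \<open>U x\<close>: it is a second derivative of \<open>F\<close>, to which symmetry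
applies.\<close>

lemma frechet_derivative_derivative_apply:
  assumes "smooth_near F x" "smooth_near U x"
  shows "fderiv (\<lambda>y. fderiv F y (U y)) x w =
    fderiv (\<lambda>y. fderiv F y (U x)) x w
    + fderiv F x (fderiv U x w)"
proof -
  let ?G = "\<lambda>u y. \<Sum>i\<in>Basis. (u y \<bullet> i) *\<^sub>R fderiv F y i"
  let ?H = "\<lambda>U w. \<Sum>i\<in>Basis. (U x \<bullet> i) *\<^sub>R fderiv (\<lambda>y. fderiv F y i) x w
          + (fderiv U x w \<bullet> i) *\<^sub>R fderiv F x i"
  have *: "fderiv (\<lambda>y. fderiv F y (U y)) x w = ?H U w"
    if U: "smooth_near U x" for U
  proof -
    have G: "?H U = fderiv (?G U) x"
      by (intro frechet_derivative_at has_derivative_sum has_derivative_scaleR has_derivative_inner_left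
          smooth_near_has_derivative U smooth_near_derivative_const assms)
    have "fderiv (\<lambda>y. fderiv F y (U y)) x = fderiv (?G U) x"
      by (intro frechet_derivative_cong eventually_mono[OF smooth_near_eventually[OF assms(1)]]
          frechet_derivative_expansion smooth_near_differentiable)
    then show ?thesis unfolding G[symmetric] by (rule fun_cong)
  qed
  have E: "fderiv F x (fderiv U x w)
      = (\<Sum>i\<in>Basis. (fderiv U x w \<bullet> i) *\<^sub>R fderiv F x i)"
    by (rule frechet_derivative_expansion[OF smooth_near_differentiable[OF assms(1)]])
  show ?thesis
    using *[OF assms(2)] *[OF smooth_near_const, of "U x"] E
    by (simp only: sum.distrib) simp
qed

text \<open>Naturality of the coordinate bracket: the second derivatives of \<open>F\<close> that appear when
\<open>DF U\<close> and \<open>DF W\<close> are differentiated cancel by symmetry. This one identity gives the independence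
of the Lie bracket of the chart, its naturality under immersions, and hence the vanishing of
the torsion of the pullback connection.\<close>

lemma pushed_bracket:
  fixes F :: "'e::euclidean_space \<Rightarrow> 'f::euclidean_space"
  assumes "smooth_near F x" "smooth_near U x" "smooth_near W x"
  shows "fderiv (\<lambda>y. fderiv F y (U y)) x (W x)
       - fderiv (\<lambda>y. fderiv F y (W y)) x (U x)
     = fderiv F x (fderiv U x (W x) - fderiv W x (U x))"
  unfolding frechet_derivative_derivative_apply[OF assms(1,2), of "W x"]
    frechet_derivative_derivative_apply[OF assms(1,3), of "U x"]
    second_derivative_symmetric[OF assms(1), of "U x" "W x"]
    linear_diff[OF linear_frechet_derivative[OF smooth_near_differentiable[OF assms(1)]]]
  by simp

section \<open>Bump functions\<close>

text \<open>The functions \<open>t\<^sup>-\<^sup>n exp (- 1/t)\<close> for \<open>t > 0\<close>, extended by zero. The derivative of one of them is a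
combination of two others, which makes them all smooth by a single induction; the case \<open>n = 0\<close>
is the usual flat function.\<close>

definition flat :: "nat \<Rightarrow> real \<Rightarrow> real" where
  "flat n t = (if t > 0 then inverse t ^ n * exp (- inverse t) else 0)"

lemma flat_tendsto_0: "(flat n \<longlongrightarrow> 0) (at 0)"
proof -
  have "((\<lambda>t. inverse t ^ n / exp (inverse t)) \<longlongrightarrow> 0) (at_right (0::real))"
    by (rule filterlim_compose[OF tendsto_power_div_exp_0 filterlim_inverse_at_top_right])
  then have r: "(flat n \<longlongrightarrow> 0) (at_right 0)"
    by (rule Lim_transform_eventually)
      (auto simp: flat_def exp_minus field_simps eventually_at_filter)
  have "(flat n \<longlongrightarrow> 0) (at_left 0)"
    by (rule Lim_transform_eventually[OF tendsto_const]) (auto simp: flat_def eventually_at_filter)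
  with r show ?thesis by (simp add: filterlim_split_at)
qed

lemma flat_has_derivative:
  "(flat n has_field_derivative flat (n + 2) t - n * flat (n + 1) t) (at t)"
proof -
  consider "t > 0" | "t = 0" | "t < 0" by linarith
  then show ?thesis
  proof cases
    case 1
    have "((\<lambda>t. inverse t ^ n * exp (- inverse t)) has_field_derivative flat (n + 2) t - n * flat (n + 1) t) (at t)"
      using 1 by (auto intro!: derivative_eq_intros simp: flat_def field_simps power2_eq_square)
        (cases n; simp add: field_simps)
    then show ?thesis
      by (rule DERIV_cong_ev[THEN iffD1, rotated -1])
        (use 1 in \<open>auto simp: flat_def eventually_nhds intro!: exI[of _ "{0<..}"]\<close>)
  next
    case 2
    \<comment> \<open>the difference quotient at zero is the next function of the family\<close>
    have "flat n h / h = flat (n + 1) h" for h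
      by (auto simp: flat_def field_simps)
    then have "(flat n has_field_derivative 0) (at 0)" using flat_tendsto_0[of "n + 1"]
      unfolding DERIV_def by (simp add: flat_def[of n 0])
    then show ?thesis unfolding 2 by (simp add: flat_def[of _ 0])
  next
    case 3
    have "((\<lambda>t. 0) has_field_derivative flat (n + 2) t - n * flat (n + 1) t) (at t)"
      using 3 by (simp add: flat_def)
    then show ?thesis
      by (rule DERIV_cong_ev[THEN iffD1, rotated -1])
        (use 3 in \<open>auto simp: flat_def eventually_nhds intro!: exI[of _ "{..<0}"]\<close>)
  qed
qed

lemma Ck_on_flat: "Ck_on k UNIV (flat n)"
proof (induction k arbitrary: n)
  case 0
  show ?case
    using flat_has_derivative by (auto intro!: continuous_at_imp_continuous_on DERIV_isCont)
next
  case (Suc k)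
  show ?case
  proof (rule Ck_on_SucI)
    show "(flat n has_derivative (*) (flat (n + 2) t - n * flat (n + 1) t)) (at t)" for t
      using flat_has_derivative[of n t] by (simp only: has_field_derivative_def)
    have "Ck_on k UNIV (\<lambda>t. v *\<^sub>R (flat (n + 2) t + (- real n) *\<^sub>R flat (n + 1) t))" for v
      by (intro Ck_on_bounded_linear[OF bounded_linear_scaleR_right] Ck_on_add Suc.IH open_UNIV)
    moreover have "(flat (n + 2) t - n * flat (n + 1) t) * v
        = v *\<^sub>R (flat (n + 2) t + (- real n) *\<^sub>R flat (n + 1) t)" for t v
      by (simp only: real_scaleR_def) algebra
    ultimately show "Ck_on k UNIV (\<lambda>t. (flat (n + 2) t - n * flat (n + 1) t) * v)" for v
      by (simp only:)
  qed simp
qed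

lemma smooth_near_flat: "smooth_near (flat n) t"
  unfolding smooth_near_def smooth_on_def by (intro exI[of _ UNIV]) (simp add: Ck_on_flat)

text \<open>With \<open>f\<close> the flat function, \<open>K f (e\<^sup>2 - |x - x0|\<^sup>2)\<close> vanishes outside the ball and is at least one near
\<open>x0\<close> for large \<open>K\<close>. Hence \<open>f (1 - K f (e\<^sup>2 - |x - x0|\<^sup>2))\<close> is constantly \<open>f 1\<close> outside the ball and zero
near \<open>x0\<close>, and the bump function arises from it without any division of functions.\<close>

lemma bump_exists:
  fixes x0 :: "'e::euclidean_space"
  assumes "0 < e"
  obtains \<rho> :: "'e \<Rightarrow> real" where "\<And>x. smooth_near \<rho> x" "\<forall>\<^sub>F x in nhds x0. \<rho> x = 1"
    "\<And>x. x \<notin> ball x0 e \<Longrightarrow> \<rho> x = 0"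
proof
  define q where "q = (\<lambda>x. (x - x0) \<bullet> (x - x0))"
  define K where "K = inverse (flat 0 (e\<^sup>2 / 2))"
  define \<rho> where "\<rho> = (\<lambda>x. 1 - inverse (flat 0 1) *\<^sub>R flat 0 (1 - K *\<^sub>R flat 0 (e\<^sup>2 - q x)))"
  have q: "smooth_near q x" for x
    unfolding q_def by (intro smooth_near_bilinear[OF bounded_bilinear_inner] smooth_near_diff) auto
  have "smooth_near (\<lambda>x. flat 0 (e\<^sup>2 - q x)) x" for x
    by (rule smooth_near_compose[OF smooth_near_flat smooth_near_diff[OF smooth_near_const q]])
  then have "smooth_near (\<lambda>x. 1 - K *\<^sub>R flat 0 (e\<^sup>2 - q x)) x" for x
    by (rule smooth_near_diff[OF smooth_near_const smooth_near_scaleR[OF smooth_near_const]])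
  then have "smooth_near (\<lambda>x. flat 0 (1 - K *\<^sub>R flat 0 (e\<^sup>2 - q x))) x" for x
    by (rule smooth_near_compose[OF smooth_near_flat])
  then show "smooth_near \<rho> x" for x
    unfolding \<rho>_def by (rule smooth_near_diff[OF smooth_near_const smooth_near_scaleR[OF smooth_near_const]])
  have K: "K * flat 0 s \<ge> 1" if "s \<ge> e\<^sup>2 / 2" for s
  proof -
    have "0 < e\<^sup>2 / 2" using assms by simp
    then have "inverse s \<le> inverse (e\<^sup>2 / 2)" "0 < s"
      using that le_imp_inverse_le[OF that] by linarith+
    then have "flat 0 (e\<^sup>2 / 2) \<le> flat 0 s" "flat 0 (e\<^sup>2 / 2) > 0"
      using assms by (auto simp: flat_def)
    then show ?thesis unfolding K_def by (simp add: field_simps)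
  qed
  have "\<rho> x = 1" if "dist x x0 < e / 2" for x
  proof -
    have "q x = (dist x x0)\<^sup>2" by (simp add: q_def dist_norm power2_norm_eq_inner)
    also have "\<dots> \<le> (e / 2)\<^sup>2" using that by (intro power_mono) auto
    also have "\<dots> \<le> e\<^sup>2 / 2" by (simp add: power2_eq_square)
    finally have "K * flat 0 (e\<^sup>2 - q x) \<ge> 1" by (intro K) simp
    then show ?thesis by (simp add: \<rho>_def flat_def[of 0 "1 - _"])
  qed
  then show "\<forall>\<^sub>F x in nhds x0. \<rho> x = 1"
    unfolding eventually_nhds_metric using assms by (intro exI[of _ "e / 2"]) auto
  show "\<rho> x = 0" if "x \<notin> ball x0 e" for x
  proof -
    have "q x = (dist x x0)\<^sup>2" by (simp add: q_def dist_norm power2_norm_eq_inner)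
    also have "\<dots> \<ge> e\<^sup>2" using that assms by (intro power_mono) (auto simp: dist_commute)
    finally have "flat 0 (e\<^sup>2 - q x) = 0" by (simp add: flat_def)
    then show ?thesis by (simp add: \<rho>_def) (simp add: flat_def)
  qed
qed

section \<open>Smooth inversion of operators\<close>

text \<open>A product is differentiable already if one factor is only continuous, provided that the other
one vanishes at the point.\<close>

lemma has_derivative_vanishing_factor:
  assumes "bounded_bilinear b" "isCont f x" "(g has_derivative g') (at x)" "g x = 0"
  shows "((\<lambda>y. b (f y) (g y)) has_derivative (\<lambda>v. b (f x) (g' v))) (at x)"
proof -
  interpret b: bounded_bilinear b by fact
  obtain K where K: "K > 0" "\<And>u v. norm (b u v) \<le> norm u * norm v * K"
    using b.pos_bounded by blast
  obtain G where G: "\<And>v. norm (g' v) \<le> norm v * G" "G > 0"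
    using bounded_linear.pos_bounded[OF has_derivative_bounded_linear[OF assms(3)]] by blast
  have "((\<lambda>y. b (f y - f x) (g y) + b (f x) (g y)) has_derivative (\<lambda>v. 0 + b (f x) (g' v))) (at x)"
  proof (rule has_derivative_add)
    show "((\<lambda>y. b (f x) (g y)) has_derivative (\<lambda>v. b (f x) (g' v))) (at x)"
      by (rule bounded_linear.has_derivative[OF b.bounded_linear_right assms(3)])
    show "((\<lambda>y. b (f y - f x) (g y)) has_derivative (\<lambda>v. 0)) (at x)"
      unfolding has_derivative_within_alt2[of _ _ x UNIV]
    proof (intro conjI allI impI)
      fix e :: real assume e: "e > 0"
      define d where "d = e / (K * (G + 1))"
      have d: "d > 0" "d * (K * (G + 1)) = e" unfolding d_def using e K(1) G(2) by simp_all
      have "\<forall>\<^sub>F y in at x. norm (f y - f x) < d"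
        using assms(2) d(1) unfolding isCont_def tendsto_iff dist_norm by simp
      moreover have "\<forall>\<^sub>F y in at x. norm (g y - g x - g' (y - x)) \<le> 1 * norm (y - x)"
        using assms(3) unfolding has_derivative_within_alt2 by (meson zero_less_one)
      ultimately show "\<forall>\<^sub>F y in at x. norm (b (f y - f x) (g y) - b (f x - f x) (g x) - 0) \<le> e * norm (y - x)"
      proof eventually_elim
        case (elim y)
        have "norm (g y) \<le> norm (g y - g x - g' (y - x)) + norm (g' (y - x))"
          using norm_triangle_ineq[of "g y - g x - g' (y - x)" "g' (y - x)"] assms(4) by simp
        also have "\<dots> \<le> (G + 1) * norm (y - x)" using elim(2) G(1)[of "y - x"] by (simp add: algebra_simps)
        finally have g: "norm (g y) \<le> (G + 1) * norm (y - x)" .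
        have "norm (b (f y - f x) (g y)) \<le> norm (f y - f x) * norm (g y) * K" by (rule K(2))
        also have "\<dots> \<le> (d * ((G + 1) * norm (y - x))) * K"
          using elim(1) g K(1) G(2) d(1) by (intro mult_right_mono mult_mono) auto
        also have "\<dots> = e * norm (y - x)" unfolding d(2)[symmetric] by (simp only: mult.assoc mult.commute mult.left_commute)
        finally show ?case by (simp add: assms(4) b.zero_right)
      qed
    qed simp
  qed
  then show ?thesis by (simp add: b.diff_left)
qed

text \<open>From \<open>R y - R x = - R y (A y - A x) R x\<close> for the inverses \<open>R x\<close> of \<open>A x\<close> one reads off first the continuity of \<open>R\<close>,
then its derivative \<open>- R A' R\<close>, and from this formula its smoothness by induction.\<close>

lemma smooth_near_inverse_operator:
  fixes A :: "'e::euclidean_space \<Rightarrow> 'n::euclidean_space \<Rightarrow>\<^sub>L 'n"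
  assumes A: "smooth_near A x0" "A x0 = id_blinfun"
  obtains R :: "'e \<Rightarrow> 'n \<Rightarrow>\<^sub>L 'n" where "smooth_near R x0"
    "\<forall>\<^sub>F x in nhds x0. (\<forall>v. A x (R x v) = v) \<and> (\<forall>v. R x (A x v) = v)"
proof -
  obtain T0 where T0: "open T0" "x0 \<in> T0" "smooth_on T0 A" using A(1) smooth_near_def by metis
  have "(A \<longlongrightarrow> id_blinfun) (nhds x0)"
    using smooth_near_isCont[OF A(1)] A(2) tendsto_at_iff_tendsto_nhds[of A x0] by (simp add: isCont_def)
  then have "\<forall>\<^sub>F x in nhds x0. dist (A x) id_blinfun < 1 / 2" by (rule tendstoD) simp
  then obtain T1 where T1: "open T1" "x0 \<in> T1" "\<And>x. x \<in> T1 \<Longrightarrow> dist (A x) id_blinfun < 1 / 2"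
    unfolding eventually_nhds by blast
  define T where "T = T0 \<inter> T1"
  have T: "open T" "x0 \<in> T" using T0 T1 by (auto simp: T_def)
  have AT: "Ck_on k T A" for k using T0(3) unfolding smooth_on_def T_def by (blast intro: Ck_on_subset)
  have low: "norm v \<le> 2 * norm (A x v)" if "x \<in> T" for x v
  proof -
    have "norm (A x v - v) = norm ((A x - id_blinfun) v)" by (simp add: blinfun.diff_left)
    also have "\<dots> \<le> norm (A x - id_blinfun) * norm v" by (rule norm_blinfun)
    also have "\<dots> \<le> 1 / 2 * norm v"
      using T1(3)[of x] that by (intro mult_right_mono) (auto simp: T_def dist_norm)
    finally show ?thesis using norm_triangle_sub[of v "A x v"] by (simp add: norm_minus_commute)
  qed
  have bij: "bij (blinfun_apply (A x))" if "x \<in> T" for x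
  proof -
    have l: "linear (blinfun_apply (A x))" by (simp add: blinfun.bounded_linear_right bounded_linear.linear)
    have "inj (blinfun_apply (A x))"
      unfolding linear_injective_0[OF l]
    proof (intro allI impI)
      fix v assume "A x v = 0" then show "v = 0" using low[OF that, of v] by simp
    qed
    then show ?thesis using linear_injective_imp_surjective[OF l] by (simp add: bij_def)
  qed
  define R where "R = (\<lambda>x. Blinfun (inv (blinfun_apply (A x))))"
  have R: "blinfun_apply (R x) = inv (blinfun_apply (A x))" if "x \<in> T" for x
  proof -
    have "linear (inv (blinfun_apply (A x)))"
      using bij[OF that] blinfun.bounded_linear_right[THEN bounded_linear.linear]
      by (intro inj_linear_imp_inv_linear) (auto simp: bij_def)
    then show ?thesis
      unfolding R_def by (intro bounded_linear_Blinfun_apply) (simp add: linear_conv_bounded_linear)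
  qed
  have AR: "A x (R x v) = v" "R x (A x v) = v" if "x \<in> T" for x v
    using bij[OF that] by (simp_all add: R[OF that] bij_def surj_f_inv_f)
  have Rn: "norm (R x) \<le> 2" if "x \<in> T" for x
    by (rule norm_blinfun_bound) (use low[OF that, of "R x _"] AR(1)[OF that] in auto)
  have step: "R y = R x - (R y o\<^sub>L ((A y - A x) o\<^sub>L R x))" if "x \<in> T" "y \<in> T" for x y
    by (rule blinfun_eqI) (simp add: blinfun.diff_left blinfun.diff_right AR that)
  have ev: "\<forall>\<^sub>F y in nhds x. R y = R x - (R y o\<^sub>L ((A y - A x) o\<^sub>L R x))" if "x \<in> T" for x
    using step that T(1) unfolding eventually_nhds by blast
  have Rcont: "isCont R x" if x: "x \<in> T" for x
  proof -
    have A': "isCont A x" using Ck_on_continuous[OF AT] T(1) x by (simp add: continuous_on_eq_continuous_at)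
    have "(R \<longlongrightarrow> R x) (at x)"
    proof (rule LIM_zero_cancel, rule Lim_null_comparison)
      have "\<forall>\<^sub>F y in at x. y \<in> T" using T(1) x by (auto simp: eventually_at_topological)
      then show "\<forall>\<^sub>F y in at x. norm (R y - R x) \<le> 4 * norm (A y - A x)"
      proof eventually_elim
        case (elim y)
        have "norm (R y - R x) = norm (R y o\<^sub>L ((A y - A x) o\<^sub>L R x))"
          using step[OF x elim] by (metis add_diff_cancel_left' diff_add_cancel norm_minus_commute)
        also have "\<dots> \<le> norm (R y) * (norm (A y - A x) * norm (R x))"
          by (intro order_trans[OF norm_blinfun_compose] mult_left_mono norm_blinfun_compose norm_ge_zero)
        also have "\<dots> \<le> 2 * (norm (A y - A x) * 2)"
          using Rn[OF elim] Rn[OF x] by (intro mult_mono) auto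
        finally show ?case by simp
      qed
      show "((\<lambda>y. 4 * norm (A y - A x)) \<longlongrightarrow> 0) (at x)"
        using A' unfolding isCont_def by (auto intro!: tendsto_eq_intros)
    qed
    then show ?thesis by (simp add: isCont_def)
  qed
  define DA where "DA = (\<lambda>x. fderiv A x)"
  have Rder: "(R has_derivative (\<lambda>v. - (R x o\<^sub>L (DA x v o\<^sub>L R x)))) (at x)" if x: "x \<in> T" for x
  proof -
    have "(A has_derivative DA x) (at x)"
      using AT[of "Suc 0"] x unfolding DA_def by (simp add: frechet_derivative_worksI)
    then have "((\<lambda>y. A y - A x) has_derivative (\<lambda>v. DA x v - 0)) (at x)"
      by (intro has_derivative_diff has_derivative_const)
    then have "((\<lambda>y. (A y - A x) o\<^sub>L R x) has_derivative (\<lambda>v. (DA x v - 0) o\<^sub>L R x)) (at x)"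
      by (rule bounded_linear.has_derivative[OF bounded_bilinear.bounded_linear_left[OF bounded_bilinear_blinfun_compose]])
    then have "((\<lambda>y. R y o\<^sub>L ((A y - A x) o\<^sub>L R x)) has_derivative (\<lambda>v. R x o\<^sub>L ((DA x v - 0) o\<^sub>L R x))) (at x)"
      by (rule has_derivative_vanishing_factor[OF bounded_bilinear_blinfun_compose Rcont[OF x]]) simp
    from has_derivative_diff[OF has_derivative_const[of "R x"] this]
    have "((\<lambda>y. R x - (R y o\<^sub>L ((A y - A x) o\<^sub>L R x))) has_derivative (\<lambda>v. - (R x o\<^sub>L (DA x v o\<^sub>L R x)))) (at x)" by simp
    then show ?thesis
    proof (rule has_derivative_transform_within_open[OF _ T(1) x])
      show "R x - (R y o\<^sub>L ((A y - A x) o\<^sub>L R x)) = R y" if "y \<in> T" for y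
        using step[OF x that] by (rule sym)
    qed
  qed
  have "Ck_on k T R" for k
  proof (induction k)
    case 0
    show ?case using Rcont by (auto intro: continuous_at_imp_continuous_on)
  next
    case (Suc k)
    show ?case
    proof (rule Ck_on_SucI[OF T(1) Rder])
      fix v
      have "Ck_on k T (\<lambda>x. DA x v)" using AT[of "Suc k"] unfolding DA_def by simp
      then have "Ck_on k T (\<lambda>x. R x o\<^sub>L (DA x v o\<^sub>L R x))"
        by (intro Ck_on_bilinear[OF bounded_bilinear_blinfun_compose T(1)] Suc.IH)
      then show "Ck_on k T (\<lambda>x. - (R x o\<^sub>L (DA x v o\<^sub>L R x)))"
        by (rule Ck_on_bounded_linear[OF bounded_linear_minus[OF bounded_linear_ident] T(1)])
    qed
  qed
  then have "smooth_near R x0" unfolding smooth_near_def smooth_on_def using T by blast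
  moreover have "\<forall>\<^sub>F x in nhds x0. (\<forall>v. A x (R x v) = v) \<and> (\<forall>v. R x (A x v) = v)"
    using AR T unfolding eventually_nhds by blast
  ultimately show thesis using that by blast
qed

section \<open>Adapted frames\<close>

text \<open>As many vectors as the dimension of their span are distinct and linearly independent, so that
they have dual functionals.\<close>

lemma dual_functionals:
  fixes v :: "nat \<Rightarrow> 'n::euclidean_space"
  assumes "dim (span (v ` {..<r})) = r"
  obtains \<alpha> :: "nat \<Rightarrow> 'n \<Rightarrow> real" where "\<And>j. linear (\<alpha> j)"
    "\<And>i j. i < r \<Longrightarrow> j < r \<Longrightarrow> \<alpha> j (v i) = (if i = j then 1 else 0)"
proof -
  let ?V = "v ` {..<r}"
  have "r \<le> card ?V" using assms by (metis dim_le_card' dim_span finite_imageI finite_lessThan)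
  moreover have c: "card ?V \<le> r" using card_image_le[of "{..<r}" v] by simp
  ultimately have card: "card ?V = card {..<r}" by simp
  then have inj: "inj_on v {..<r}" by (intro eq_card_imp_inj_on) auto
  have "independent ?V"
    using c assms by (intro card_le_dim_spanning[of ?V "span ?V"]) (auto simp: span_base)
  then have "\<exists>g::'n \<Rightarrow> real. linear g \<and> (\<forall>x\<in>?V. g x = (if x = v j then 1 else 0))" for j
    using linear_independent_extend[of ?V "\<lambda>x. if x = v j then 1 else 0"] by blast
  then obtain \<alpha> :: "nat \<Rightarrow> 'n \<Rightarrow> real" where "\<And>j. linear (\<alpha> j)"
      "\<And>j x. x \<in> ?V \<Longrightarrow> \<alpha> j x = (if x = v j then 1 else 0)" by metis
  then show thesis using inj by (intro that[of \<alpha>]) (auto simp: inj_on_eq_iff)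
qed

text \<open>A family of subspaces with a smooth frame \<open>S\<^sub>0, ..., S\<^sub>r\<^sub>-\<^sub>1\<close> is near \<open>x0\<close> a family of graphs over its member
\<open>F\<close> at \<open>x0\<close>: for a fixed projection \<open>\<pi>\<close> onto \<open>F\<close>, the operator \<open>M x\<close> sends \<open>u \<in> F\<close> to the vector of the
subspace at \<open>x\<close> that projects to \<open>u\<close>. It is obtained by correcting the operator \<open>T x\<close> that carries the
frame at \<open>x0\<close> to the frame at \<open>x\<close> by the inverse of \<open>H x = \<pi> T x + 1 - \<pi>\<close>, which is the identity at \<open>x0\<close>.\<close>

lemma adapted_frame:
  fixes S :: "nat \<Rightarrow> 'n::euclidean_space \<Rightarrow> 'n"
  assumes S: "\<And>j. j < r \<Longrightarrow> smooth_near (S j) x0"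
    and dim: "dim (span ((\<lambda>j. S j x0) ` {..<r})) = r"
  obtains M :: "'n \<Rightarrow> 'n \<Rightarrow>\<^sub>L 'n" and \<pi> where "smooth_near M x0" "linear \<pi>" "\<And>u. \<pi> (\<pi> u) = \<pi> u"
    "\<forall>\<^sub>F x in nhds x0. (\<forall>u. \<pi> (M x u) = \<pi> u) \<and> (\<forall>u. M x (\<pi> u) = M x u)
        \<and> range (M x) = span ((\<lambda>j. S j x) ` {..<r})"
proof -
  define v where "v = (\<lambda>j. S j x0)"
  obtain \<alpha> :: "nat \<Rightarrow> 'n \<Rightarrow> real" where \<alpha>: "\<And>j. linear (\<alpha> j)"
    "\<And>i j. i < r \<Longrightarrow> j < r \<Longrightarrow> \<alpha> j (v i) = (if i = j then 1 else 0)"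
    using dual_functionals[OF dim] unfolding v_def by blast
  note lin\<alpha> = linear_add[OF \<alpha>(1)] linear_scale[OF \<alpha>(1)]
  define comb :: "(nat \<Rightarrow> 'n) \<Rightarrow> 'n \<Rightarrow> 'n" where "comb = (\<lambda>w u. \<Sum>j<r. \<alpha> j u *\<^sub>R w j)"
  have lin_comb: "linear (comb w)" for w :: "nat \<Rightarrow> 'n"
    unfolding comb_def by (rule linearI) (simp_all add: lin\<alpha> scaleR_add_left sum.distrib scaleR_sum_right)
  have comb_v: "comb w (v i) = w i" if "i < r" for w :: "nat \<Rightarrow> 'n" and i
  proof -
    have "comb w (v i) = (\<Sum>j<r. if i = j then w j else 0)"
      unfolding comb_def using that by (intro sum.cong refl) (simp add: \<alpha>(2))
    then show ?thesis using that by simp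
  qed
  have comb_span: "comb w u \<in> span (w ` {..<r})" for w :: "nat \<Rightarrow> 'n" and u
    unfolding comb_def by (intro span_sum span_scale span_base) auto
  define \<pi> where "\<pi> = comb v"
  have \<pi>_lin: "linear \<pi>" unfolding \<pi>_def by (rule lin_comb)
  have comb_\<pi>: "comb w (\<pi> u) = comb w u" for w :: "nat \<Rightarrow> 'n" and u
  proof -
    have "\<pi> u = (\<Sum>j<r. \<alpha> j u *\<^sub>R v j)" by (simp add: \<pi>_def comb_def)
    then have "comb w (\<pi> u) = (\<Sum>j<r. \<alpha> j u *\<^sub>R comb w (v j))"
      by (simp add: linear_sum[OF lin_comb] linear_scale[OF lin_comb])
    also have "\<dots> = (\<Sum>j<r. \<alpha> j u *\<^sub>R w j)" by (intro sum.cong refl) (simp add: comb_v)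
    also have "\<dots> = comb w u" by (simp add: comb_def)
    finally show ?thesis .
  qed
  have \<pi>\<pi>: "\<pi> (\<pi> u) = \<pi> u" for u using comb_\<pi>[of v u] unfolding \<pi>_def .
  have \<pi>_v: "\<pi> (v i) = v i" if "i < r" for i using comb_v[OF that, of v] unfolding \<pi>_def .
  \<comment> \<open>\<open>T x\<close> fixes the kernel of \<open>\<pi>\<close> and maps each \<open>v j\<close> to \<open>S j x\<close>; \<open>H x = \<pi> T x + 1 - \<pi>\<close>\<close>
  define T where "T = (\<lambda>x u. u + comb (\<lambda>j. S j x - v j) u)"
  define H where "H = (\<lambda>x u. u + comb (\<lambda>j. \<pi> (S j x - v j)) u)"
  have lT: "linear (T x)" and lH: "linear (H x)" for x
    unfolding T_def H_def by (auto intro!: linear_compose_add linear_ident lin_comb)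
  define Tb where "Tb = (\<lambda>x. Blinfun (T x))"
  define Hb where "Hb = (\<lambda>x. Blinfun (H x))"
  have Tb: "blinfun_apply (Tb x) = T x" and Hb: "blinfun_apply (Hb x) = H x" for x
    using lT[of x] lH[of x] unfolding Tb_def Hb_def
    by (auto intro!: bounded_linear_Blinfun_apply simp: linear_conv_bounded_linear)
  have sm: "smooth_near (\<lambda>x. L (S j x - v j)) x0" if "j < r" "linear L" for j and L :: "'n \<Rightarrow> 'n"
    by (rule smooth_near_bounded_linear[OF _ smooth_near_diff[OF S smooth_near_const]])
      (use that in \<open>auto simp: linear_conv_bounded_linear\<close>)
  have smc: "smooth_near (\<lambda>x. u + comb (\<lambda>j. L (S j x - v j)) u) x0" if "linear L" for u and L :: "'n \<Rightarrow> 'n"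
    unfolding comb_def
    by (intro smooth_near_add smooth_near_const smooth_near_sum smooth_near_scaleR sm that) auto
  have smT: "smooth_near Tb x0"
    by (rule smooth_near_blinfunI) (use smc[OF linear_ident] in \<open>simp add: Tb T_def\<close>)
  have smH: "smooth_near Hb x0"
    by (rule smooth_near_blinfunI) (use smc[OF \<pi>_lin] in \<open>simp add: Hb H_def\<close>)
  have H0: "Hb x0 = id_blinfun"
    by (rule blinfun_eqI) (simp add: Hb H_def v_def linear_0[OF \<pi>_lin] comb_def)
  obtain R :: "'n \<Rightarrow> 'n \<Rightarrow>\<^sub>L 'n" where R: "smooth_near R x0"
    "\<forall>\<^sub>F x in nhds x0. (\<forall>u. Hb x (R x u) = u) \<and> (\<forall>u. R x (Hb x u) = u)"
    using smooth_near_inverse_operator[OF smH H0] by blast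
  define \<pi>b where "\<pi>b = Blinfun \<pi>"
  have \<pi>b: "blinfun_apply \<pi>b = \<pi>"
    unfolding \<pi>b_def by (rule bounded_linear_Blinfun_apply) (use \<pi>_lin in \<open>simp add: linear_conv_bounded_linear\<close>)
  define M where "M = (\<lambda>x. Tb x o\<^sub>L (R x o\<^sub>L \<pi>b))"
  have "smooth_near M x0"
    unfolding M_def
    by (intro smooth_near_bilinear[OF bounded_bilinear_blinfun_compose] smT R(1) smooth_near_const)
  moreover have "\<forall>\<^sub>F x in nhds x0. (\<forall>u. \<pi> (M x u) = \<pi> u) \<and> (\<forall>u. M x (\<pi> u) = M x u)
        \<and> range (M x) = span ((\<lambda>j. S j x) ` {..<r})"
    using R(2)
  proof eventually_elim
    case (elim x)
    have M: "M x u = T x (R x (\<pi> u))" for u by (simp add: M_def Tb \<pi>b)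
    have HR: "H x (R x u) = u" "R x (H x u) = u" for u using elim by (auto simp: Hb)
    have \<pi>_comb: "\<pi> (comb w u) = comb (\<lambda>j. \<pi> (w j)) u" for w :: "nat \<Rightarrow> 'n" and u
      unfolding comb_def by (simp add: linear_sum[OF \<pi>_lin] linear_scale[OF \<pi>_lin])
    have w: "\<pi> (R x (\<pi> u)) = R x (\<pi> u)" for u
    proof -
      obtain X where X: "X = \<pi> u - comb (\<lambda>j. \<pi> (S j x - v j)) (R x (\<pi> u))" by blast
      have "R x (\<pi> u) = X"
        using HR(1)[of "\<pi> u"] unfolding H_def X by (simp add: algebra_simps)
      moreover have "\<pi> X = X"
        unfolding X linear_diff[OF \<pi>_lin, of "\<pi> u"] \<pi>_comb \<pi>\<pi> ..
      ultimately show ?thesis by simp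
    qed
    have T\<pi>: "T x (\<pi> u) = comb (\<lambda>j. S j x) u" for u
    proof -
      have "comb (\<lambda>j. S j x - v j) u = comb (\<lambda>j. S j x) u - \<pi> u"
        unfolding \<pi>_def comb_def by (simp add: scaleR_diff_right sum_subtractf)
      then show ?thesis unfolding T_def by (simp add: comb_\<pi>)
    qed
    have 1: "\<pi> (M x u) = \<pi> u" for u
    proof -
      have "\<pi> (M x u) = \<pi> (R x (\<pi> u)) + \<pi> (comb (\<lambda>j. S j x - v j) (R x (\<pi> u)))"
        unfolding M T_def by (rule linear_add[OF \<pi>_lin])
      also have "\<dots> = H x (R x (\<pi> u))" unfolding H_def w \<pi>_comb ..
      finally show ?thesis by (simp add: HR)
    qed
    have "M x u \<in> span ((\<lambda>j. S j x) ` {..<r})" for u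
      using T\<pi>[of "R x (\<pi> u)"] comb_span unfolding M w by metis
    moreover have "span ((\<lambda>j. S j x) ` {..<r}) \<subseteq> range (M x)"
    proof (rule span_minimal)
      show "(\<lambda>j. S j x) ` {..<r} \<subseteq> range (M x)"
      proof (rule image_subsetI)
        fix i assume "i \<in> {..<r}"
        then have i: "i < r" by simp
        have "\<pi> (H x (v i)) = H x (v i)"
          unfolding H_def by (simp add: linear_add[OF \<pi>_lin] \<pi>_comb \<pi>\<pi> \<pi>_v[OF i])
        then have "M x (H x (v i)) = T x (v i)" unfolding M by (simp add: HR)
        also have "\<dots> = S i x" unfolding T_def by (simp add: comb_v[OF i])
        finally show "S i x \<in> range (M x)" by (metis rangeI)
      qed
      show "subspace (range (M x))"
        by (intro linear_subspace_image subspace_UNIV) (simp add: blinfun.bounded_linear_right bounded_linear.linear)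
    qed
    ultimately show ?case using 1 by (auto simp: M \<pi>\<pi>)
  qed
  ultimately show thesis using that \<pi>_lin \<pi>\<pi> by blast
qed

section \<open>Integral leaves of a commuting adapted frame\<close>

text \<open>The substitution \<open>u = s t\<close>, in a form that covers \<open>s = 0\<close> as well: the starting point of a ray is one of
the points where the integral equation is rescaled.\<close>

lemma integral_radial_rescale:
  fixes g :: "real \<Rightarrow> 'a::banach"
  assumes "continuous_on {0..1} g" "s \<in> {0..1}"
  shows "((\<lambda>t. s *\<^sub>R g (s * t)) has_integral integral {0..s} g) {0..1}"
proof -
  have sub: "(\<lambda>t. s * t) ` {0..1} \<subseteq> {0..1}"
    using assms(2) by (auto intro: mult_le_one)
  have "(((\<lambda>u. integral {0..u} g) \<circ> (\<lambda>t. s * t)) has_vector_derivative s *\<^sub>R g (s * t)) (at t within {0..1})"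
    if "t \<in> {0..1}" for t
  proof (rule vector_diff_chain_within)
    show "((\<lambda>t. s * t) has_vector_derivative s) (at t within {0..1})"
      by (auto intro!: derivative_eq_intros simp: has_vector_derivative_def)
    have "((\<lambda>u. integral {0..u} g) has_vector_derivative g (s * t)) (at (s * t) within {0..1})"
      by (rule integral_has_vector_derivative[OF assms(1)]) (use sub that in blast)
    then show "((\<lambda>u. integral {0..u} g) has_vector_derivative g (s * t)) (at (s * t) within (\<lambda>t. s * t) ` {0..1})"
      by (rule has_vector_derivative_within_subset) (rule sub)
  qed
  from fundamental_theorem_of_calculus[OF _ this] show ?thesis by simp
qed

text \<open>The estimate that replaces Gronwall's inequality: at a maximum of \<open>|f|\<close> the bound on the
integrand gives \<open>|f| \<le> |f| / 2 + c\<close>.\<close>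

lemma radial_contraction:
  fixes f :: "real \<Rightarrow> 'a::real_normed_vector"
  assumes cont: "continuous_on {0..1} f" and c: "c \<ge> 0" and s: "s \<in> {0..1}"
    and int: "\<And>s. s \<in> {0..1} \<Longrightarrow> (k s has_integral f s) {0..1}"
    and bound: "\<And>s t. s \<in> {0..1} \<Longrightarrow> t \<in> {0..1} \<Longrightarrow> norm (k s t) \<le> norm (f (t * s)) / 2 + c"
  shows "norm (f s) \<le> 2 * c"
proof -
  obtain s0 where s0: "s0 \<in> {0..1}" "\<And>s. s \<in> {0..1} \<Longrightarrow> norm (f s) \<le> norm (f s0)"
    using continuous_attains_sup[of "{0..1::real}" "\<lambda>s. norm (f s)"] continuous_on_norm[OF cont] by auto
  have "norm (f s0) \<le> (norm (f s0) / 2 + c) * measure lborel {0..1::real}"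
  proof (rule has_integral_bound_real[OF _ finite.emptyI int[OF s0(1)]])
    show "norm (k s0 t) \<le> norm (f s0) / 2 + c" if "t \<in> {0..1} - {}" for t
      using bound[OF s0(1), of t] s0(2)[of "t * s0"] s0(1) that mult_le_one[of t s0] by auto
  qed (use c in auto)
  then show ?thesis using s0(2)[OF s] by simp
qed

text \<open>The task is to solve \<open>D\<Phi>(z) = M (\<Phi> z)\<close> with \<open>\<Phi> 0 = x0\<close>. The assumption \<open>comm\<close> says that the vector
fields \<open>x \<mapsto> M x u\<close> commute pairwise; it is the integrability condition of the equation. The radius
\<open>\<epsilon>\<close> is so small that solutions stay in the ball \<open>C\<close> and that the integral equation along
the rays is a contraction with factor one half.\<close>

locale leaf_problem =
  fixes M :: "'n::euclidean_space \<Rightarrow> 'n \<Rightarrow>\<^sub>L 'n" and M' :: "'n \<Rightarrow> 'n \<Rightarrow>\<^sub>L ('n \<Rightarrow>\<^sub>L 'n)"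
    and x0 :: 'n and R K L \<epsilon> :: real
  assumes R: "R > 0"
    and der: "\<And>x. x \<in> cball x0 R \<Longrightarrow> (M has_derivative blinfun_apply (M' x)) (at x within cball x0 R)"
    and cont': "continuous_on (cball x0 R) M'"
    and comm: "\<And>x u v. x \<in> cball x0 R \<Longrightarrow> M' x (M x u) v = M' x (M x v) u"
    and K: "K > 0" "\<And>x. x \<in> cball x0 R \<Longrightarrow> norm (M x) \<le> K"
    and L: "L > 0" "\<And>x. x \<in> cball x0 R \<Longrightarrow> norm (M' x) \<le> L"
    and \<epsilon>: "\<epsilon> > 0" "K * \<epsilon> \<le> R" "L * \<epsilon> \<le> 1 / 2"
begin

abbreviation "C \<equiv> cball x0 R"

lemma cont_M: "continuous_on C M"
  using der by (meson has_derivative_continuous_on)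

lemma lipschitz_M: "x \<in> C \<Longrightarrow> y \<in> C \<Longrightarrow> norm (M x - M y) \<le> L * norm (x - y)"
proof (rule differentiable_bound[of C M "\<lambda>x. blinfun_apply (M' x)"])
  show "onorm (blinfun_apply (M' x)) \<le> L" if "x \<in> C" for x
    using L(2)[OF that] by (simp add: norm_blinfun.rep_eq)
qed (use der in auto)

text \<open>Along the ray through \<open>z\<close> a solution satisfies \<open>\<Phi> z = x0 + \<integral> M (\<Phi> (s z)) z ds\<close>, and Banach's fixed point theorem
solves this equation. Projecting the arguments to the closest points of the balls keeps the Lipschitz
bounds and makes everything globally defined, so that the theorem applies in the complete space of all
bounded continuous functions; on the small ball the projections have no effect on the fixed point.\<close>

lemma fixed_point_exists:
  "\<exists>\<Phi>. continuous_on (cball 0 \<epsilon>) \<Phi> \<and> \<Phi> ` cball 0 \<epsilon> \<subseteq> C \<and>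
     (\<forall>z\<in>cball 0 \<epsilon>. \<Phi> z = x0 + integral {0..1} (\<lambda>s. M (\<Phi> (s *\<^sub>R z)) z))"
proof -
  define r where "r = closest_point C"
  define \<zeta> where "\<zeta> = closest_point (cball (0::'n) \<epsilon>)"
  have rC: "r x \<in> C" for x
    unfolding r_def using R by (intro closest_point_in_set) auto
  have r_lip: "norm (r x - r y) \<le> norm (x - y)" for x y
    using closest_point_lipschitz[of C x y] R unfolding r_def dist_norm by auto
  have r_cont: "continuous_on S r" for S
    unfolding r_def using R by (intro continuous_on_closest_point) auto
  have z_in: "norm (\<zeta> z) \<le> \<epsilon>" for z
    using closest_point_in_set[of "cball (0::'n) \<epsilon>" z] \<epsilon>(1) unfolding \<zeta>_def by auto
  have z_cont: "continuous_on S \<zeta>" for S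
    unfolding \<zeta>_def using \<epsilon>(1) by (intro continuous_on_closest_point) auto
  define N where "N = (\<lambda>x. M (r x))"
  have N_cont: "continuous_on S N" for S
    unfolding N_def by (rule continuous_on_compose2[OF cont_M r_cont]) (use rC in auto)
  have N_bd: "norm (N x) \<le> K" for x unfolding N_def by (rule K(2)[OF rC])
  have N_lip: "norm (N x - N y) \<le> L * norm (x - y)" for x y
    unfolding N_def using lipschitz_M[OF rC rC, of x y] r_lip[of x y] L(1)
    by (meson mult_left_mono less_imp_le order_trans)
  define f where "f = (\<lambda>\<Phi> z s. N (\<Phi> (s *\<^sub>R \<zeta> z)) (\<zeta> z))"
  have f_cont2: "continuous_on (UNIV \<times> cbox 0 1) (\<lambda>(z, s). f \<Phi> z s)" if "continuous_on UNIV \<Phi>" for \<Phi>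
    unfolding f_def split_beta
    by (intro blinfun.continuous_on continuous_on_compose2[OF N_cont[of UNIV]] continuous_on_compose2[OF that]
        continuous_on_compose2[OF z_cont[of UNIV]] continuous_intros) auto
  have f_cont: "continuous_on {0..1} (f \<Phi> z)" if "continuous_on UNIV \<Phi>" for \<Phi> z
    unfolding f_def
    by (intro blinfun.continuous_on continuous_on_compose2[OF N_cont[of UNIV]] continuous_on_compose2[OF that]
        continuous_intros) auto
  have f_bd: "norm (f \<Phi> z s) \<le> K * \<epsilon>" for \<Phi> z s
  proof -
    have "norm (f \<Phi> z s) \<le> norm (N (\<Phi> (s *\<^sub>R \<zeta> z))) * norm (\<zeta> z)" unfolding f_def by (rule norm_blinfun)
    also have "\<dots> \<le> K * \<epsilon>" using N_bd z_in K by (intro mult_mono) auto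
    finally show ?thesis .
  qed
  define T where "T = (\<lambda>\<Phi>::'n \<Rightarrow>\<^sub>C 'n. Bcontfun (\<lambda>z. x0 + integral {0..1} (f \<Phi> z)))"
  have T: "apply_bcontfun (T \<Phi>) = (\<lambda>z. x0 + integral {0..1} (f \<Phi> z))" for \<Phi>
    unfolding T_def
  proof (rule Bcontfun_inverse, rule bcontfun_normI)
    show "continuous_on UNIV (\<lambda>z. x0 + integral {0..1} (f \<Phi> z))"
      using integral_continuous_on_param[OF f_cont2[of \<Phi>]]
      by (intro continuous_intros) auto
    show "norm (x0 + integral {0..1} (f \<Phi> z)) \<le> norm x0 + K * \<epsilon>" for z
      using integral_bound[OF _ f_cont[of \<Phi> z], of "K * \<epsilon>"] f_bd
      by (intro order_trans[OF norm_triangle_ineq]) auto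
  qed
  have "dist (T \<Phi>) (T \<Psi>) \<le> 1 / 2 * dist \<Phi> \<Psi>" for \<Phi> \<Psi>
  proof (rule dist_bound)
    fix z
    have c: "continuous_on {0..1} (f \<Phi> z)" "continuous_on {0..1} (f \<Psi> z)" by (auto intro: f_cont)
    have b: "norm (f \<Phi> z s - f \<Psi> z s) \<le> 1 / 2 * dist \<Phi> \<Psi>" for s
    proof -
      have "norm (f \<Phi> z s - f \<Psi> z s) = norm ((N (\<Phi> (s *\<^sub>R \<zeta> z)) - N (\<Psi> (s *\<^sub>R \<zeta> z))) (\<zeta> z))"
        unfolding f_def by (simp add: blinfun.diff_left)
      also have "\<dots> \<le> norm (N (\<Phi> (s *\<^sub>R \<zeta> z)) - N (\<Psi> (s *\<^sub>R \<zeta> z))) * norm (\<zeta> z)" by (rule norm_blinfun)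
      also have "\<dots> \<le> (L * dist \<Phi> \<Psi>) * \<epsilon>"
      proof (intro mult_mono z_in)
        have "norm (\<Phi> (s *\<^sub>R \<zeta> z) - \<Psi> (s *\<^sub>R \<zeta> z)) \<le> dist \<Phi> \<Psi>"
          using dist_bounded[of \<Phi> "s *\<^sub>R \<zeta> z" \<Psi>] by (simp add: dist_norm)
        then show "norm (N (\<Phi> (s *\<^sub>R \<zeta> z)) - N (\<Psi> (s *\<^sub>R \<zeta> z))) \<le> L * dist \<Phi> \<Psi>"
          using N_lip L(1) by (meson mult_left_mono less_imp_le order_trans)
      qed (use L(1) in auto)
      also have "\<dots> = (L * \<epsilon>) * dist \<Phi> \<Psi>" by simp
      also have "\<dots> \<le> 1 / 2 * dist \<Phi> \<Psi>" by (rule mult_right_mono[OF \<epsilon>(3)]) simp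
      finally show ?thesis .
    qed
    have "dist (T \<Phi> z) (T \<Psi> z) = norm (integral {0..1} (\<lambda>s. f \<Phi> z s - f \<Psi> z s))"
      unfolding T dist_norm using c by (simp add: integral_diff integrable_continuous_real)
    also have "\<dots> \<le> 1 / 2 * dist \<Phi> \<Psi> * (1 - 0)"
      using c b by (intro integral_bound continuous_on_diff) auto
    finally show "dist (T \<Phi> z) (T \<Psi> z) \<le> 1 / 2 * dist \<Phi> \<Psi>" by simp
  qed
  then have "\<exists>!\<Phi>. T \<Phi> = \<Phi>" by (intro banach_fix_type[of "1/2"]) auto
  then obtain \<Phi> where \<Phi>: "T \<Phi> = \<Phi>" by blast
  have eq: "\<Phi> z = x0 + integral {0..1} (f \<Phi> z)" for z
    using T[of \<Phi>] unfolding \<Phi> by (rule fun_cong)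
  have inC: "\<Phi> z \<in> C" for z
  proof -
    have "norm (integral {0..1} (f \<Phi> z)) \<le> K * \<epsilon> * (1 - 0)"
      by (intro integral_bound f_cont f_bd) auto
    then show ?thesis using \<epsilon>(2) by (subst eq) (simp add: dist_norm)
  qed
  have "\<Phi> z = x0 + integral {0..1} (\<lambda>s. M (\<Phi> (s *\<^sub>R z)) z)" if "z \<in> cball 0 \<epsilon>" for z
  proof -
    have "\<zeta> z = z" unfolding \<zeta>_def using that by (rule closest_point_self)
    moreover have "r (\<Phi> w) = \<Phi> w" for w unfolding r_def by (rule closest_point_self[OF inC])
    ultimately have "f \<Phi> z = (\<lambda>s. M (\<Phi> (s *\<^sub>R z)) z)" unfolding f_def N_def by simp
    then show ?thesis using eq[of z] by simp
  qed
  moreover have "apply_bcontfun \<Phi> ` cball 0 \<epsilon> \<subseteq> C" using inC by blast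
  moreover have "continuous_on (cball 0 \<epsilon>) (apply_bcontfun \<Phi>)" by simp
  ultimately show ?thesis by blast
qed

text \<open>By uniform continuity of \<open>M'\<close> on the compact ball, one \<open>\<delta>\<close> serves all \<open>x\<close>, in particular all points on the
image of a ray.\<close>

lemma taylor_M:
  assumes "\<eta> > 0"
  shows "\<exists>\<delta>>0. \<forall>x\<in>C. \<forall>y\<in>C. norm (y - x) < \<delta> \<longrightarrow> norm (M y - M x - M' x (y - x)) \<le> \<eta> * norm (y - x)"
proof -
  have "uniformly_continuous_on C M'" by (rule compact_uniformly_continuous[OF cont']) simp
  then obtain \<delta> where \<delta>: "\<delta> > 0" "\<And>x y. x \<in> C \<Longrightarrow> y \<in> C \<Longrightarrow> dist y x < \<delta> \<Longrightarrow> dist (M' y) (M' x) < \<eta>"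
    using assms unfolding uniformly_continuous_on_def by metis
  have "norm (M y - M x - M' x (y - x)) \<le> norm (y - x) * \<eta>"
    if xy: "x \<in> C" "y \<in> C" "norm (y - x) < \<delta>" for x y
  proof (rule differentiable_bound_linearization[of x y "closed_segment x y" M "\<lambda>x. blinfun_apply (M' x)"])
    have seg: "closed_segment x y \<subseteq> C" using xy by (intro closed_segment_subset) auto
    show "x + t *\<^sub>R (y - x) \<in> closed_segment x y" if "t \<in> {0..1}" for t
      using that unfolding closed_segment_def by (auto intro!: exI[of _ t] simp: algebra_simps)
    show "(M has_derivative blinfun_apply (M' w)) (at w within closed_segment x y)" if "w \<in> closed_segment x y" for w
      using der seg that by (meson has_derivative_subset subsetD)
    show "onorm (blinfun_apply (M' w) - blinfun_apply (M' x)) \<le> \<eta>" if w: "w \<in> closed_segment x y" for w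
    proof -
      have "dist w x \<le> dist x y" using w by (metis dist_in_closed_segment dist_commute)
      then have "norm (M' w - M' x) < \<eta>"
        using \<delta>(2)[of x w] xy w seg by (auto simp: dist_norm norm_minus_commute)
      then show ?thesis
        by (simp add: norm_blinfun.rep_eq fun_diff_def minus_blinfun.rep_eq)
    qed
  qed auto
  then show ?thesis using \<delta>(1) by (metis mult.commute)
qed

text \<open>Let \<open>e z w = \<Phi> w - \<Phi> z - M (\<Phi> z) (w - z)\<close> for the fixed point \<open>\<Phi>\<close>. Differentiating \<open>t M (\<Phi> (t z)) (w - z)\<close> with
respect to \<open>t\<close> writes \<open>M (\<Phi> z) (w - z)\<close> as an integral; after the commutation relation exchanges the two
vector arguments of \<open>M'\<close>, \<open>e z w\<close> is the integral of \<open>M' (e (t z) (t w)) z\<close> plus terms of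
size \<open>o(|w - z|)\<close>. As the first term is at most half as large as \<open>e\<close>, all of \<open>e\<close> is \<open>o(|w - z|)\<close>.\<close>

lemma leaf_exists:
  "\<exists>\<Phi>. \<Phi> 0 = x0 \<and> (\<forall>z\<in>ball 0 \<epsilon>. \<Phi> z \<in> C \<and> (\<Phi> has_derivative blinfun_apply (M (\<Phi> z))) (at z))"
proof -
  obtain \<Phi> where cont: "continuous_on (cball 0 \<epsilon>) \<Phi>" and C: "\<And>z. z \<in> cball 0 \<epsilon> \<Longrightarrow> \<Phi> z \<in> C"
    and eq: "\<And>z. z \<in> cball 0 \<epsilon> \<Longrightarrow> \<Phi> z = x0 + integral {0..1} (\<lambda>s. M (\<Phi> (s *\<^sub>R z)) z)"
    using fixed_point_exists by blast
  define \<D> where "\<D> = cball (0::'n) \<epsilon>"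
  note cont = cont[folded \<D>_def] and C = C[folded \<D>_def] and eq = eq[folded \<D>_def]
  have sD: "s *\<^sub>R z \<in> \<D>" if "z \<in> \<D>" "s \<in> {0..1}" for s z
  proof -
    have "\<bar>s\<bar> * norm z \<le> 1 * norm z" using that by (intro mult_right_mono) auto
    then show ?thesis using that(1) unfolding \<D>_def by simp
  qed
  have sC: "\<Phi> (s *\<^sub>R z) \<in> C" if "z \<in> \<D>" "s \<in> {0..1}" for s z using C sD that by blast
  have c\<Phi>: "continuous_on {0..1} (\<lambda>s. \<Phi> (s *\<^sub>R z))" if "z \<in> \<D>" for z
    by (rule continuous_on_compose2[OF cont]) (use sD[OF that] in \<open>auto intro!: continuous_intros\<close>)
  have cM: "continuous_on {0..1} (\<lambda>s. M (\<Phi> (s *\<^sub>R z)))" if "z \<in> \<D>" for z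
    by (rule continuous_on_compose2[OF cont_M c\<Phi>[OF that]]) (use sC[OF that] in auto)
  have int: "((\<lambda>t. M (\<Phi> (t *\<^sub>R z)) z) has_integral (\<Phi> z - x0)) {0..1}" if "z \<in> \<D>" for z
  proof -
    have "(\<lambda>t. M (\<Phi> (t *\<^sub>R z)) z) integrable_on {0..1}"
      by (intro integrable_continuous_real blinfun.continuous_on cM that continuous_on_const)
    then show ?thesis using eq[OF that] by (simp add: has_integral_iff)
  qed
  \<comment> \<open>rescaling the integral equation for \<open>s z\<close> shows that \<open>\<Phi>\<close> is an integral curve along each ray\<close>
  have rad: "((\<lambda>s. \<Phi> (s *\<^sub>R z)) has_vector_derivative M (\<Phi> (s *\<^sub>R z)) z) (at s within {0..1})"
    if "z \<in> \<D>" "s \<in> {0..1}" for z s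
  proof -
    define g where "g = (\<lambda>s. M (\<Phi> (s *\<^sub>R z)) z)"
    have g: "continuous_on {0..1} g"
      unfolding g_def by (intro blinfun.continuous_on cM that continuous_on_const)
    have e: "x0 + integral {0..s} g = \<Phi> (s *\<^sub>R z)" if s: "s \<in> {0..1}" for s
    proof -
      have "((\<lambda>t. s *\<^sub>R g (s * t)) has_integral (\<Phi> (s *\<^sub>R z) - x0)) {0..1}"
        using int[OF sD[OF \<open>z \<in> \<D>\<close> s]] unfolding g_def by (simp add: blinfun.scaleR_right mult.commute)
      from has_integral_unique[OF integral_radial_rescale[OF g s] this] show ?thesis by simp
    qed
    have "((\<lambda>s. x0 + integral {0..s} g) has_vector_derivative 0 + g s) (at s within {0..1})"
      by (intro has_vector_derivative_add has_vector_derivative_const integral_has_vector_derivative g that)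
    then have "((\<lambda>s. x0 + integral {0..s} g) has_vector_derivative M (\<Phi> (s *\<^sub>R z)) z) (at s within {0..1})"
      by (simp add: g_def)
    then show ?thesis
      using e that(2) has_vector_derivative_transform[of s "{0..1}" "\<lambda>s. \<Phi> (s *\<^sub>R z)" "\<lambda>s. x0 + integral {0..s} g"]
      by metis
  qed
  have \<Phi>0: "\<Phi> 0 = x0" using eq[of 0] \<epsilon>(1) by (simp add: \<D>_def)
  have scaled: "norm (s *\<^sub>R w - s *\<^sub>R z) \<le> norm (w - z)" if "s \<in> {0..1}" for s :: real and w z :: 'n
    using that by (simp add: mult_left_le_one_le flip: scaleR_diff_right)
  have lip: "norm (\<Phi> (s *\<^sub>R w) - \<Phi> (s *\<^sub>R z)) \<le> 2 * K * norm (w - z)"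
    if zw: "z \<in> \<D>" "w \<in> \<D>" and s: "s \<in> {0..1}" for z w s
  proof -
    have "norm (\<Phi> (s *\<^sub>R w) - \<Phi> (s *\<^sub>R z)) \<le> 2 * (K * norm (w - z))"
    proof (rule radial_contraction[OF _ _ s])
      show "continuous_on {0..1} (\<lambda>s. \<Phi> (s *\<^sub>R w) - \<Phi> (s *\<^sub>R z))" by (intro continuous_intros c\<Phi> zw)
      show "0 \<le> K * norm (w - z)" using K(1) by simp
    next
      fix s :: real assume s: "s \<in> {0..1}"
      let ?z = "s *\<^sub>R z" and ?w = "s *\<^sub>R w"
      have zws: "?z \<in> \<D>" "?w \<in> \<D>" using sD zw s by auto
      have "((\<lambda>t. M (\<Phi> (t *\<^sub>R ?w)) ?w - M (\<Phi> (t *\<^sub>R ?z)) ?z) has_integral (\<Phi> ?w - x0 - (\<Phi> ?z - x0))) {0..1}"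
        by (intro has_integral_diff int zws)
      then show "((\<lambda>t. M (\<Phi> (t *\<^sub>R ?w)) ?w - M (\<Phi> (t *\<^sub>R ?z)) ?z) has_integral (\<Phi> ?w - \<Phi> ?z)) {0..1}" by simp
      fix t :: real assume t: "t \<in> {0..1}"
      let ?x = "\<Phi> (t *\<^sub>R ?z)" and ?y = "\<Phi> (t *\<^sub>R ?w)"
      have xC: "?x \<in> C" "?y \<in> C" by (rule sC[OF zws(1) t], rule sC[OF zws(2) t])
      have "norm ((M ?y - M ?x) ?z) \<le> norm (M ?y - M ?x) * norm ?z" by (rule norm_blinfun)
      also have "\<dots> \<le> (L * norm (?y - ?x)) * \<epsilon>"
        using lipschitz_M[OF xC(2,1)] zws(1) L(1) unfolding \<D>_def by (intro mult_mono) auto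
      also have "\<dots> \<le> norm (?y - ?x) / 2"
        using mult_right_mono[OF \<epsilon>(3), of "norm (?y - ?x)"] by (simp add: ac_simps)
      finally have 1: "norm ((M ?y - M ?x) ?z) \<le> norm (?y - ?x) / 2" .
      have "norm (M ?y (?w - ?z)) \<le> norm (M ?y) * norm (?w - ?z)" by (rule norm_blinfun)
      also have "\<dots> \<le> K * norm (w - z)"
        using K xC(2) scaled[OF s] by (intro mult_mono) auto
      finally have "norm ((M ?y - M ?x) ?z + M ?y (?w - ?z)) \<le> norm (?y - ?x) / 2 + K * norm (w - z)"
        using 1 by (intro norm_triangle_le) simp
      then show "norm (M ?y ?w - M ?x ?z) \<le> norm (\<Phi> ((t * s) *\<^sub>R w) - \<Phi> ((t * s) *\<^sub>R z)) / 2 + K * norm (w - z)"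
        by (simp add: blinfun.diff_left blinfun.diff_right)
    qed
    then show ?thesis by simp
  qed
  define e where "e = (\<lambda>z w. \<Phi> w - \<Phi> z - M (\<Phi> z) (w - z))"
  have e_int: "((\<lambda>t. (M (\<Phi> (t *\<^sub>R w)) - M (\<Phi> (t *\<^sub>R z))) (w - z)
      + (M (\<Phi> (t *\<^sub>R w)) - M (\<Phi> (t *\<^sub>R z)) - M' (\<Phi> (t *\<^sub>R z)) (\<Phi> (t *\<^sub>R w) - \<Phi> (t *\<^sub>R z))) z
      + M' (\<Phi> (t *\<^sub>R z)) (e (t *\<^sub>R z) (t *\<^sub>R w)) z) has_integral e z w) {0..1}"
    if zw: "z \<in> \<D>" "w \<in> \<D>" for z w
  proof -
    let ?h = "w - z"
    have Mh: "((\<lambda>t. t *\<^sub>R M (\<Phi> (t *\<^sub>R z)) ?h) has_vector_derivative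
       t *\<^sub>R M' (\<Phi> (t *\<^sub>R z)) (M (\<Phi> (t *\<^sub>R z)) z) ?h + 1 *\<^sub>R M (\<Phi> (t *\<^sub>R z)) ?h) (at t within {0..1})"
      if t: "t \<in> {0..1}" for t
    proof (rule has_vector_derivative_scaleR)
      show "((\<lambda>t. t) has_field_derivative 1) (at t within {0..1})" by (rule DERIV_ident)
      have "(M has_derivative blinfun_apply (M' (\<Phi> (t *\<^sub>R z)))) (at (\<Phi> (t *\<^sub>R z)) within (\<lambda>t. \<Phi> (t *\<^sub>R z)) ` {0..1})"
        by (rule has_derivative_subset[OF der]) (use sC[OF zw(1)] t in auto)
      from vector_derivative_diff_chain_within[OF rad[OF zw(1) t] this]
      have "((\<lambda>t. M (\<Phi> (t *\<^sub>R z))) has_vector_derivative M' (\<Phi> (t *\<^sub>R z)) (M (\<Phi> (t *\<^sub>R z)) z)) (at t within {0..1})"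
        by (simp add: comp_def)
      from bounded_linear.has_vector_derivative[OF blinfun.bounded_linear_left this]
      show "((\<lambda>t. M (\<Phi> (t *\<^sub>R z)) ?h) has_vector_derivative M' (\<Phi> (t *\<^sub>R z)) (M (\<Phi> (t *\<^sub>R z)) z) ?h) (at t within {0..1})" .
    qed
    have "((\<lambda>t. t *\<^sub>R M' (\<Phi> (t *\<^sub>R z)) (M (\<Phi> (t *\<^sub>R z)) z) ?h + 1 *\<^sub>R M (\<Phi> (t *\<^sub>R z)) ?h) has_integral
       (1 *\<^sub>R M (\<Phi> (1 *\<^sub>R z)) ?h - 0 *\<^sub>R M (\<Phi> (0 *\<^sub>R z)) ?h)) {0..1}"
      by (rule fundamental_theorem_of_calculus[OF _ Mh]) auto
    from has_integral_diff[OF has_integral_diff[OF int[OF zw(2)] int[OF zw(1)]] this]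
    have "((\<lambda>t. M (\<Phi> (t *\<^sub>R w)) w - M (\<Phi> (t *\<^sub>R z)) z - (t *\<^sub>R M' (\<Phi> (t *\<^sub>R z)) (M (\<Phi> (t *\<^sub>R z)) z) ?h
       + 1 *\<^sub>R M (\<Phi> (t *\<^sub>R z)) ?h)) has_integral e z w) {0..1}"
      unfolding e_def by (simp add: algebra_simps)
    then show ?thesis
    proof (rule has_integral_eq[rotated])
      fix t :: real assume t: "t \<in> {0..1}"
      show "M (\<Phi> (t *\<^sub>R w)) w - M (\<Phi> (t *\<^sub>R z)) z - (t *\<^sub>R M' (\<Phi> (t *\<^sub>R z)) (M (\<Phi> (t *\<^sub>R z)) z) ?h
       + 1 *\<^sub>R M (\<Phi> (t *\<^sub>R z)) ?h) = (M (\<Phi> (t *\<^sub>R w)) - M (\<Phi> (t *\<^sub>R z))) (w - z)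
      + (M (\<Phi> (t *\<^sub>R w)) - M (\<Phi> (t *\<^sub>R z)) - M' (\<Phi> (t *\<^sub>R z)) (\<Phi> (t *\<^sub>R w) - \<Phi> (t *\<^sub>R z))) z
      + M' (\<Phi> (t *\<^sub>R z)) (e (t *\<^sub>R z) (t *\<^sub>R w)) z"
        unfolding comm[OF sC[OF zw(1) t], of z ?h] e_def
        by (simp add: blinfun.diff_left blinfun.diff_right blinfun.scaleR_left blinfun.scaleR_right
            flip: scaleR_diff_right)
    qed
  qed
  have e_bound: "norm (e z w) \<le> 4 * L * K * norm (w - z) * norm (w - z) + 4 * \<eta> * K * \<epsilon> * norm (w - z)"
    if zw: "z \<in> \<D>" "w \<in> \<D>" and \<eta>: "\<eta> > 0" and close: "2 * K * norm (w - z) < \<delta>"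
      and \<delta>: "\<And>x y. x \<in> C \<Longrightarrow> y \<in> C \<Longrightarrow> norm (y - x) < \<delta> \<Longrightarrow> norm (M y - M x - M' x (y - x)) \<le> \<eta> * norm (y - x)"
    for z w \<eta> \<delta>
  proof -
    define n where "n = norm (w - z)"
    have n0: "n \<ge> 0" by (simp add: n_def)
    let ?c = "2 * L * K * n * n + 2 * \<eta> * K * \<epsilon> * n"
    have "norm (e (1 *\<^sub>R z) (1 *\<^sub>R w)) \<le> 2 * ?c"
    proof (rule radial_contraction[where f = "\<lambda>s. e (s *\<^sub>R z) (s *\<^sub>R w)"])
      show "continuous_on {0..1} (\<lambda>s. e (s *\<^sub>R z) (s *\<^sub>R w))"
        unfolding e_def by (intro continuous_intros c\<Phi> cM zw)
      show "0 \<le> ?c" using K(1) L(1) n0 \<eta> \<epsilon>(1) by simp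
    next
      fix s :: real assume s: "s \<in> {0..1}"
      let ?z = "s *\<^sub>R z" and ?w = "s *\<^sub>R w"
      have zws: "?z \<in> \<D>" "?w \<in> \<D>" using sD zw s by auto
      have n: "norm (?w - ?z) \<le> n" unfolding n_def by (rule scaled[OF s])
      have z\<epsilon>: "norm ?z \<le> \<epsilon>" using zws(1) unfolding \<D>_def by simp
      note e_int[OF zws]
      then show "((\<lambda>t. (M (\<Phi> (t *\<^sub>R ?w)) - M (\<Phi> (t *\<^sub>R ?z))) (?w - ?z)
        + (M (\<Phi> (t *\<^sub>R ?w)) - M (\<Phi> (t *\<^sub>R ?z)) - M' (\<Phi> (t *\<^sub>R ?z)) (\<Phi> (t *\<^sub>R ?w) - \<Phi> (t *\<^sub>R ?z))) ?z
        + M' (\<Phi> (t *\<^sub>R ?z)) (e (t *\<^sub>R ?z) (t *\<^sub>R ?w)) ?z) has_integral e ?z ?w) {0..1}" .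
      fix t :: real assume t: "t \<in> {0..1}"
      have ts: "t * s \<in> {0..1}" using t s by (auto intro: mult_le_one)
      let ?x = "\<Phi> (t *\<^sub>R ?z)" and ?y = "\<Phi> (t *\<^sub>R ?w)" and ?e = "e (t *\<^sub>R ?z) (t *\<^sub>R ?w)"
      have xC: "?x \<in> C" "?y \<in> C" by (rule sC[OF zws(1) t], rule sC[OF zws(2) t])
      have xy: "norm (?y - ?x) \<le> 2 * K * n" using lip[OF zw ts] by (simp add: n_def)
      have "norm ((M ?y - M ?x) (?w - ?z)) \<le> norm (M ?y - M ?x) * norm (?w - ?z)" by (rule norm_blinfun)
      also have "\<dots> \<le> (L * (2 * K * n)) * n"
      proof (rule mult_mono[OF _ n])
        show "norm (M ?y - M ?x) \<le> L * (2 * K * n)"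
          using lipschitz_M[OF xC(2,1)] xy L(1) by (meson mult_left_mono less_imp_le order_trans)
      qed (use L(1) K(1) n0 in auto)
      finally have 1: "norm ((M ?y - M ?x) (?w - ?z)) \<le> 2 * L * K * n * n" by (simp add: algebra_simps)
      have "norm ((M ?y - M ?x - M' ?x (?y - ?x)) ?z) \<le> norm (M ?y - M ?x - M' ?x (?y - ?x)) * norm ?z"
        by (rule norm_blinfun)
      also have "\<dots> \<le> (\<eta> * (2 * K * n)) * \<epsilon>"
      proof (rule mult_mono[OF _ z\<epsilon>])
        have "norm (M ?y - M ?x - M' ?x (?y - ?x)) \<le> \<eta> * norm (?y - ?x)"
          using xy close unfolding n_def[symmetric] by (intro \<delta> xC) simp
        also have "\<dots> \<le> \<eta> * (2 * K * n)" using xy \<eta> by simp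
        finally show "norm (M ?y - M ?x - M' ?x (?y - ?x)) \<le> \<eta> * (2 * K * n)" .
      qed (use \<eta> K(1) n0 in auto)
      finally have 2: "norm ((M ?y - M ?x - M' ?x (?y - ?x)) ?z) \<le> 2 * \<eta> * K * \<epsilon> * n" by (simp add: algebra_simps)
      have "norm (M' ?x ?e ?z) \<le> norm (M' ?x ?e) * norm ?z" by (rule norm_blinfun)
      also have "\<dots> \<le> (L * norm ?e) * \<epsilon>"
        using L xC(1) z\<epsilon> by (intro mult_mono order_trans[OF norm_blinfun]) auto
      also have "\<dots> \<le> norm ?e / 2"
        using mult_right_mono[OF \<epsilon>(3), of "norm ?e"] by (simp add: ac_simps)
      finally have "norm ((M ?y - M ?x) (?w - ?z) + (M ?y - M ?x - M' ?x (?y - ?x)) ?z + M' ?x ?e ?z)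
          \<le> ?c + norm ?e / 2"
        using 1 2 by (intro norm_triangle_le add_mono) auto
      then show "norm ((M ?y - M ?x) (?w - ?z) + (M ?y - M ?x - M' ?x (?y - ?x)) ?z + M' ?x ?e ?z)
          \<le> norm (e ((t * s) *\<^sub>R z) ((t * s) *\<^sub>R w)) / 2 + ?c" by simp
    qed simp
    then show ?thesis unfolding n_def by simp
  qed
  have "(\<Phi> has_derivative blinfun_apply (M (\<Phi> z))) (at z)" if z: "z \<in> ball 0 \<epsilon>" for z
    unfolding has_derivative_at_alt
  proof (intro conjI allI impI)
    show "bounded_linear (blinfun_apply (M (\<Phi> z)))" by (rule blinfun.bounded_linear_right)
    fix \<theta> :: real assume \<theta>: "\<theta> > 0"
    \<comment> \<open>with this \<open>\<eta>\<close> and \<open>|w - z| < \<theta> / (8 L K)\<close>, each of the two summands in \<open>e_bound\<close> is at most \<open>\<theta> |w - z| / 2\<close>\<close>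
    define \<eta> where "\<eta> = \<theta> / (8 * K * \<epsilon>)"
    have \<eta>: "\<eta> > 0" unfolding \<eta>_def using \<theta> K(1) \<epsilon>(1) by simp
    obtain \<delta> where \<delta>: "\<delta> > 0"
      "\<And>x y. x \<in> C \<Longrightarrow> y \<in> C \<Longrightarrow> norm (y - x) < \<delta> \<Longrightarrow> norm (M y - M x - M' x (y - x)) \<le> \<eta> * norm (y - x)"
      using taylor_M[OF \<eta>] by blast
    define d where "d = min (\<epsilon> - norm z) (min (\<delta> / (2 * K)) (\<theta> / (8 * L * K)))"
    have "d > 0" unfolding d_def using z \<delta>(1) \<theta> K(1) L(1) by simp
    moreover have "norm (\<Phi> w - \<Phi> z - M (\<Phi> z) (w - z)) \<le> \<theta> * norm (w - z)" if w: "norm (w - z) < d" for w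
    proof -
      have "norm w \<le> norm z + norm (w - z)" by (metis add.commute diff_add_cancel norm_triangle_ineq)
      then have zw: "z \<in> \<D>" "w \<in> \<D>" using z w unfolding \<D>_def d_def by auto
      have "norm (w - z) < \<delta> / (2 * K)" "norm (w - z) \<le> \<theta> / (8 * L * K)" using w unfolding d_def by auto
      then have c: "2 * K * norm (w - z) < \<delta>" and c': "8 * L * K * norm (w - z) \<le> \<theta>"
        using K(1) L(1) by (auto simp: field_simps)
      have "norm (e z w) \<le> 4 * L * K * norm (w - z) * norm (w - z) + 4 * \<eta> * K * \<epsilon> * norm (w - z)"
        by (rule e_bound[OF zw \<eta> c \<delta>(2)])
      also have "4 * \<eta> * K * \<epsilon> = \<theta> / 2" unfolding \<eta>_def using K(1) \<epsilon>(1) by (simp add: field_simps)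
      also have "4 * L * K * norm (w - z) * norm (w - z) \<le> \<theta> / 2 * norm (w - z)"
        using c' by (intro mult_right_mono) auto
      finally show ?thesis unfolding e_def by simp
    qed
    ultimately show "\<exists>d>0. \<forall>w. norm (w - z) < d \<longrightarrow> norm (\<Phi> w - \<Phi> z - M (\<Phi> z) (w - z)) \<le> \<theta> * norm (w - z)"
      by blast
  qed
  moreover have "\<Phi> z \<in> C" if "z \<in> ball 0 \<epsilon>" for z
    using C that unfolding \<D>_def by auto
  ultimately show ?thesis using \<Phi>0 by blast
qed

end

lemma commuting_frame_leaf:
  fixes M :: "'n::euclidean_space \<Rightarrow> 'n \<Rightarrow>\<^sub>L 'n"
  assumes U: "open U" "x0 \<in> U"
    and der: "\<And>x. x \<in> U \<Longrightarrow> (M has_derivative blinfun_apply (M' x)) (at x)"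
    and cont: "continuous_on U M'"
    and comm: "\<And>x u v. x \<in> U \<Longrightarrow> M' x (M x u) v = M' x (M x v) u"
  obtains \<epsilon> \<Phi> where "\<epsilon> > 0" "\<Phi> 0 = x0" "\<And>z. z \<in> ball 0 \<epsilon> \<Longrightarrow> \<Phi> z \<in> U"
    "\<And>z. z \<in> ball 0 \<epsilon> \<Longrightarrow> (\<Phi> has_derivative blinfun_apply (M (\<Phi> z))) (at z)"
proof -
  obtain R where R: "R > 0" "cball x0 R \<subseteq> U" using U unfolding open_contains_cball by blast
  have bd: "\<exists>K>0. \<forall>x\<in>cball x0 R. norm (f x) \<le> K" if "continuous_on (cball x0 R) f" for f :: "'n \<Rightarrow> 'x::real_normed_vector"
  proof -
    have "bounded (f ` cball x0 R)" by (intro compact_imp_bounded compact_continuous_image that) simp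
    then show ?thesis unfolding bounded_pos by auto
  qed
  have der': "(M has_derivative blinfun_apply (M' x)) (at x within cball x0 R)" if "x \<in> cball x0 R" for x
    using der R(2) that by (meson has_derivative_at_withinI subsetD)
  have cont': "continuous_on (cball x0 R) M'" using cont R(2) by (rule continuous_on_subset)
  obtain K where K: "K > 0" "\<And>x. x \<in> cball x0 R \<Longrightarrow> norm (M x) \<le> K"
    using bd[OF has_derivative_continuous_on[OF der']] by blast
  obtain L where L: "L > 0" "\<And>x. x \<in> cball x0 R \<Longrightarrow> norm (M' x) \<le> L"
    using bd[OF cont'] by blast
  define \<epsilon> where "\<epsilon> = min (R / K) (1 / (2 * L))"
  have "\<epsilon> > 0" "\<epsilon> \<le> R / K" "\<epsilon> \<le> 1 / (2 * L)" using R K L by (auto simp: \<epsilon>_def)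
  then have \<epsilon>: "\<epsilon> > 0" "K * \<epsilon> \<le> R" "L * \<epsilon> \<le> 1 / 2" using K L by (auto simp: field_simps)
  have CU: "cball x0 R \<subseteq> U" by (rule R(2))
  interpret leaf_problem M M' x0 R K L \<epsilon>
    by unfold_locales (use R der' cont' comm K L \<epsilon> in auto)
  show thesis using leaf_exists that[OF \<open>\<epsilon> > 0\<close>] CU by blast
qed

section \<open>Charts\<close>

lemma chart_inv_in: "x \<in> snd c ` fst c \<Longrightarrow> chart_inv c x \<in> fst c"
  by (rule inv_into_into)

lemma chart_of_inv: "x \<in> snd c ` fst c \<Longrightarrow> snd c (chart_inv c x) = x"
  by (rule f_inv_into_f)

lemma atlas_openD: "smooth_atlas A \<Longrightarrow> c \<in> A \<Longrightarrow> open (fst c)"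
  unfolding smooth_atlas_def by blast

lemma atlas_homeo:
  "smooth_atlas A \<Longrightarrow> c \<in> A \<Longrightarrow> homeomorphism (fst c) (snd c ` fst c) (snd c) (chart_inv c)"
  unfolding smooth_atlas_def by blast

lemma chart_inv_of: "smooth_atlas A \<Longrightarrow> c \<in> A \<Longrightarrow> p \<in> fst c \<Longrightarrow> chart_inv c (snd c p) = p"
  by (meson atlas_homeo homeomorphism_apply1)

lemma chart_image_open:
  assumes "smooth_atlas A" "c \<in> A" "open U"
  shows "open (snd c ` (fst c \<inter> U))"
proof -
  note h = atlas_homeo[OF assms(1,2)]
  have "snd c ` (fst c \<inter> U) = snd c ` fst c \<inter> chart_inv c -` U"
    using chart_inv_of[OF assms(1,2)] by (auto simp: image_iff)
  moreover have "open (snd c ` fst c \<inter> chart_inv c -` U)"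
    using homeomorphism_cont2[OF h] assms unfolding smooth_atlas_def
    by (intro continuous_open_preimage) auto
  ultimately show ?thesis by simp
qed

lemma chart_at_in: "smooth_atlas A \<Longrightarrow> chart_at A p \<in> A"
  and chart_at_mem: "smooth_atlas A \<Longrightarrow> p \<in> fst (chart_at A p)"
proof -
  assume "smooth_atlas A"
  then have "\<exists>c. c \<in> A \<and> p \<in> fst c" unfolding smooth_atlas_def by blast
  then have "chart_at A p \<in> A \<and> p \<in> fst (chart_at A p)" unfolding chart_at_def by (rule someI_ex)
  then show "chart_at A p \<in> A" "p \<in> fst (chart_at A p)" by auto
qed

lemma chart_tendsto:
  assumes "smooth_atlas A" "c \<in> A" "p \<in> fst c"
  shows "filterlim (snd c) (nhds (snd c p)) (nhds p)"
proof -
  have "isCont (snd c) p"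
    using homeomorphism_cont1[OF atlas_homeo[OF assms(1,2)]] atlas_openD[OF assms(1,2)] assms(3)
    by (simp add: continuous_on_eq_continuous_at)
  then show ?thesis by (simp add: isCont_def tendsto_at_iff_tendsto_nhds)
qed

lemma chart_inv_tendsto:
  assumes "smooth_atlas A" "c \<in> A" "p \<in> fst c"
  shows "filterlim (chart_inv c) (nhds p) (nhds (snd c p))"
proof -
  have "isCont (chart_inv c) (snd c p)"
    using homeomorphism_cont2[OF atlas_homeo[OF assms(1,2)]] assms
    unfolding smooth_atlas_def by (simp add: continuous_on_eq_continuous_at)
  then show ?thesis
    using chart_inv_of[OF assms] tendsto_at_iff_tendsto_nhds[of "chart_inv c" "snd c p"]
    by (simp add: isCont_def)
qed

lemma eventually_in_chart:
  assumes "smooth_atlas A" "c \<in> A" "p \<in> fst c"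
  shows "\<forall>\<^sub>F q in nhds p. q \<in> fst c"
  using atlas_openD[OF assms(1,2)] assms(3) by (auto simp: eventually_nhds)

lemma eventually_chart_iff:
  assumes "smooth_atlas A" "c \<in> A" "p \<in> fst c"
  shows "(\<forall>\<^sub>F x in nhds (snd c p). Q (chart_inv c x)) \<longleftrightarrow> (\<forall>\<^sub>F q in nhds p. Q q)"
proof
  assume "\<forall>\<^sub>F q in nhds p. Q q"
  then show "\<forall>\<^sub>F x in nhds (snd c p). Q (chart_inv c x)"
    by (rule eventually_compose_filterlim[OF _ chart_inv_tendsto[OF assms]])
next
  assume "\<forall>\<^sub>F x in nhds (snd c p). Q (chart_inv c x)"
  then have "\<forall>\<^sub>F q in nhds p. Q (chart_inv c (snd c q))"
    by (rule eventually_compose_filterlim[OF _ chart_tendsto[OF assms]])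
  then show "\<forall>\<^sub>F q in nhds p. Q q"
    using eventually_in_chart[OF assms]
    by eventually_elim (simp add: chart_inv_of[OF assms(1,2)])
qed

lemmas eventually_chart_inv = eventually_chart_iff[THEN iffD2]

lemma eventually_in_chart_image:
  assumes "smooth_atlas A" "c \<in> A" "p \<in> fst c"
  shows "\<forall>\<^sub>F x in nhds (snd c p). x \<in> snd c ` fst c"
  using assms unfolding smooth_atlas_def by (auto simp: eventually_nhds)

lemma transition_smooth:
  assumes "smooth_atlas A" "c \<in> A" "d \<in> A" "p \<in> fst c" "p \<in> fst d"
  shows "smooth_near (\<lambda>x. snd d (chart_inv c x)) (snd c p)"
proof -
  have "smooth_on (snd c ` (fst c \<inter> fst d)) (\<lambda>x. snd d (chart_inv c x))"
    using assms unfolding smooth_atlas_def comp_def by blast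
  then show ?thesis
    using assms chart_image_open[OF assms(1,2) atlas_openD[OF assms(1,3)]]
    by (simp add: smooth_on_iff_near)
qed

lemma smooth_map_near:
  assumes "smooth_atlas B" "smooth_atlas A" "smooth_map B A \<iota>"
    "c \<in> B" "d \<in> A" "p \<in> fst c" "\<iota> p \<in> fst d"
  shows "smooth_near (\<lambda>x. snd d (\<iota> (chart_inv c x))) (snd c p)"
proof -
  have "open (\<iota> -` fst d)"
    using assms atlas_openD[OF assms(2,5)] unfolding smooth_map_def
    by (auto intro: open_vimage)
  moreover have "smooth_on (snd c ` (fst c \<inter> \<iota> -` fst d)) (\<lambda>x. snd d (\<iota> (chart_inv c x)))"
    using assms unfolding smooth_map_def comp_def by blast
  ultimately show ?thesis
    using assms chart_image_open[OF assms(1,4), of "\<iota> -` fst d"] by (simp add: smooth_on_iff_near)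
qed

lemma smooth_map_tendsto:
  fixes \<iota> :: "'b::t2_space \<Rightarrow> 'a::topological_space"
  assumes "smooth_map B A \<iota>"
  shows "filterlim \<iota> (nhds (\<iota> p)) (nhds p)"
proof -
  have "isCont \<iota> p"
    using assms continuous_on_eq_continuous_at[OF open_UNIV, of \<iota>] unfolding smooth_map_def by blast
  then show ?thesis unfolding tendsto_at_iff_tendsto_nhds[symmetric] isCont_def .
qed

lemma smooth_map_ident: "smooth_atlas A \<Longrightarrow> smooth_map A A (\<lambda>p. p)"
  unfolding smooth_map_def smooth_atlas_def comp_def by (auto simp: continuous_on_id)

section \<open>Components of tangent vectors\<close>

text \<open>Coordinate expressions satisfy chain rules only where the charts overlap, that is near a point.\<close>

lemma fderiv_chain:
  assumes "f differentiable at x" "h differentiable at (f x)" "\<forall>\<^sub>F y in nhds x. h (f y) = k y"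
  shows "fderiv k x v = fderiv h (f x) (fderiv f x v)"
  unfolding frechet_derivative_cong[OF assms(3), symmetric]
    frechet_derivative_at[OF has_derivative_compose[OF assms(1,2)[THEN frechet_derivative_worksI]], symmetric] ..

lemma fderiv_change_source_chart:
  assumes "smooth_atlas B" "smooth_atlas A" "smooth_map B A \<iota>"
    "b \<in> B" "p \<in> fst b" "c \<in> B" "p \<in> fst c" "d \<in> A" "\<iota> p \<in> fst d"
  shows "fderiv (\<lambda>x. snd d (\<iota> (chart_inv b x))) (snd b p) v =
    fderiv (\<lambda>y. snd d (\<iota> (chart_inv c y))) (snd c p) (fderiv (\<lambda>x. snd c (chart_inv b x)) (snd b p) v)"
proof -
  have inv: "chart_inv b (snd b p) = p" by (rule chart_inv_of[OF assms(1,4,5)])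
  have "\<forall>\<^sub>F x in nhds (snd b p). chart_inv b x \<in> fst c"
    by (rule eventually_chart_inv[OF assms(1,4,5) eventually_in_chart[OF assms(1,6,7)]])
  then have "\<forall>\<^sub>F x in nhds (snd b p). snd d (\<iota> (chart_inv c (snd c (chart_inv b x)))) = snd d (\<iota> (chart_inv b x))"
    by eventually_elim (simp add: chart_inv_of[OF assms(1,6)])
  from fderiv_chain[where f = "\<lambda>x. snd c (chart_inv b x)" and h = "\<lambda>y. snd d (\<iota> (chart_inv c y))", OF _ _ this] show ?thesis
    by (simp add: inv smooth_near_differentiable[OF transition_smooth[OF assms(1,4,6,5,7)]]
        smooth_near_differentiable[OF smooth_map_near[OF assms(1-3,6,8,7,9)]])
qed

lemma fderiv_change_target_chart:
  assumes "smooth_atlas B" "smooth_atlas A" "smooth_map B A \<iota>"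
    "b \<in> B" "p \<in> fst b" "a \<in> A" "\<iota> p \<in> fst a" "d \<in> A" "\<iota> p \<in> fst d"
  shows "fderiv (\<lambda>x. snd d (\<iota> (chart_inv b x))) (snd b p) v =
    fderiv (\<lambda>y. snd d (chart_inv a y)) (snd a (\<iota> p)) (fderiv (\<lambda>x. snd a (\<iota> (chart_inv b x))) (snd b p) v)"
proof -
  have inv: "chart_inv b (snd b p) = p" by (rule chart_inv_of[OF assms(1,4,5)])
  have "\<forall>\<^sub>F q in nhds p. \<iota> q \<in> fst a"
    by (rule eventually_compose_filterlim[OF eventually_in_chart[OF assms(2,6,7)] smooth_map_tendsto[OF assms(3)]])
  then have "\<forall>\<^sub>F x in nhds (snd b p). \<iota> (chart_inv b x) \<in> fst a"
    by (rule eventually_chart_inv[OF assms(1,4,5)])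
  then have "\<forall>\<^sub>F x in nhds (snd b p). snd d (chart_inv a (snd a (\<iota> (chart_inv b x)))) = snd d (\<iota> (chart_inv b x))"
    by eventually_elim (simp add: chart_inv_of[OF assms(2,6)])
  from fderiv_chain[where f = "\<lambda>x. snd a (\<iota> (chart_inv b x))" and h = "\<lambda>y. snd d (chart_inv a y)", OF _ _ this] show ?thesis
    by (simp add: inv smooth_near_differentiable[OF smooth_map_near[OF assms(1-3,4,6,5,7)]]
        smooth_near_differentiable[OF transition_smooth[OF assms(2,6,8,7,9)]])
qed

lemma components_eq:
  "components A c p v =
     fderiv (\<lambda>x. snd c (chart_inv (chart_at A p) x)) (snd (chart_at A p) p) v"
  unfolding components_def comp_def ..

text \<open>Tangent vectors at \<open>p\<close> are by convention their own components in the preferred chart at \<open>p\<close>.\<close>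

lemma components_chart_at:
  assumes "smooth_atlas A"
  shows "components A (chart_at A p) p v = v"
proof -
  have "fderiv (\<lambda>x. snd (chart_at A p) (chart_inv (chart_at A p) x)) (snd (chart_at A p) p)
     = fderiv (\<lambda>x. x) (snd (chart_at A p) p)"
    by (rule frechet_derivative_cong,
        rule eventually_mono[OF eventually_in_chart_image[OF assms chart_at_in[OF assms] chart_at_mem[OF assms]]])
      (rule chart_of_inv)
  then show ?thesis unfolding components_eq by simp
qed

text \<open>The larger atlas \<open>A'\<close> accommodates charts that are compatible with \<open>A\<close> without belonging to it, as
in the definition of an integral manifold.\<close>

lemma components_change:
  assumes "smooth_atlas A'" "A \<subseteq> A'" "smooth_atlas A"
    and "c \<in> A'" "d \<in> A'" "p \<in> fst c" "p \<in> fst d"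
  shows "components A d p v = fderiv (\<lambda>x. snd d (chart_inv c x)) (snd c p) (components A c p v)"
proof -
  let ?e = "chart_at A p"
  have e: "?e \<in> A'" "p \<in> fst ?e"
    using chart_at_in[OF assms(3)] chart_at_mem[OF assms(3)] assms(2) by auto
  show ?thesis
    unfolding components_eq
    by (rule fderiv_change_source_chart[OF assms(1,1) smooth_map_ident[OF assms(1)] e assms(4,6,5,7)])
qed

lemma components_linear:
  assumes "smooth_atlas A'" "A \<subseteq> A'" "smooth_atlas A" "c \<in> A'" "p \<in> fst c"
  shows "linear (components A c p)"
  unfolding components_eq[abs_def]
  using chart_at_in[OF assms(3)] chart_at_mem[OF assms(3)] assms
  by (intro linear_frechet_derivative smooth_near_differentiable transition_smooth[OF assms(1)]) auto

lemma components_inj: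
  assumes "smooth_atlas A'" "A \<subseteq> A'" "smooth_atlas A" "c \<in> A'" "p \<in> fst c"
    and "components A c p v = components A c p w"
  shows "v = w"
proof -
  have e: "chart_at A p \<in> A'" "p \<in> fst (chart_at A p)"
    using chart_at_in[OF assms(3)] chart_at_mem[OF assms(3)] assms(2) by auto
  show ?thesis
    using components_change[OF assms(1-4) e(1) assms(5) e(2), of v]
      components_change[OF assms(1-4) e(1) assms(5) e(2), of w] assms(6)
    by (simp add: components_chart_at[OF assms(3)])
qed

section \<open>Smooth functions and sections\<close>

text \<open>Smoothness at a point is required in all charts around it; \<open>function_atI\<close> and \<open>section_atI\<close> say
that one chart, or one pair of charts, suffices.\<close>

definition function_at :: "('a, 'e::euclidean_space) chart set \<Rightarrow> ('a \<Rightarrow> real) \<Rightarrow> 'a \<Rightarrow> bool" where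
  "function_at A f p \<longleftrightarrow> (\<forall>c\<in>A. p \<in> fst c \<longrightarrow> smooth_near (\<lambda>x. f (chart_inv c x)) (snd c p))"

text \<open>The components of a section along \<open>\<iota>\<close> in the target chart \<open>d\<close>, as a function of the coordinates of
the source chart \<open>c\<close>.\<close>

definition sec_rep where
  "sec_rep A \<iota> c d V = (\<lambda>x. components A d (\<iota> (chart_inv c x)) (V (chart_inv c x)))"

definition section_at ::
  "('b, 'n::euclidean_space) chart set \<Rightarrow> ('a, 'm::euclidean_space) chart set \<Rightarrow> ('b \<Rightarrow> 'a) \<Rightarrow>
   ('b \<Rightarrow> 'm) \<Rightarrow> 'b \<Rightarrow> bool" where
  "section_at B A \<iota> V p \<longleftrightarrow> (\<forall>c\<in>B. \<forall>d\<in>A. p \<in> fst c \<longrightarrow> \<iota> p \<in> fst d \<longrightarrow>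
     smooth_near (sec_rep A \<iota> c d V) (snd c p))"

lemma smooth_function_iff:
  assumes "smooth_atlas A"
  shows "smooth_function A f \<longleftrightarrow> (\<forall>p. function_at A f p)"
proof -
  have "smooth_on (snd c ` fst c) (f \<circ> chart_inv c) \<longleftrightarrow>
     (\<forall>p\<in>fst c. smooth_near (\<lambda>x. f (chart_inv c x)) (snd c p))" if "c \<in> A" for c
    using assms that unfolding smooth_atlas_def by (simp add: smooth_on_iff_near comp_def)
  then show ?thesis unfolding smooth_function_def function_at_def by blast
qed

lemma smooth_section_on_iff:
  assumes "smooth_atlas B" "smooth_atlas A" "smooth_map B A \<iota>" "open U"
  shows "smooth_section_on B A \<iota> U V \<longleftrightarrow> (\<forall>p\<in>U. section_at B A \<iota> V p)"
proof -
  have "open (snd c ` (fst c \<inter> \<iota> -` fst d \<inter> U))" if "c \<in> B" "d \<in> A" for c d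
  proof -
    have "open (\<iota> -` fst d)"
      using assms atlas_openD[OF assms(2) that(2)] unfolding smooth_map_def by (auto intro: open_vimage)
    then have "open (snd c ` (fst c \<inter> (\<iota> -` fst d \<inter> U)))"
      using assms that by (intro chart_image_open[OF assms(1)]) auto
    then show ?thesis by (simp add: Int_assoc)
  qed
  then have "smooth_on (snd c ` (fst c \<inter> \<iota> -` fst d \<inter> U))
        ((\<lambda>q. components A d (\<iota> q) (V q)) \<circ> chart_inv c) \<longleftrightarrow>
     (\<forall>p \<in> fst c \<inter> \<iota> -` fst d \<inter> U. smooth_near (sec_rep A \<iota> c d V) (snd c p))" if "c \<in> B" "d \<in> A" for c d
    using that by (simp add: smooth_on_iff_near comp_def sec_rep_def)
  then show ?thesis unfolding smooth_section_on_def section_at_def by blast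
qed

lemma function_atI:
  assumes "smooth_atlas A" "c \<in> A" "p \<in> fst c" "smooth_near (\<lambda>x. f (chart_inv c x)) (snd c p)"
  shows "function_at A f p"
  unfolding function_at_def
proof (intro ballI impI)
  fix d assume d: "d \<in> A" "p \<in> fst d"
  have inv: "chart_inv d (snd d p) = p" by (rule chart_inv_of[OF assms(1) d])
  have 1: "smooth_near (\<lambda>x. f (chart_inv c (snd c (chart_inv d x)))) (snd d p)"
    by (rule smooth_near_compose[of "\<lambda>x. f (chart_inv c x)",
          OF _ transition_smooth[OF assms(1) d(1) assms(2) d(2) assms(3)]])
      (simp add: inv assms(4))
  have "\<forall>\<^sub>F x in nhds (snd d p). chart_inv d x \<in> fst c"
    by (rule eventually_chart_inv[OF assms(1) d eventually_in_chart[OF assms(1-3)]])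
  then have "\<forall>\<^sub>F x in nhds (snd d p). f (chart_inv c (snd c (chart_inv d x))) = f (chart_inv d x)"
    by eventually_elim (simp add: chart_inv_of[OF assms(1,2)])
  with 1 show "smooth_near (\<lambda>x. f (chart_inv d x)) (snd d p)" by (rule smooth_near_cong)
qed

lemma section_atI:
  assumes "smooth_atlas B" "smooth_atlas A" "smooth_map B A \<iota>"
    "c \<in> B" "d \<in> A" "p \<in> fst c" "\<iota> p \<in> fst d" "smooth_near (sec_rep A \<iota> c d V) (snd c p)"
  shows "section_at B A \<iota> V p"
  unfolding section_at_def
proof (intro ballI impI)
  fix c' d' assume c': "c' \<in> B" "p \<in> fst c'" and d': "d' \<in> A" "\<iota> p \<in> fst d'"
  have inv: "chart_inv c' (snd c' p) = p" by (rule chart_inv_of[OF assms(1) c'])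
  let ?W = "\<lambda>x. sec_rep A \<iota> c d V (snd c (chart_inv c' x))"
  have W: "smooth_near ?W (snd c' p)"
    by (rule smooth_near_compose[of "sec_rep A \<iota> c d V",
          OF _ transition_smooth[OF assms(1) c'(1) assms(4) c'(2) assms(6)]])
      (simp add: inv assms(8))
  have 1: "smooth_near (\<lambda>x. fderiv (\<lambda>y. snd d' (chart_inv d y)) (snd d (\<iota> (chart_inv c' x))) (?W x)) (snd c' p)"
    by (intro smooth_near_derivative W smooth_map_near[OF assms(1-3)] c' assms)
      (simp add: inv transition_smooth[OF assms(2,5) d'(1) assms(7) d'(2)])
  have "\<forall>\<^sub>F q in nhds p. q \<in> fst c \<and> \<iota> q \<in> fst d \<and> \<iota> q \<in> fst d'"
    by (intro eventually_conj eventually_in_chart[OF assms(1)] assms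
        eventually_compose_filterlim[OF eventually_in_chart[OF assms(2)] smooth_map_tendsto[OF assms(3)]] d')
  then have "\<forall>\<^sub>F x in nhds (snd c' p). chart_inv c' x \<in> fst c \<and> \<iota> (chart_inv c' x) \<in> fst d \<and> \<iota> (chart_inv c' x) \<in> fst d'"
    by (rule eventually_chart_inv[OF assms(1) c'])
  then have "\<forall>\<^sub>F x in nhds (snd c' p).
      fderiv (\<lambda>y. snd d' (chart_inv d y)) (snd d (\<iota> (chart_inv c' x))) (?W x) = sec_rep A \<iota> c' d' V x"
    by eventually_elim (simp add: sec_rep_def chart_inv_of[OF assms(1,4)]
        components_change[OF assms(2) order_refl assms(2,5) d'(1)])
  with 1 show "smooth_near (sec_rep A \<iota> c' d' V) (snd c' p)" by (rule smooth_near_cong)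
qed

lemma function_at_cong:
  assumes "smooth_atlas A" "function_at A f p" "\<forall>\<^sub>F q in nhds p. f q = g q"
  shows "function_at A g p"
  unfolding function_at_def
proof (intro ballI impI)
  fix c assume c: "c \<in> A" "p \<in> fst c"
  show "smooth_near (\<lambda>x. g (chart_inv c x)) (snd c p)"
    by (rule smooth_near_cong[OF _ eventually_chart_inv[OF assms(1) c assms(3)]])
      (use assms(2) c in \<open>simp add: function_at_def\<close>)
qed

lemma section_at_cong:
  assumes "smooth_atlas B" "section_at B A \<iota> V p" "\<forall>\<^sub>F q in nhds p. V q = W q"
  shows "section_at B A \<iota> W p"
  unfolding section_at_def
proof (intro ballI impI)
  fix c d assume c: "c \<in> B" "p \<in> fst c" "d \<in> A" "\<iota> p \<in> fst d"
  have "\<forall>\<^sub>F x in nhds (snd c p). V (chart_inv c x) = W (chart_inv c x)"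
    by (rule eventually_chart_inv[OF assms(1) c(1,2) assms(3)])
  then have "\<forall>\<^sub>F x in nhds (snd c p). sec_rep A \<iota> c d V x = sec_rep A \<iota> c d W x"
    by eventually_elim (simp add: sec_rep_def)
  then show "smooth_near (sec_rep A \<iota> c d W) (snd c p)"
    by (rule smooth_near_cong[of "sec_rep A \<iota> c d V", rotated])
      (use assms(2) c in \<open>simp add: section_at_def\<close>)
qed

lemma function_at_const [simp]: "function_at A (\<lambda>q. k) p"
  unfolding function_at_def by simp

lemma eventually_components_linear:
  assumes "smooth_atlas B" "smooth_atlas A" "smooth_map B A \<iota>" "c \<in> B" "p \<in> fst c" "d \<in> A" "\<iota> p \<in> fst d"
  shows "\<forall>\<^sub>F x in nhds (snd c p). linear (components A d (\<iota> (chart_inv c x)))"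
proof -
  have "\<forall>\<^sub>F q in nhds p. \<iota> q \<in> fst d"
    by (rule eventually_compose_filterlim[OF eventually_in_chart[OF assms(2)] smooth_map_tendsto[OF assms(3)]]) fact+
  then have "\<forall>\<^sub>F x in nhds (snd c p). \<iota> (chart_inv c x) \<in> fst d"
    by (rule eventually_chart_inv[OF assms(1,4,5)])
  then show ?thesis
    by eventually_elim (rule components_linear[OF assms(2) order_refl assms(2,6)])
qed

lemma section_at_scaleR:
  assumes "smooth_atlas B" "smooth_atlas A" "smooth_map B A \<iota>" "function_at B f p" "section_at B A \<iota> V p"
  shows "section_at B A \<iota> (\<lambda>q. f q *\<^sub>R V q) p"
  unfolding section_at_def
proof (intro ballI impI)
  fix c d assume c: "c \<in> B" "d \<in> A" "p \<in> fst c" "\<iota> p \<in> fst d"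
  have "\<forall>\<^sub>F x in nhds (snd c p). f (chart_inv c x) *\<^sub>R sec_rep A \<iota> c d V x = sec_rep A \<iota> c d (\<lambda>q. f q *\<^sub>R V q) x"
    using eventually_components_linear[OF assms(1-3) c(1,3,2,4)]
    by eventually_elim (simp add: sec_rep_def linear_scale)
  then show "smooth_near (sec_rep A \<iota> c d (\<lambda>q. f q *\<^sub>R V q)) (snd c p)"
    by (rule smooth_near_cong[OF smooth_near_scaleR, rotated -1])
      (use assms c in \<open>auto simp: section_at_def function_at_def\<close>)
qed

lemma section_at_add:
  assumes "smooth_atlas B" "smooth_atlas A" "smooth_map B A \<iota>" "section_at B A \<iota> V p" "section_at B A \<iota> W p"
  shows "section_at B A \<iota> (\<lambda>q. V q + W q) p"
  unfolding section_at_def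
proof (intro ballI impI)
  fix c d assume c: "c \<in> B" "d \<in> A" "p \<in> fst c" "\<iota> p \<in> fst d"
  have "\<forall>\<^sub>F x in nhds (snd c p). sec_rep A \<iota> c d V x + sec_rep A \<iota> c d W x = sec_rep A \<iota> c d (\<lambda>q. V q + W q) x"
    using eventually_components_linear[OF assms(1-3) c(1,3,2,4)]
    by eventually_elim (simp add: sec_rep_def linear_add)
  then show "smooth_near (sec_rep A \<iota> c d (\<lambda>q. V q + W q)) (snd c p)"
    by (rule smooth_near_cong[OF smooth_near_add, rotated -1])
      (use assms c in \<open>auto simp: section_at_def\<close>)
qed

lemma section_at_zero:
  assumes "smooth_atlas B" "smooth_atlas A" "smooth_map B A \<iota>"
  shows "section_at B A \<iota> (\<lambda>q. 0) p"
  unfolding section_at_def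
proof (intro ballI impI)
  fix c d assume c: "c \<in> B" "d \<in> A" "p \<in> fst c" "\<iota> p \<in> fst d"
  have "\<forall>\<^sub>F x in nhds (snd c p). 0 = sec_rep A \<iota> c d (\<lambda>q. 0) x"
    using eventually_components_linear[OF assms(1-3) c(1,3,2,4)]
    by eventually_elim (simp add: sec_rep_def linear_0)
  then show "smooth_near (sec_rep A \<iota> c d (\<lambda>q. 0)) (snd c p)"
    by (rule smooth_near_cong[OF smooth_near_const])
qed

lemma section_at_sum:
  assumes "smooth_atlas B" "smooth_atlas A" "smooth_map B A \<iota>" "\<And>i. i \<in> I \<Longrightarrow> section_at B A \<iota> (V i) p"
  shows "section_at B A \<iota> (\<lambda>q. \<Sum>i\<in>I. V i q) p"
  using assms(4)
proof (induction I rule: infinite_finite_induct)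
  case (insert i I)
  then have "section_at B A \<iota> (\<lambda>q. V i q + (\<Sum>i\<in>I. V i q)) p"
    by (intro section_at_add[OF assms(1-3)]) auto
  with insert show ?case by simp
qed (simp_all add: section_at_zero[OF assms(1-3)])

text \<open>A bump function in a chart, extended by zero. Its support is the image of a closed ball, hence
compact, and therefore closed because the manifold is Hausdorff; this is what makes the extension smooth.\<close>

lemma manifold_bump:
  fixes B :: "('b::{t2_space,second_countable_topology}, 'n::euclidean_space) chart set"
  assumes "smooth_atlas B" "open U" "p \<in> U"
  obtains \<rho> K where "\<And>q. function_at B \<rho> q" "\<forall>\<^sub>F q in nhds p. \<rho> q = 1"
    "closed K" "K \<subseteq> U" "\<And>q. q \<notin> K \<Longrightarrow> \<rho> q = 0"
proof -
  let ?c = "chart_at B p"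
  have c: "?c \<in> B" "p \<in> fst ?c" using chart_at_in[OF assms(1)] chart_at_mem[OF assms(1)] by auto
  have "open (snd ?c ` (fst ?c \<inter> U))" "snd ?c p \<in> snd ?c ` (fst ?c \<inter> U)"
    using chart_image_open[OF assms(1) c(1) assms(2)] c assms(3) by auto
  then obtain e where e: "e > 0" "cball (snd ?c p) e \<subseteq> snd ?c ` (fst ?c \<inter> U)"
    unfolding open_contains_cball by blast
  obtain \<sigma> :: "'n \<Rightarrow> real" where \<sigma>: "\<And>x. smooth_near \<sigma> x" "\<forall>\<^sub>F x in nhds (snd ?c p). \<sigma> x = 1"
    "\<And>x. x \<notin> ball (snd ?c p) e \<Longrightarrow> \<sigma> x = 0"
    using bump_exists[OF e(1)] by blast
  define \<rho> where "\<rho> = (\<lambda>q. if q \<in> fst ?c then \<sigma> (snd ?c q) else 0)"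
  define K where "K = chart_inv ?c ` cball (snd ?c p) e"
  have "continuous_on (cball (snd ?c p) e) (chart_inv ?c)"
    using e by (intro continuous_on_subset[OF homeomorphism_cont2[OF atlas_homeo[OF assms(1) c(1)]]]) auto
  then have K: "closed K"
    unfolding K_def by (intro compact_imp_closed compact_continuous_image) auto
  have KU: "K \<subseteq> fst ?c \<inter> U"
    using e(2) chart_inv_of[OF assms(1) c(1)] by (force simp: K_def)
  have 0: "\<rho> q = 0" if "q \<notin> K" for q
  proof (cases "q \<in> fst ?c")
    case True
    then have "snd ?c q \<notin> cball (snd ?c p) e"
      using that chart_inv_of[OF assms(1) c(1) True] unfolding K_def by (metis imageI)
    then show ?thesis using \<sigma>(3) by (auto simp: \<rho>_def)
  qed (simp add: \<rho>_def)
  have "\<forall>\<^sub>F q in nhds p. \<sigma> (snd ?c q) = 1"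
    by (rule eventually_compose_filterlim[OF \<sigma>(2) chart_tendsto[OF assms(1) c]])
  then have 1: "\<forall>\<^sub>F q in nhds p. \<rho> q = 1"
    using eventually_in_chart[OF assms(1) c] by eventually_elim (simp add: \<rho>_def)
  have "function_at B \<rho> q" for q
  proof (cases "q \<in> fst ?c")
    case True
    show ?thesis
    proof (rule function_atI[OF assms(1) c(1) True], rule smooth_near_cong[OF \<sigma>(1)])
      show "\<forall>\<^sub>F x in nhds (snd ?c q). \<sigma> x = \<rho> (chart_inv ?c x)"
        using eventually_in_chart_image[OF assms(1) c(1) True]
        by eventually_elim (simp add: \<rho>_def chart_inv_in chart_of_inv)
    qed
  next
    case False
    then have "q \<in> - K" "open (- K)" using KU K by auto
    then have "\<forall>\<^sub>F r in nhds q. 0 = \<rho> r"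
      using 0 by (auto simp: eventually_nhds)
    then show ?thesis by (rule function_at_cong[OF assms(1) function_at_const])
  qed
  then show thesis using that 1 K KU 0 by blast
qed

text \<open>Local sections become global ones in this way: the product is smooth on \<open>U\<close>, and it vanishes on the open
complement of \<open>K\<close>.\<close>

lemma cutoff_section:
  assumes "smooth_atlas B" "smooth_atlas A" "smooth_map B A \<iota>"
    and "\<And>q. function_at B \<rho> q" "closed K" "K \<subseteq> U" "\<And>q. q \<notin> K \<Longrightarrow> \<rho> q = 0"
    and "\<And>q. q \<in> U \<Longrightarrow> section_at B A \<iota> V q"
  shows "section_at B A \<iota> (\<lambda>q. \<rho> q *\<^sub>R V q) q"
proof (cases "q \<in> U")
  case True
  then show ?thesis using assms by (intro section_at_scaleR) auto
next
  case False
  then have "\<forall>\<^sub>F r in nhds q. 0 = \<rho> r *\<^sub>R V r"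
    using assms(5-7) unfolding eventually_nhds by (intro exI[of _ "- K"]) auto
  then show ?thesis by (rule section_at_cong[OF assms(1) section_at_zero[OF assms(1-3)]])
qed

lemma cutoff_function:
  assumes "smooth_atlas B" 
    and "\<And>q. function_at B \<rho> q" "closed K" "K \<subseteq> U" "\<And>q. q \<notin> K \<Longrightarrow> \<rho> q = 0"
    and "\<And>q. q \<in> U \<Longrightarrow> function_at B f q"
  shows "function_at B (\<lambda>q. \<rho> q * f q) q"
proof (cases "q \<in> U")
  case True
  then show ?thesis using assms(2)[of q] assms(6)[of q]
    unfolding function_at_def by (auto intro!: smooth_near_bilinear[OF bounded_bilinear_mult])
next
  case False
  then have "\<forall>\<^sub>F r in nhds q. 0 = \<rho> r * f r"
    using assms(3-5) unfolding eventually_nhds by (intro exI[of _ "- K"]) auto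
  then show ?thesis by (rule function_at_cong[OF assms(1) function_at_const])
qed

section \<open>Coordinate fields\<close>

lemma vector_field_iff:
  "smooth_atlas A \<Longrightarrow> vector_field A X \<longleftrightarrow> (\<forall>p. section_at A A (\<lambda>p. p) X p)"
  using smooth_section_on_iff[of A A "\<lambda>p. p" UNIV X] smooth_map_ident by auto

lemma smooth_section_iff:
  "smooth_atlas B \<Longrightarrow> smooth_atlas A \<Longrightarrow> smooth_map B A \<iota> \<Longrightarrow>
    smooth_section B A \<iota> V \<longleftrightarrow> (\<forall>p. section_at B A \<iota> V p)"
  using smooth_section_on_iff[of B A \<iota> UNIV V] by auto

text \<open>The inverse of \<open>components A c p\<close>, which is bijective for \<open>p\<close> in the domain of \<open>c\<close>.\<close>

definition from_components :: "('a, 'e::euclidean_space) chart set \<Rightarrow> ('a, 'e) chart \<Rightarrow> 'a \<Rightarrow> 'e \<Rightarrow> 'e" where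
  "from_components A c p v = inv (components A c p) v"

lemma components_from_components:
  assumes "smooth_atlas A" "c \<in> A" "p \<in> fst c"
  shows "components A c p (from_components A c p v) = v"
proof -
  have "surj (components A c p)"
    using components_linear[OF assms(1) order_refl assms] components_inj[OF assms(1) order_refl assms]
    by (intro linear_injective_imp_surjective) (auto simp: inj_def)
  then show ?thesis unfolding from_components_def by (rule surj_f_inv_f)
qed

lemma coordinate_section_at:
  assumes "smooth_atlas A" "c \<in> A" "p \<in> fst c" "smooth_near \<phi> (snd c p)"
  shows "section_at A A (\<lambda>p. p) (\<lambda>q. from_components A c q (\<phi> (snd c q))) p"
proof (rule section_atI[OF assms(1,1) smooth_map_ident[OF assms(1)] assms(2,2,3,3)], rule smooth_near_cong[OF assms(4)])
  show "\<forall>\<^sub>F x in nhds (snd c p). \<phi> x = sec_rep A (\<lambda>p. p) c c (\<lambda>q. from_components A c q (\<phi> (snd c q))) x"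
    using eventually_in_chart_image[OF assms(1-3)]
    by eventually_elim (simp add: sec_rep_def components_from_components[OF assms(1,2)] chart_inv_in chart_of_inv)
qed

text \<open>The coordinate fields of the preferred chart at \<open>y\<close>, cut off away from \<open>y\<close>. Near \<open>y\<close> they have constant
components, so they commute there.\<close>

lemma ambient_frame:
  fixes A :: "('a::{t2_space,second_countable_topology}, 'm::euclidean_space) chart set"
  assumes "smooth_atlas A"
  obtains E :: "'m \<Rightarrow> 'a \<Rightarrow> 'm" where "\<And>i. vector_field A (E i)"
    "\<forall>\<^sub>F z in nhds y. \<forall>i. components A (chart_at A y) z (E i z) = i"
proof -
  let ?a = "chart_at A y"
  note a = chart_at_in[OF assms, of y] chart_at_mem[OF assms, of y]
  obtain \<rho> K where \<rho>: "\<And>q. function_at A \<rho> q" "\<forall>\<^sub>F q in nhds y. \<rho> q = 1"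
    "closed K" "K \<subseteq> fst ?a" "\<And>q. q \<notin> K \<Longrightarrow> \<rho> q = 0"
    using manifold_bump[OF assms atlas_openD[OF assms a(1)] a(2)] by metis
  define E where "E = (\<lambda>i z. \<rho> z *\<^sub>R from_components A ?a z i)"
  have "section_at A A (\<lambda>p. p) (\<lambda>z. from_components A ?a z i) q" if "q \<in> fst ?a" for q i
    by (rule coordinate_section_at[OF assms a(1) that, of "\<lambda>_. i"]) simp
  then have "vector_field A (E i)" for i
    unfolding vector_field_iff[OF assms] E_def
    using cutoff_section[OF assms assms smooth_map_ident[OF assms] \<rho>(1,3-5)] by blast
  moreover have "\<forall>\<^sub>F z in nhds y. \<forall>i. components A ?a z (E i z) = i"
    using \<rho>(2) eventually_in_chart[OF assms a]
    by eventually_elim (simp add: E_def components_from_components[OF assms a(1)])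
  ultimately show thesis using that by blast
qed

section \<open>Push forward\<close>

lemma components_differential:
  assumes "smooth_atlas B" "smooth_atlas A" "smooth_map B A \<iota>"
    "c \<in> B" "p \<in> fst c" "d \<in> A" "\<iota> p \<in> fst d"
  shows "components A d (\<iota> p) (differential B A \<iota> p v) =
    fderiv (\<lambda>x. snd d (\<iota> (chart_inv c x))) (snd c p) (components B c p v)"
proof -
  note b = chart_at_in[OF assms(1), of p] chart_at_mem[OF assms(1), of p]
  note a = chart_at_in[OF assms(2), of "\<iota> p"] chart_at_mem[OF assms(2), of "\<iota> p"]
  show ?thesis
    unfolding components_eq differential_def comp_def
    using fderiv_change_target_chart[OF assms(1-3) b a assms(6,7)] fderiv_change_source_chart[OF assms(1-3) b assms(4-7)]
    by metis
qed

lemma pushforward_rep: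
  assumes "smooth_atlas B" "smooth_atlas A" "smooth_map B A \<iota>"
    "c \<in> B" "p \<in> fst c" "d \<in> A" "\<iota> p \<in> fst d"
  shows "\<forall>\<^sub>F x in nhds (snd c p). fderiv (\<lambda>x. snd d (\<iota> (chart_inv c x))) x
     (sec_rep B (\<lambda>p. p) c c W x) = sec_rep A \<iota> c d (pushforward B A \<iota> W) x"
proof -
  have "\<forall>\<^sub>F q in nhds p. \<iota> q \<in> fst d"
    by (rule eventually_compose_filterlim[OF eventually_in_chart[OF assms(2,6,7)] smooth_map_tendsto[OF assms(3)]])
  then have "\<forall>\<^sub>F x in nhds (snd c p). \<iota> (chart_inv c x) \<in> fst d"
    by (rule eventually_chart_inv[OF assms(1,4,5)])
  with eventually_in_chart_image[OF assms(1,4,5)] show ?thesis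
    by eventually_elim (simp add: sec_rep_def pushforward_def chart_inv_in chart_of_inv
        components_differential[OF assms(1-4) _ assms(6)])
qed

lemma sec_rep_smooth:
  "section_at B A \<iota> V p \<Longrightarrow> c \<in> B \<Longrightarrow> p \<in> fst c \<Longrightarrow> d \<in> A \<Longrightarrow> \<iota> p \<in> fst d \<Longrightarrow>
    smooth_near (sec_rep A \<iota> c d V) (snd c p)"
  unfolding section_at_def by blast

lemma pushforward_section_at:
  assumes "smooth_atlas B" "smooth_atlas A" "smooth_map B A \<iota>" "section_at B B (\<lambda>p. p) W p"
  shows "section_at B A \<iota> (pushforward B A \<iota> W) p"
proof -
  note b = chart_at_in[OF assms(1), of p] chart_at_mem[OF assms(1), of p]
  note a = chart_at_in[OF assms(2), of "\<iota> p"] chart_at_mem[OF assms(2), of "\<iota> p"]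
  show ?thesis
  proof (rule section_atI[OF assms(1-3) b(1) a(1) b(2) a(2)],
      rule smooth_near_cong[OF _ pushforward_rep[OF assms(1-3) b a]])
    show "smooth_near (\<lambda>x. fderiv (\<lambda>x. snd (chart_at A (\<iota> p)) (\<iota> (chart_inv (chart_at B p) x))) x
         (sec_rep B (\<lambda>p. p) (chart_at B p) (chart_at B p) W x)) (snd (chart_at B p) p)"
      by (rule smooth_near_derivative[OF smooth_map_near[OF assms(1-3) b(1) a(1) b(2) a(2)] smooth_near_ident
          sec_rep_smooth[OF assms(4) b b]])
  qed
qed

lemma restriction_section_at:
  assumes "smooth_atlas B" "smooth_atlas A" "smooth_map B A \<iota>" "section_at A A (\<lambda>p. p) Y (\<iota> p)"
  shows "section_at B A \<iota> (\<lambda>q. Y (\<iota> q)) p"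
proof -
  let ?b = "chart_at B p" and ?a = "chart_at A (\<iota> p)"
  note b = chart_at_in[OF assms(1), of p] chart_at_mem[OF assms(1), of p]
  note a = chart_at_in[OF assms(2), of "\<iota> p"] chart_at_mem[OF assms(2), of "\<iota> p"]
  have inv: "chart_inv ?b (snd ?b p) = p" by (rule chart_inv_of[OF assms(1) b])
  have "\<forall>\<^sub>F q in nhds p. \<iota> q \<in> fst ?a"
    by (rule eventually_compose_filterlim[OF eventually_in_chart[OF assms(2) a] smooth_map_tendsto[OF assms(3)]])
  then have "\<forall>\<^sub>F x in nhds (snd ?b p). \<iota> (chart_inv ?b x) \<in> fst ?a"
    by (rule eventually_chart_inv[OF assms(1) b])
  then have ev: "\<forall>\<^sub>F x in nhds (snd ?b p). sec_rep A (\<lambda>p. p) ?a ?a Y (snd ?a (\<iota> (chart_inv ?b x)))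
      = sec_rep A \<iota> ?b ?a (\<lambda>q. Y (\<iota> q)) x"
    by eventually_elim (simp add: sec_rep_def chart_inv_of[OF assms(2) a(1)])
  show ?thesis
  proof (rule section_atI[OF assms(1-3) b(1) a(1) b(2) a(2)], rule smooth_near_cong[OF _ ev])
    show "smooth_near (\<lambda>x. sec_rep A (\<lambda>p. p) ?a ?a Y (snd ?a (\<iota> (chart_inv ?b x)))) (snd ?b p)"
      by (rule smooth_near_compose[OF _ smooth_map_near[OF assms(1-3) b(1) a(1) b(2) a(2)]])
        (simp add: inv sec_rep_smooth[OF assms(4) a a])
  qed
qed

section \<open>Lie brackets\<close>

lemma lie_bracket_eq:
  assumes "smooth_atlas B"
  shows "lie_bracket B W U p =
    fderiv (sec_rep B (\<lambda>p. p) (chart_at B p) (chart_at B p) U) (snd (chart_at B p) p) (W p) -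
    fderiv (sec_rep B (\<lambda>p. p) (chart_at B p) (chart_at B p) W) (snd (chart_at B p) p) (U p)"
  unfolding lie_bracket_def sec_rep_def Let_def comp_def ..

lemma sec_rep_at:
  assumes "smooth_atlas B" "c \<in> B" "p \<in> fst c"
  shows "sec_rep A \<iota> c d V (snd c p) = components A d (\<iota> p) (V p)"
  by (simp add: sec_rep_def chart_inv_of[OF assms])

lemma bracket_pushforward:
  assumes "smooth_atlas B" "smooth_atlas A" "smooth_map B A \<iota>"
    "section_at B B (\<lambda>p. p) W p" "section_at B B (\<lambda>p. p) U p" "d \<in> A" "\<iota> p \<in> fst d"
  defines "b \<equiv> chart_at B p"
  shows "fderiv (sec_rep A \<iota> b d (pushforward B A \<iota> U)) (snd b p) (W p) -
    fderiv (sec_rep A \<iota> b d (pushforward B A \<iota> W)) (snd b p) (U p)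
    = components A d (\<iota> p) (differential B A \<iota> p (lie_bracket B W U p))"
proof -
  note b = chart_at_in[OF assms(1), of p, folded b_def] chart_at_mem[OF assms(1), of p, folded b_def]
  have r: "fderiv (sec_rep A \<iota> b d (pushforward B A \<iota> V)) (snd b p) =
    fderiv (\<lambda>x. fderiv (\<lambda>x. snd d (\<iota> (chart_inv b x))) x
     (sec_rep B (\<lambda>p. p) b b V x)) (snd b p)" for V
    by (rule frechet_derivative_cong[OF pushforward_rep[OF assms(1-3) b assms(6,7)], symmetric])
  have v: "V p = sec_rep B (\<lambda>p. p) b b V (snd b p)" for V
    unfolding sec_rep_at[OF assms(1) b] by (simp add: b_def components_chart_at[OF assms(1)])
  have "components A d (\<iota> p) (differential B A \<iota> p (lie_bracket B W U p)) =
     fderiv (\<lambda>x. snd d (\<iota> (chart_inv b x))) (snd b p) (lie_bracket B W U p)"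
    unfolding components_differential[OF assms(1-3) b assms(6,7)]
    by (simp add: b_def components_chart_at[OF assms(1)])
  then show ?thesis
    unfolding r lie_bracket_eq[OF assms(1)] b_def[symmetric] v[of W] v[of U]
    using pushed_bracket[OF smooth_map_near[OF assms(1-3) b(1) assms(6) b(2) assms(7)]
        sec_rep_smooth[OF assms(5) b b] sec_rep_smooth[OF assms(4) b b]]
    by simp
qed

text \<open>The derivatives are still taken in the preferred chart; only the components of the fields refer
to \<open>d\<close>. This is the form needed when \<open>d\<close> straightens a leaf of a distribution.\<close>

lemma bracket_in_compatible_chart:
  assumes "smooth_atlas B" "smooth_atlas B'" "B \<subseteq> B'"
    "section_at B B (\<lambda>p. p) W p" "section_at B B (\<lambda>p. p) U p" "d \<in> B'" "p \<in> fst d"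
  defines "b \<equiv> chart_at B p"
  shows "fderiv (sec_rep B (\<lambda>p. p) b d U) (snd b p) (W p) -
    fderiv (sec_rep B (\<lambda>p. p) b d W) (snd b p) (U p)
    = components B d p (lie_bracket B W U p)"
proof -
  note b = chart_at_in[OF assms(1), of p, folded b_def] chart_at_mem[OF assms(1), of p, folded b_def]
  have b': "b \<in> B'" using b assms(3) by auto
  have "\<forall>\<^sub>F x in nhds (snd b p). chart_inv b x \<in> fst d"
    by (rule eventually_chart_inv[OF assms(1) b eventually_in_chart[OF assms(2,6,7)]])
  with eventually_in_chart_image[OF assms(1) b]
  have ev: "\<forall>\<^sub>F x in nhds (snd b p). sec_rep B (\<lambda>p. p) b d V x =
    fderiv (\<lambda>x. snd d (chart_inv b x)) x (sec_rep B (\<lambda>p. p) b b V x)" for V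
    by eventually_elim (simp add: sec_rep_def chart_inv_in chart_of_inv
        components_change[OF assms(2,3,1) b' assms(6)])
  have v: "V p = sec_rep B (\<lambda>p. p) b b V (snd b p)" for V
    unfolding sec_rep_at[OF assms(1) b] by (simp add: b_def components_chart_at[OF assms(1)])
  have "components B d p (lie_bracket B W U p) =
     fderiv (\<lambda>x. snd d (chart_inv b x)) (snd b p) (lie_bracket B W U p)"
    unfolding components_change[OF assms(2,3,1) b' assms(6) b(2) assms(7)]
    by (simp add: b_def components_chart_at[OF assms(1)])
  then show ?thesis
    unfolding frechet_derivative_cong[OF ev] lie_bracket_eq[OF assms(1)] b_def[symmetric] v[of W] v[of U]
    using pushed_bracket[OF transition_smooth[OF assms(2) b' assms(6) b(2) assms(7)]
        sec_rep_smooth[OF assms(5) b b] sec_rep_smooth[OF assms(4) b b]]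
    by simp
qed

text \<open>In contrast to the definition, \<open>d\<close> need not be the preferred chart at \<open>p\<close>. Thus the brackets at all
points of the domain of one chart are computed in that chart.\<close>

lemma bracket_in_chart:
  assumes "smooth_atlas B" "section_at B B (\<lambda>p. p) W p" "section_at B B (\<lambda>p. p) U p" "d \<in> B" "p \<in> fst d"
  shows "fderiv (sec_rep B (\<lambda>p. p) d d U) (snd d p) (components B d p (W p)) -
    fderiv (sec_rep B (\<lambda>p. p) d d W) (snd d p) (components B d p (U p))
    = components B d p (lie_bracket B W U p)"
proof -
  define b where "b = chart_at B p"
  note b = chart_at_in[OF assms(1), of p, folded b_def] chart_at_mem[OF assms(1), of p, folded b_def]
  have inv: "chart_inv b (snd b p) = p" by (rule chart_inv_of[OF assms(1) b])
  have *: "fderiv (sec_rep B (\<lambda>p. p) b d V) (snd b p) v =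
     fderiv (sec_rep B (\<lambda>p. p) d d V) (snd d p) (components B d p v)"
    if V: "section_at B B (\<lambda>p. p) V p" for V v
  proof -
    have "\<forall>\<^sub>F x in nhds (snd b p). chart_inv b x \<in> fst d"
      by (rule eventually_chart_inv[OF assms(1) b eventually_in_chart[OF assms(1,4,5)]])
    then have ev: "\<forall>\<^sub>F x in nhds (snd b p). sec_rep B (\<lambda>p. p) d d V (snd d (chart_inv b x)) = sec_rep B (\<lambda>p. p) b d V x"
      by eventually_elim (simp add: sec_rep_def chart_inv_of[OF assms(1,4)])
    from fderiv_chain[where f = "\<lambda>x. snd d (chart_inv b x)" and h = "sec_rep B (\<lambda>p. p) d d V", OF _ _ ev] show ?thesis
      unfolding components_eq b_def[symmetric]
      by (simp add: inv smooth_near_differentiable[OF transition_smooth[OF assms(1) b(1) assms(4) b(2) assms(5)]]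
          smooth_near_differentiable[OF sec_rep_smooth[OF V assms(4,5,4,5)]])
  qed
  show ?thesis
    using bracket_in_compatible_chart[OF assms(1,1) order_refl assms(2-5)]
    unfolding b_def[symmetric] by (simp add: * assms)
qed

section \<open>Compatible charts\<close>

lemma smooth_atlasI:
  fixes A :: "('a::{t2_space,second_countable_topology}, 'e::euclidean_space) chart set"
  assumes op: "\<And>c. c \<in> A \<Longrightarrow> open (fst c)" "\<And>c. c \<in> A \<Longrightarrow> open (snd c ` fst c)"
    and homeo: "\<And>c. c \<in> A \<Longrightarrow> homeomorphism (fst c) (snd c ` fst c) (snd c) (chart_inv c)"
    and cover: "(\<Union>c\<in>A. fst c) = UNIV"
    and trans: "\<And>c d p. c \<in> A \<Longrightarrow> d \<in> A \<Longrightarrow> p \<in> fst c \<Longrightarrow> p \<in> fst d \<Longrightarrow>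
       smooth_near (\<lambda>x. snd d (chart_inv c x)) (snd c p)"
  shows "smooth_atlas A"
proof -
  have "smooth_on (snd c ` (fst c \<inter> fst d)) (snd d \<circ> chart_inv c)" if cd: "c \<in> A" "d \<in> A" for c d
  proof -
    have "snd c ` (fst c \<inter> fst d) = snd c ` fst c \<inter> chart_inv c -` fst d"
      using homeomorphism_apply1[OF homeo[OF cd(1)]] by (auto simp: image_iff)
    moreover have "open (snd c ` fst c \<inter> chart_inv c -` fst d)"
      by (rule continuous_open_preimage[OF homeomorphism_cont2[OF homeo[OF cd(1)]] op(2)[OF cd(1)] op(1)[OF cd(2)]])
    ultimately have "open (snd c ` (fst c \<inter> fst d))" by simp
    then show ?thesis using trans[OF cd] by (auto simp: smooth_on_iff_near comp_def)
  qed
  then show ?thesis unfolding smooth_atlas_def using op homeo cover by blast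
qed

text \<open>This supplies charts of the maximal atlas that straighten leaves: \<open>\<sigma>\<close> is a diffeomorphism of coordinate
space with inverse \<open>\<tau>\<close>.\<close>

lemma compatible_chart:
  assumes B: "smooth_atlas B" "b \<in> B" and open_V: "open V" and open_W: "open W"
    and \<sigma>: "\<And>y. y \<in> V \<Longrightarrow> smooth_near \<sigma> y" "\<And>y. y \<in> V \<Longrightarrow> \<sigma> y \<in> W" "\<And>y. y \<in> V \<Longrightarrow> \<tau> (\<sigma> y) = y"
    and \<tau>: "\<And>z. z \<in> W \<Longrightarrow> smooth_near \<tau> z" "\<And>z. z \<in> W \<Longrightarrow> \<tau> z \<in> V" "\<And>z. z \<in> W \<Longrightarrow> \<sigma> (\<tau> z) = z"
  defines "d \<equiv> (fst b \<inter> snd b -` V, \<lambda>q. \<sigma> (snd b q))"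
  shows "smooth_atlas (insert d B)"
proof -
  have cb: "continuous_on (fst b) (snd b)" "continuous_on (snd b ` fst b) (chart_inv b)"
    using atlas_homeo[OF B] homeomorphism_cont1 homeomorphism_cont2 by blast+
  have ob: "open (fst b)" "open (snd b ` fst b)" using B unfolding smooth_atlas_def by blast+
  have c\<sigma>: "continuous_on V \<sigma>" and c\<tau>: "continuous_on W \<tau>"
    using \<sigma>(1) \<tau>(1) smooth_near_isCont by (blast intro: continuous_at_imp_continuous_on)+
  have od: "open (fst d)" unfolding d_def by (simp add: continuous_open_preimage[OF cb(1) ob(1) open_V])
  have im: "snd d ` fst d = W \<inter> \<tau> -` (snd b ` fst b)"
  proof (intro equalityI subsetI)
    fix z assume "z \<in> snd d ` fst d" then show "z \<in> W \<inter> \<tau> -` (snd b ` fst b)"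
      unfolding d_def using \<sigma> by auto
  next
    fix z assume "z \<in> W \<inter> \<tau> -` (snd b ` fst b)"
    then obtain q where "z \<in> W" "q \<in> fst b" "\<tau> z = snd b q" by auto
    then show "z \<in> snd d ` fst d"
      unfolding d_def using \<tau>(2,3)[of z] by (intro image_eqI[of _ _ q]) auto
  qed
  have oim: "open (snd d ` fst d)" unfolding im by (rule continuous_open_preimage[OF c\<tau> open_W ob(2)])
  have "inj_on (snd d) (fst d)"
  proof (rule inj_onI)
    fix q q' assume q: "q \<in> fst d" "q' \<in> fst d" "snd d q = snd d q'"
    then have "snd b q = snd b q'" unfolding d_def using \<sigma>(3) by (metis IntD2 fst_conv snd_conv vimageD)
    then show "q = q'" using q chart_inv_of[OF B] unfolding d_def by (metis IntD1 fst_conv)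
  qed
  then have dinv: "chart_inv d (snd d q) = q" if "q \<in> fst d" for q using that by (rule inv_into_f_f)
  have inv_eq: "chart_inv d z = chart_inv b (\<tau> z)" if z: "z \<in> snd d ` fst d" for z
  proof -
    obtain q where q: "q \<in> fst d" "z = snd d q" using z by auto
    then have "\<tau> z = snd b q" using \<sigma>(3) unfolding d_def by auto
    moreover have "q \<in> fst b" using q unfolding d_def by simp
    ultimately show ?thesis using q dinv chart_inv_of[OF B] by simp
  qed
  have cd: "continuous_on (fst d) (snd d)"
    unfolding d_def fst_conv snd_conv
    by (rule continuous_on_compose2[OF c\<sigma> continuous_on_subset[OF cb(1)]]) auto
  have "continuous_on (snd d ` fst d) (\<lambda>z. chart_inv b (\<tau> z))"
    by (rule continuous_on_compose2[OF cb(2) continuous_on_subset[OF c\<tau>]]) (use im in auto)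
  then have cinv: "continuous_on (snd d ` fst d) (chart_inv d)"
    by (rule continuous_on_eq) (simp add: inv_eq)
  have hd: "homeomorphism (fst d) (snd d ` fst d) (snd d) (chart_inv d)"
    unfolding homeomorphism_def using cd cinv dinv by (auto simp: image_iff)
  have into: "smooth_near (\<lambda>x. snd d (chart_inv c x)) (snd c p)" if c: "c \<in> B" "p \<in> fst c" "p \<in> fst d" for c p
  proof -
    have p: "p \<in> fst b" "snd b p \<in> V" using c(3) unfolding d_def by auto
    have inv: "chart_inv c (snd c p) = p" by (rule chart_inv_of[OF B(1) c(1,2)])
    have "smooth_near (\<lambda>x. \<sigma> (snd b (chart_inv c x))) (snd c p)"
      by (rule smooth_near_compose[OF _ transition_smooth[OF B(1) c(1) B(2) c(2) p(1)]])
        (simp add: inv \<sigma>(1) p(2))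
    then show ?thesis unfolding d_def by simp
  qed
  have "smooth_near (\<lambda>x. snd c (chart_inv d x)) (snd d p)" if c: "c \<in> B" "p \<in> fst c" "p \<in> fst d" for c p
  proof -
    have p: "p \<in> fst b" "snd b p \<in> V" "snd d p = \<sigma> (snd b p)" using c(3) unfolding d_def by auto
    have "smooth_near (\<lambda>x. snd c (chart_inv b (\<tau> x))) (snd d p)"
      by (rule smooth_near_compose[of "\<lambda>y. snd c (chart_inv b y)"])
        (use transition_smooth[OF B c(1) p(1) c(2)] \<sigma>(2,3)[OF p(2)] \<tau>(1) p(3) in auto)
    moreover have "\<forall>\<^sub>F x in nhds (snd d p). snd c (chart_inv b (\<tau> x)) = snd c (chart_inv d x)"
      using oim c(3) inv_eq unfolding eventually_nhds by (intro exI[of _ "snd d ` fst d"]) auto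
    ultimately show ?thesis by (rule smooth_near_cong)
  qed
  moreover have "smooth_near (\<lambda>x. snd d (chart_inv d x)) (snd d p)" if "p \<in> fst d" for p
  proof (rule smooth_near_cong[OF smooth_near_ident])
    show "\<forall>\<^sub>F x in nhds (snd d p). x = snd d (chart_inv d x)"
      using oim that unfolding eventually_nhds
      by (intro exI[of _ "snd d ` fst d"]) (auto simp: chart_of_inv)
  qed
  ultimately show ?thesis
    using od oim hd into B(1) transition_smooth[OF B(1)] atlas_homeo[OF B(1)]
    by (intro smooth_atlasI) (auto simp: smooth_atlas_def)
qed

section \<open>Frobenius' theorem\<close>

definition field_in ::
  "('b, 'n::euclidean_space) chart set \<Rightarrow> ('b \<Rightarrow> 'n set) \<Rightarrow> ('b \<Rightarrow> 'n) \<Rightarrow> bool" where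
  "field_in B E W \<longleftrightarrow> vector_field B W \<and> (\<forall>p. W p \<in> E p)"

definition involutive :: "('b, 'n::euclidean_space) chart set \<Rightarrow> ('b \<Rightarrow> 'n set) \<Rightarrow> bool" where
  "involutive B E \<longleftrightarrow> (\<forall>W U. field_in B E W \<longrightarrow> field_in B E U \<longrightarrow> (\<forall>p. lie_bracket B W U p \<in> E p))"

text \<open>In a chart \<open>c\<close> in which the leaf through \<open>p\<close> is a slice by \<open>F\<close>, fields in the distribution take values
in \<open>F\<close> along the slice, and they are differentiated at \<open>p\<close> in directions tangent to the slice. So
both terms of the coordinate formula for the bracket lie in \<open>F\<close>.\<close>

lemma integrable_imp_involutive:
  assumes B: "smooth_atlas B" and int: "integrable_distribution B E" and E: "\<And>p. subspace (E p)"
  shows "involutive B E"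
  unfolding involutive_def
proof (intro allI impI)
  fix W U p assume W: "field_in B E W" and U: "field_in B E U"
  obtain L where L: "p \<in> L" "integral_manifold B E L" using int unfolding integrable_distribution_def by blast
  obtain c F where c': "smooth_atlas (insert c B)" "p \<in> fst c" "subspace F"
    "L \<inter> fst c = {q \<in> fst c. snd c q \<in> F}" "\<forall>q\<in>L \<inter> fst c. components B c q ` E q = F"
    using bspec[OF L(2)[unfolded integral_manifold_def] L(1)] by (elim exE conjE) (rule that; assumption)
  note c = c'(1-4) c'(5)[rule_format]
  define b where "b = chart_at B p"
  note b = chart_at_in[OF B, of p, folded b_def] chart_at_mem[OF B, of p, folded b_def]
  let ?B = "insert c B"
  have b': "b \<in> ?B" and cB: "c \<in> ?B" using b by auto
  have pL: "p \<in> L \<inter> fst c" using L c by auto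
  then have cpF: "snd c p \<in> F" using c(4) by auto
  have binv: "chart_inv b (snd b p) = p" by (rule chart_inv_of[OF B b])
  have cinv: "chart_inv c (snd c p) = p" by (rule chart_inv_of[OF c(1) cB c(2)])
  \<comment> \<open>\<open>\<gamma>\<close> below is a curve in the leaf with velocity \<open>W p\<close>, a straight line in \<open>c\<close>; along it the components of \<open>U\<close>
    stay in \<open>F\<close>, hence so does their derivative\<close>
  have key: "fderiv (sec_rep B (\<lambda>p. p) b c U) (snd b p) (W p) \<in> F"
    if W: "field_in B E W" and U: "field_in B E U" for W U
  proof -
    define w where "w = components B c p (W p)"
    have wF: "w \<in> F" using c(5)[OF pL] W unfolding field_in_def w_def by blast
    define \<gamma> where "\<gamma> = (\<lambda>t::real. snd b (chart_inv c (snd c p + t *\<^sub>R w)))"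
    have 1: "((\<lambda>t::real. snd c p + t *\<^sub>R w) has_derivative (\<lambda>t. t *\<^sub>R w)) (at 0)"
      by (auto intro!: derivative_eq_intros)
    have 2: "((\<lambda>x. snd b (chart_inv c x)) has_derivative fderiv (\<lambda>x. snd b (chart_inv c x)) (snd c p))
        (at (snd c p + (0::real) *\<^sub>R w))"
      using smooth_near_has_derivative[OF transition_smooth[OF c(1) cB b' c(2) b(2)]] by simp
    have "fderiv (\<lambda>x. snd b (chart_inv c x)) (snd c p) w = components B b p (W p)"
      unfolding w_def by (rule components_change[OF c(1) subset_insertI B cB b' c(2) b(2), symmetric])
    also have "\<dots> = W p" unfolding b_def by (rule components_chart_at[OF B])
    finally have w: "fderiv (\<lambda>x. snd b (chart_inv c x)) (snd c p) w = W p" .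
    have lin2: "linear (fderiv (\<lambda>x. snd b (chart_inv c x)) (snd c p))"
      by (intro linear_frechet_derivative smooth_near_differentiable transition_smooth[OF c(1) cB b' c(2) b(2)])
    have 3: "(\<gamma> has_derivative (\<lambda>t. t *\<^sub>R W p)) (at 0)"
      using has_derivative_compose[OF 1 2] unfolding \<gamma>_def linear_scale[OF lin2] w .
    have \<gamma>0: "\<gamma> 0 = snd b p" unfolding \<gamma>_def by (simp add: cinv)
    have sU: "section_at B B (\<lambda>p. p) U p" using U unfolding field_in_def vector_field_iff[OF B] by blast
    have repc: "\<forall>\<^sub>F x in nhds (snd b p). sec_rep B (\<lambda>p. p) b c U x =
      fderiv (\<lambda>x. snd c (chart_inv b x)) x (sec_rep B (\<lambda>p. p) b b U x)"
    proof -
      have "\<forall>\<^sub>F x in nhds (snd b p). chart_inv b x \<in> fst c"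
        by (rule eventually_chart_inv[OF B b eventually_in_chart[OF c(1) cB c(2)]])
      with eventually_in_chart_image[OF B b] show ?thesis
        by eventually_elim (simp add: sec_rep_def chart_inv_in chart_of_inv
            components_change[OF c(1) subset_insertI B b' cB])
    qed
    have smr: "smooth_near (sec_rep B (\<lambda>p. p) b c U) (snd b p)"
    proof (rule smooth_near_cong)
      show "smooth_near (\<lambda>x. fderiv (\<lambda>x. snd c (chart_inv b x)) x (sec_rep B (\<lambda>p. p) b b U x)) (snd b p)"
        by (rule smooth_near_derivative[OF transition_smooth[OF c(1) b' cB b(2) c(2)] smooth_near_ident
            sec_rep_smooth[OF sU b b]])
      show "\<forall>\<^sub>F x in nhds (snd b p). fderiv (\<lambda>x. snd c (chart_inv b x)) x (sec_rep B (\<lambda>p. p) b b U x)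
         = sec_rep B (\<lambda>p. p) b c U x"
        using repc by eventually_elim simp
    qed
    let ?D = "fderiv (sec_rep B (\<lambda>p. p) b c U) (snd b p)"
    have 4: "((\<lambda>t. sec_rep B (\<lambda>p. p) b c U (\<gamma> t)) has_derivative (\<lambda>t. ?D (t *\<^sub>R W p))) (at 0)"
      by (rule has_derivative_compose[OF 3]) (simp add: \<gamma>0 smooth_near_has_derivative[OF smr])
    have inF: "\<forall>\<^sub>F t in nhds (0::real). sec_rep B (\<lambda>p. p) b c U (\<gamma> t) \<in> F"
    proof -
      have "isCont (\<lambda>t::real. snd c p + t *\<^sub>R w) 0" by (intro continuous_intros)
      then have lim: "filterlim (\<lambda>t::real. snd c p + t *\<^sub>R w) (nhds (snd c p)) (nhds 0)"
        using tendsto_at_iff_tendsto_nhds[of "\<lambda>t::real. snd c p + t *\<^sub>R w" 0] by (simp add: isCont_def)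
      have "\<forall>\<^sub>F x in nhds (snd c p). chart_inv c x \<in> fst b"
        by (rule eventually_chart_inv[OF c(1) cB c(2) eventually_in_chart[OF B b]])
      with eventually_in_chart_image[OF c(1) cB c(2)]
      have "\<forall>\<^sub>F x in nhds (snd c p). x \<in> snd c ` fst c \<and> chart_inv c x \<in> fst b" by (rule eventually_conj)
      from eventually_compose_filterlim[OF this lim] show ?thesis
      proof eventually_elim
        case (elim t)
        let ?q = "chart_inv c (snd c p + t *\<^sub>R w)"
        have "snd c ?q = snd c p + t *\<^sub>R w" "?q \<in> fst c"
          using elim by (auto intro: chart_of_inv chart_inv_in)
        moreover have "snd c p + t *\<^sub>R w \<in> F" using c(3) cpF wF by (intro subspace_add subspace_scale)
        ultimately have "?q \<in> L \<inter> fst c" using c(4) by auto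
        then have "components B c ?q (U ?q) \<in> F" using c(5) U unfolding field_in_def by blast
        then show ?case using elim chart_inv_of[OF B b(1)] by (simp add: sec_rep_def \<gamma>_def)
      qed
    qed
    obtain y z where yz: "y \<in> span F" "\<And>v. v \<in> span F \<Longrightarrow> orthogonal z v" "?D (W p) = y + z"
      using orthogonal_subspace_decomp_exists[of F "?D (W p)"] by metis
    have spF: "span F = F" using c(3) by (simp add: span_eq_iff)
    have "\<forall>\<^sub>F t in nhds (0::real). sec_rep B (\<lambda>p. p) b c U (\<gamma> t) \<bullet> z = 0"
    proof (use inF in eventually_elim)
      case (elim t)
      then show ?case using yz(2)[unfolded spF, OF elim] by (simp add: orthogonal_def inner_commute)
    qed
    then have "fderiv (\<lambda>t. sec_rep B (\<lambda>p. p) b c U (\<gamma> t) \<bullet> z) 0 = (\<lambda>t. 0)"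
      using frechet_derivative_cong[of "\<lambda>t. sec_rep B (\<lambda>p. p) b c U (\<gamma> t) \<bullet> z" "\<lambda>t. 0" 0] by simp
    moreover have "(\<lambda>t. ?D (t *\<^sub>R W p) \<bullet> z) = fderiv (\<lambda>t. sec_rep B (\<lambda>p. p) b c U (\<gamma> t) \<bullet> z) 0"
      by (rule frechet_derivative_at[OF has_derivative_inner_left[OF 4]])
    ultimately have "(\<lambda>t. ?D (t *\<^sub>R W p) \<bullet> z) = (\<lambda>t. 0)" by simp
    then have "?D (1 *\<^sub>R W p) \<bullet> z = 0" by (rule fun_cong)
    then have "y \<bullet> z + z \<bullet> z = 0" unfolding scaleR_one yz(3) by (simp add: inner_add_left)
    moreover have "y \<bullet> z = 0" using yz(2)[OF yz(1)] by (simp add: orthogonal_def inner_commute)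
    ultimately have "z = 0" by simp
    then show ?thesis using yz spF by simp
  qed
  have "components B c p (lie_bracket B W U p) \<in> F"
    using bracket_in_compatible_chart[OF B c(1) subset_insertI _ _ cB c(2), of W U] key[OF W U] key[OF U W] W U c(3)
    unfolding field_in_def vector_field_iff[OF B] b_def[symmetric] by (metis subspace_diff)
  then obtain v where "v \<in> E p" "components B c p v = components B c p (lie_bracket B W U p)"
    using c(5)[OF pL] by (metis imageE)
  then show "lie_bracket B W U p \<in> E p"
    using components_inj[OF c(1) subset_insertI B cB c(2)] by metis
qed

text \<open>In the preferred chart at \<open>p\<close>, take an adapted frame \<open>M\<close> of the distribution. The bracket of two fields
\<open>x \<mapsto> M x u\<close> is in the distribution by involutivity, and \<open>\<pi>\<close> annihilates it because \<open>\<pi> (M x u) = \<pi> u\<close> does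
not depend on \<open>x\<close>. As \<open>\<pi>\<close> is injective on the distribution, the fields commute, and
\<open>commuting_frame_leaf\<close> yields \<open>\<Phi>\<close> with \<open>D\<Phi>(z) = M (\<Phi> z)\<close>. This equation makes \<open>\<Phi>\<close> as smooth as \<open>M\<close>.

The leaf through \<open>p\<close> is the graph of \<open>\<Phi>\<close> over \<open>F = range \<pi>\<close>, and the chart
\<open>y \<mapsto> y - \<Phi> (\<pi> (y - x0)) + \<pi> (y - x0)\<close> maps it into \<open>F\<close>. Only this one leaf becomes a slice; the
neighbouring leaves are in general not slices of this chart.\<close>

lemma involutive_imp_integrable:
  fixes B :: "('b::{t2_space,second_countable_topology}, 'n::euclidean_space) chart set"
  assumes B: "smooth_atlas B" and dist: "distribution B r E" and inv: "involutive B E"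
  shows "integrable_distribution B E"
  unfolding integrable_distribution_def
proof
  fix p
  have E: "subspace (E q)" "dim (E q) = r" for q using dist unfolding smooth_subbundle_def by blast+
  define b where "b = chart_at B p"
  note b = chart_at_in[OF B, of p, folded b_def] chart_at_mem[OF B, of p, folded b_def]
  define x0 where "x0 = snd b p"
  define Eh where "Eh = (\<lambda>x. components B b (chart_inv b x) ` E (chart_inv b x))"
  obtain U s where U: "open U" "p \<in> U" "\<forall>j<r. smooth_section_on B B (\<lambda>p. p) U (s j)"
    "\<forall>q\<in>U. E q = span ((\<lambda>j. s j q) ` {..<r})"
    using dist unfolding smooth_subbundle_def by blast
  define S where "S = (\<lambda>j. sec_rep B (\<lambda>p. p) b b (s j))"
  have sat: "section_at B B (\<lambda>p. p) (s j) p" if "j < r" for j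
    using U that smooth_section_on_iff[OF B B smooth_map_ident[OF B] U(1)] by blast
  have smS: "smooth_near (S j) x0" if "j < r" for j
    unfolding S_def x0_def by (rule sec_rep_smooth[OF sat[OF that] b b])
  have clin: "linear (components B b q)" if "q \<in> fst b" for q
    by (rule components_linear[OF B order_refl B b(1) that])
  have Eh_S: "\<forall>\<^sub>F x in nhds x0. Eh x = span ((\<lambda>j. S j x) ` {..<r})"
  proof -
    have "\<forall>\<^sub>F q in nhds p. q \<in> U" using U(1,2) by (auto simp: eventually_nhds)
    then have "\<forall>\<^sub>F x in nhds x0. chart_inv b x \<in> U" unfolding x0_def by (rule eventually_chart_inv[OF B b])
    then show ?thesis
      using eventually_in_chart_image[OF B b, folded x0_def]
    proof eventually_elim
      case (elim x)
      have "Eh x = span (components B b (chart_inv b x) ` (\<lambda>j. s j (chart_inv b x)) ` {..<r})"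
        unfolding Eh_def using U(4) elim(1) linear_span_image[OF clin[OF chart_inv_in[OF elim(2)]]] by metis
      then show ?case unfolding S_def sec_rep_def image_image .
    qed
  qed
  have binv: "chart_inv b x0 = p" unfolding x0_def by (rule chart_inv_of[OF B b])
  have "Eh x0 = E p" unfolding Eh_def binv unfolding b_def by (simp add: components_chart_at[OF B])
  then have "dim (span ((\<lambda>j. S j x0) ` {..<r})) = r"
    using eventually_nhds_x_imp_x[OF Eh_S] E(2) by metis
  then obtain M :: "'n \<Rightarrow> 'n \<Rightarrow>\<^sub>L 'n" and \<pi> where M: "smooth_near M x0" "linear \<pi>" "\<And>u. \<pi> (\<pi> u) = \<pi> u"
    and evM: "\<forall>\<^sub>F x in nhds x0. (\<forall>u. \<pi> (M x u) = \<pi> u) \<and> (\<forall>u. M x (\<pi> u) = M x u)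
        \<and> range (M x) = span ((\<lambda>j. S j x) ` {..<r})"
    using adapted_frame[of r S x0, OF smS] by blast
  define good where "good = (\<lambda>x. x \<in> snd b ` fst b \<and> smooth_near M x \<and> (\<forall>u. \<pi> (M x u) = \<pi> u)
      \<and> (\<forall>u. M x (\<pi> u) = M x u) \<and> range (M x) = Eh x)"
  have "\<forall>\<^sub>F x in nhds x0. good x"
    using evM Eh_S smooth_near_eventually[OF M(1)] eventually_in_chart_image[OF B b, folded x0_def]
    by eventually_elim (simp add: good_def)
  then obtain V where V0: "open V" "x0 \<in> V" "\<And>x. x \<in> V \<Longrightarrow> good x"
    unfolding eventually_nhds by blast
  have V: "open V" "x0 \<in> V" "\<And>x. x \<in> V \<Longrightarrow> x \<in> snd b ` fst b" "\<And>x. x \<in> V \<Longrightarrow> smooth_near M x"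
    "\<And>x u. x \<in> V \<Longrightarrow> \<pi> (M x u) = \<pi> u" "\<And>x u. x \<in> V \<Longrightarrow> M x (\<pi> u) = M x u" "\<And>x. x \<in> V \<Longrightarrow> range (M x) = Eh x"
    using V0(1,2) V0(3)[unfolded good_def] by simp_all
  have bMl: "bounded_linear \<pi>" using M(2) by (simp add: linear_conv_bounded_linear)
  have smMu: "smooth_near (\<lambda>x. M x u) x" if "x \<in> V" for x u
    by (rule smooth_near_bounded_linear[OF blinfun.bounded_linear_left V(4)[OF that]])
  \<comment> \<open>involutivity speaks of global fields only, so the frame fields are cut off outside a neighbourhood of \<open>p\<close>\<close>
  define N where "N = fst b \<inter> snd b -` V"
  have N: "open N" "p \<in> N"
    unfolding N_def using V(1,2) b x0_def
      continuous_open_preimage[OF homeomorphism_cont1[OF atlas_homeo[OF B b(1)]] atlas_openD[OF B b(1)]] by auto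
  obtain \<rho> K where \<rho>: "\<And>q. function_at B \<rho> q" "\<forall>\<^sub>F q in nhds p. \<rho> q = 1"
    "closed K" "K \<subseteq> N" "\<And>q. q \<notin> K \<Longrightarrow> \<rho> q = 0"
    using manifold_bump[OF B N] by metis
  define X where "X = (\<lambda>u q. \<rho> q *\<^sub>R from_components B b q (M (snd b q) u))"
  have X: "field_in B E (X u)" for u
    unfolding field_in_def vector_field_iff[OF B]
  proof (intro conjI allI)
    have "section_at B B (\<lambda>p. p) (\<lambda>q. from_components B b q (M (snd b q) u)) q" if "q \<in> N" for q
      using that unfolding N_def by (intro coordinate_section_at[OF B b(1)] smMu) auto
    from cutoff_section[OF B B smooth_map_ident[OF B] \<rho>(1,3-5) this]
    show "section_at B B (\<lambda>p. p) (X u) q" for q unfolding X_def by blast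
    show "X u q \<in> E q" for q
    proof (cases "q \<in> K")
      case True
      then have q: "q \<in> fst b" "snd b q \<in> V" using \<rho>(4) unfolding N_def by auto
      have "M (snd b q) u \<in> Eh (snd b q)" using V(7)[OF q(2)] by blast
      then obtain v where v: "v \<in> E q" "components B b q v = M (snd b q) u"
        unfolding Eh_def chart_inv_of[OF B b(1) q(1)] by auto
      have "from_components B b q (M (snd b q) u) = v"
        by (rule components_inj[OF B order_refl B b(1) q(1)]) (simp add: components_from_components[OF B b(1) q(1)] v(2))
      then show ?thesis unfolding X_def using v(1) E(1) by (simp add: subspace_scale)
    next
      case False
      then show ?thesis unfolding X_def using \<rho>(5) subspace_0[OF E(1)] by simp
    qed
  qed
  obtain O1 where O1: "open O1" "p \<in> O1" "\<And>q. q \<in> O1 \<Longrightarrow> \<rho> q = 1"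
    using \<rho>(2) unfolding eventually_nhds by blast
  define V' where "V' = V \<inter> (snd b ` (fst b \<inter> O1))"
  have V': "open V'" "x0 \<in> V'"
    unfolding V'_def using V(1,2) chart_image_open[OF B b(1) O1(1)] b(2) O1(2) x0_def by auto
  define M' where "M' = (\<lambda>x. Blinfun (fderiv M x))"
  have M': "blinfun_apply (M' x) = fderiv M x" if "x \<in> V" for x
    unfolding M'_def
    using smooth_near_has_derivative[OF V(4)[OF that]]
    by (intro bounded_linear_Blinfun_apply) (rule has_derivative_bounded_linear)
  have derM: "(M has_derivative blinfun_apply (M' x)) (at x)" if "x \<in> V" for x
    unfolding M'[OF that] by (rule smooth_near_has_derivative[OF V(4)[OF that]])
  have contM': "continuous_on V' M'"
  proof (rule continuous_at_imp_continuous_on, rule ballI, rule smooth_near_isCont, rule smooth_near_blinfunI)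
    fix x v assume "x \<in> V'"
    then have x: "x \<in> V" unfolding V'_def by simp
    show "smooth_near (\<lambda>x. M' x v) x"
    proof (rule smooth_near_cong[OF smooth_near_derivative_const[OF V(4)[OF x], of v]])
      show "\<forall>\<^sub>F y in nhds x. fderiv M y v = M' y v"
        unfolding eventually_nhds using V(1) x M' by (intro exI[of _ V]) auto
    qed
  qed
  have dMu: "fderiv (\<lambda>x. M x v) x w = M' x w v" if "x \<in> V" for x v w
    using frechet_derivative_bounded_linear[OF blinfun.bounded_linear_left smooth_near_differentiable[OF V(4)[OF that]]]
    unfolding M'[OF that] .
  have comm: "M' x (M x u) v = M' x (M x v) u" if x: "x \<in> V'" for x u v
  proof -
    obtain q where q: "q \<in> fst b" "q \<in> O1" "x = snd b q" and xV: "x \<in> V" using x unfolding V'_def by auto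
    have rep: "\<forall>\<^sub>F y in nhds (snd b q). sec_rep B (\<lambda>p. p) b b (X u) y = M y u" for u
    proof -
      have "\<forall>\<^sub>F y in nhds (snd b q). y \<in> V'" using V'(1) x q(3) by (auto simp: eventually_nhds)
      then show ?thesis
      proof eventually_elim
        case (elim y)
        then obtain q' where q': "q' \<in> fst b" "q' \<in> O1" "y = snd b q'" unfolding V'_def by auto
        show ?case
          unfolding sec_rep_def q'(3) chart_inv_of[OF B b(1) q'(1)]
          by (simp add: X_def O1(3)[OF q'(2)] components_from_components[OF B b(1) q'(1)])
      qed
    qed
    have val: "components B b q (X u q) = M x u" for u
      using eventually_nhds_x_imp_x[OF rep[of u]] unfolding sec_rep_at[OF B b(1) q(1)] q(3) .
    have sX: "section_at B B (\<lambda>p. p) (X u) q" for u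
      using X unfolding field_in_def vector_field_iff[OF B] by blast
    have br: "M' x (M x u) v - M' x (M x v) u = components B b q (lie_bracket B (X u) (X v) q)"
      using bracket_in_chart[OF B sX sX b(1) q(1), of v u]
      unfolding q(3)[symmetric] frechet_derivative_cong[OF rep, folded q(3)] val dMu[OF xV] .
    have "lie_bracket B (X u) (X v) q \<in> E q" using inv X unfolding involutive_def by blast
    then have "components B b q (lie_bracket B (X u) (X v) q) \<in> Eh x"
      unfolding Eh_def q(3) chart_inv_of[OF B b(1) q(1)] by blast
    then have "M' x (M x u) v - M' x (M x v) u \<in> Eh x" unfolding br .
    then obtain c where c: "M' x (M x u) v - M' x (M x v) u = M x c"
      using V(7)[OF xV] by (metis imageE)
    have \<pi>0: "\<pi> (M' x w v) = 0" for w v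
    proof -
      have "\<pi> (M' x w v) = fderiv (\<lambda>x. \<pi> (M x v)) x w"
        using frechet_derivative_bounded_linear[OF bMl smooth_near_differentiable[OF smMu[OF xV]], of v w]
        unfolding dMu[OF xV] by simp
      also have "fderiv (\<lambda>x. \<pi> (M x v)) x = fderiv (\<lambda>x. \<pi> v) x"
        by (rule frechet_derivative_cong) (use V(1,5) xV in \<open>auto simp: eventually_nhds\<close>)
      finally show ?thesis by simp
    qed
    have "\<pi> (M x c) = 0" unfolding c[symmetric] by (simp add: linear_diff[OF M(2)] \<pi>0)
    then have "\<pi> c = 0" using V(5)[OF xV] by simp
    then have "M x c = 0" using V(6)[OF xV, of c] by simp
    then show ?thesis using c by simp
  qed
  obtain \<epsilon> \<Phi> where \<epsilon>: "\<epsilon> > 0" and \<Phi>0: "\<Phi> 0 = x0" and \<Phi>V': "\<And>z. z \<in> ball 0 \<epsilon> \<Longrightarrow> \<Phi> z \<in> V'"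
    and \<Phi>d: "\<And>z. z \<in> ball 0 \<epsilon> \<Longrightarrow> (\<Phi> has_derivative blinfun_apply (M (\<Phi> z))) (at z)"
    using commuting_frame_leaf[OF V' derM contM' comm] unfolding V'_def by blast
  have \<Phi>V: "\<Phi> z \<in> V" if "z \<in> ball 0 \<epsilon>" for z using \<Phi>V'[OF that] unfolding V'_def by simp
  \<comment> \<open>if \<open>\<Phi>\<close> is of class \<open>C\<^sup>k\<close>, then so is its derivative \<open>M (\<Phi> z)\<close>\<close>
  have MV: "Ck_on k V M" for k
    using V(4) smooth_on_iff_near[OF V(1)] unfolding smooth_on_def by blast
  have "Ck_on k (ball 0 \<epsilon>) \<Phi>" for k
  proof (induction k)
    case 0
    show ?case using \<Phi>d by (auto intro!: continuous_at_imp_continuous_on has_derivative_continuous)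
  next
    case (Suc k)
    have "Ck_on k (ball 0 \<epsilon>) (\<lambda>z. M (\<Phi> z))"
      by (rule Ck_on_compose[OF open_ball V(1) MV Suc.IH]) (use \<Phi>V in blast)
    then show ?case
      by (intro Ck_on_SucI[OF open_ball \<Phi>d] Ck_on_bounded_linear[OF blinfun.bounded_linear_left open_ball])
  qed
  then have sm\<Phi>: "smooth_near \<Phi> z" if "z \<in> ball 0 \<epsilon>" for z
    using that unfolding smooth_near_def smooth_on_def by blast
  have \<pi>\<Phi>: "\<pi> (\<Phi> z) = \<pi> x0 + \<pi> z" if z: "z \<in> ball 0 \<epsilon>" for z
  proof -
    have "((\<lambda>z. \<pi> (\<Phi> z) - \<pi> z) has_derivative (\<lambda>h. 0)) (at z within ball 0 \<epsilon>)" if "z \<in> ball 0 \<epsilon>" for z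
    proof -
      have "((\<lambda>z. \<pi> (\<Phi> z) - \<pi> z) has_derivative (\<lambda>h. \<pi> (M (\<Phi> z) h) - \<pi> h)) (at z)"
        by (intro has_derivative_diff bounded_linear.has_derivative[OF bMl] \<Phi>d that
            bounded_linear_imp_has_derivative bMl)
      then show ?thesis
        unfolding V(5)[OF \<Phi>V[OF that]] by (simp add: has_derivative_at_withinI)
    qed
    then obtain k where "\<And>z. z \<in> ball 0 \<epsilon> \<Longrightarrow> \<pi> (\<Phi> z) - \<pi> z = k"
      using has_derivative_zero_constant[of "ball 0 \<epsilon>" "\<lambda>z. \<pi> (\<Phi> z) - \<pi> z"] by auto
    from this[OF z] this[of 0] show ?thesis
      using \<epsilon> by (simp add: \<Phi>0 linear_0[OF M(2)] algebra_simps)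
  qed
  \<comment> \<open>\<open>\<sigma>\<close> straightens the leaf: \<open>\<pi> (\<sigma> y) = \<pi> (y - x0)\<close>, so \<open>\<sigma> y \<in> F\<close> forces \<open>y = \<Phi> (\<pi> (y - x0))\<close>; \<open>\<tau>\<close> is its inverse\<close>
  define \<sigma> where "\<sigma> = (\<lambda>y. y - \<Phi> (\<pi> (y - x0)) + \<pi> (y - x0))"
  define \<tau> where "\<tau> = (\<lambda>z. z + \<Phi> (\<pi> z) - \<pi> z)"
  define G where "G = {y. \<pi> (y - x0) \<in> ball 0 \<epsilon>}"
  define H where "H = {z. \<pi> z \<in> ball 0 \<epsilon>}"
  have \<pi>cont: "continuous_on UNIV \<pi>" using bMl by (rule linear_continuous_on)
  have oG: "open G" and oH: "open H"
    unfolding G_def H_def using open_vimage[OF open_ball, of "\<lambda>y. \<pi> (y - x0)" 0 \<epsilon>] open_vimage[OF open_ball \<pi>cont, of 0 \<epsilon>]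
      continuous_on_compose2[OF \<pi>cont, of UNIV "\<lambda>y. y - x0"] by (auto simp: vimage_def continuous_intros)
  note \<pi>lin = linear_add[OF M(2)] linear_diff[OF M(2)]
  have \<pi>\<sigma>: "\<pi> (\<sigma> y) = \<pi> (y - x0)" if "y \<in> G" for y
    using \<pi>\<Phi>[of "\<pi> (y - x0)"] that unfolding \<sigma>_def G_def by (simp add: \<pi>lin M(3))
  have \<pi>\<tau>: "\<pi> (\<tau> z - x0) = \<pi> z" if "z \<in> H" for z
    using \<pi>\<Phi>[of "\<pi> z"] that unfolding \<tau>_def H_def by (simp add: \<pi>lin M(3))
  have \<tau>\<sigma>: "\<tau> (\<sigma> y) = y" if "y \<in> G" for y
    using \<pi>\<sigma>[OF that] unfolding \<tau>_def by (simp add: \<sigma>_def)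
  have \<sigma>\<tau>: "\<sigma> (\<tau> z) = z" if "z \<in> H" for z
    using \<pi>\<tau>[OF that] unfolding \<sigma>_def by (simp add: \<tau>_def)
  have sm\<pi>: "smooth_near (\<lambda>y. \<pi> (y - x0)) y" "smooth_near \<pi> y" for y
    by (rule smooth_near_bounded_linear[OF bMl smooth_near_diff[OF smooth_near_ident smooth_near_const]])
      (rule smooth_near_linear[OF bMl])
  have sm\<sigma>: "smooth_near \<sigma> y" if "y \<in> G" for y
  proof -
    have "smooth_near (\<lambda>y. \<Phi> (\<pi> (y - x0))) y"
      by (rule smooth_near_compose[OF sm\<Phi> sm\<pi>(1)]) (use that in \<open>simp add: G_def\<close>)
    then show ?thesis unfolding \<sigma>_def by (intro smooth_near_add smooth_near_diff smooth_near_ident sm\<pi>)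
  qed
  have sm\<tau>: "smooth_near \<tau> z" if "z \<in> H" for z
  proof -
    have "smooth_near (\<lambda>z. \<Phi> (\<pi> z)) z"
      by (rule smooth_near_compose[OF sm\<Phi> sm\<pi>(2)]) (use that in \<open>simp add: H_def\<close>)
    then show ?thesis unfolding \<tau>_def by (intro smooth_near_add smooth_near_diff smooth_near_ident sm\<pi>)
  qed
  define d where "d = (fst b \<inter> snd b -` G, \<lambda>q. \<sigma> (snd b q))"
  have B': "smooth_atlas (insert d B)"
    unfolding d_def
    by (rule compatible_chart[OF B b(1) oG oH sm\<sigma> _ \<tau>\<sigma> sm\<tau> _ \<sigma>\<tau>])
      (use \<pi>\<sigma> \<pi>\<tau> in \<open>auto simp: G_def H_def\<close>)
  define F where "F = range \<pi>"
  define L where "L = {q \<in> fst d. snd d q \<in> F}"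
  have FI: "v \<in> F \<longleftrightarrow> \<pi> v = v" for v unfolding F_def using M(3) by (metis rangeE rangeI)
  have x0G: "x0 \<in> G" unfolding G_def using \<epsilon> by (simp add: linear_0[OF M(2)])
  have "\<sigma> x0 = 0" unfolding \<sigma>_def by (simp add: linear_0[OF M(2)] \<Phi>0)
  then have pL: "p \<in> L"
    unfolding L_def FI d_def using b(2) x0G by (simp add: x0_def[symmetric] linear_0[OF M(2)])
  have tangent: "components B d q ` E q = F" if q: "q \<in> L" for q
  proof -
    define y where "y = snd b q"
    have qb: "q \<in> fst b" and yG: "y \<in> G" and \<sigma>F: "\<sigma> y \<in> F" and qd: "q \<in> fst d"
      using q unfolding L_def d_def y_def by auto
    define z where "z = \<pi> (y - x0)"
    have zb: "z \<in> ball 0 \<epsilon>" using yG unfolding G_def z_def by simp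
    have "\<sigma> y = z" using \<sigma>F \<pi>\<sigma>[OF yG] unfolding FI z_def by simp
    then have y: "y = \<Phi> z" unfolding \<sigma>_def z_def[symmetric] by simp
    have yV: "y \<in> V" unfolding y by (rule \<Phi>V[OF zb])
    have qi: "chart_inv b y = q" unfolding y_def by (rule chart_inv_of[OF B b(1) qb])
    have D\<sigma>: "(\<sigma> has_derivative (\<lambda>v. v - M y (\<pi> v) + \<pi> v)) (at y)"
    proof -
      have 1: "((\<lambda>y. \<pi> (y - x0)) has_derivative \<pi>) (at y)"
        using bounded_linear.has_derivative[OF bMl has_derivative_diff[OF has_derivative_ident has_derivative_const]] by simp
      have 2: "(\<Phi> has_derivative blinfun_apply (M y)) (at (\<pi> (y - x0)))"
        using \<Phi>d[OF zb, folded y] unfolding z_def .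
      show ?thesis unfolding \<sigma>_def
        by (intro has_derivative_add has_derivative_diff has_derivative_ident 1 has_derivative_compose[OF 1 2])
    qed
    have comp: "components B d q v = w - M y (\<pi> w) + \<pi> w" if "w = components B b q v" for v w
    proof -
      have "components B d q v = fderiv (\<lambda>x. snd d (chart_inv b x)) (snd b q) (components B b q v)"
        by (rule components_change[OF B' subset_insertI B _ _ qb qd]) (use b(1) in auto)
      also have "fderiv (\<lambda>x. snd d (chart_inv b x)) (snd b q) = fderiv \<sigma> (snd b q)"
        by (rule frechet_derivative_cong, rule eventually_mono[OF eventually_in_chart_image[OF B b(1) qb]])
          (simp add: d_def chart_of_inv)
      also have "\<dots> = (\<lambda>v. v - M y (\<pi> v) + \<pi> v)"
        using frechet_derivative_at[OF D\<sigma>] unfolding y_def by simp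
      finally show ?thesis unfolding that .
    qed
    have Ey: "components B b q ` E q = range (M y)"
      using V(7)[OF yV] unfolding Eh_def qi by simp
    have val: "M y u - M y (\<pi> (M y u)) + \<pi> (M y u) = \<pi> u" for u
      using V(5,6)[OF yV] by simp
    have "components B d q ` E q = (\<lambda>w. w - M y (\<pi> w) + \<pi> w) ` (components B b q ` E q)"
      unfolding image_image by (rule image_cong[OF refl]) (rule comp[OF refl])
    also have "\<dots> = F" unfolding Ey F_def image_image val ..
    finally show ?thesis .
  qed
  have sF: "subspace F" unfolding F_def by (rule linear_subspace_image[OF M(2) subspace_UNIV])
  have "integral_manifold B E L"
    unfolding integral_manifold_def
  proof
    fix q assume q: "q \<in> L"
    show "\<exists>c F. smooth_atlas (insert c B) \<and> q \<in> fst c \<and> subspace F \<and>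
        L \<inter> fst c = {q \<in> fst c. snd c q \<in> F} \<and> (\<forall>q\<in>L \<inter> fst c. components B c q ` E q = F)"
      by (rule exI[of _ d], rule exI[of _ F]) (use B' sF q tangent in \<open>auto simp: L_def\<close>)
  qed
  then show "\<exists>L. p \<in> L \<and> integral_manifold B E L" using pL by blast
qed

text \<open>Frobenius' theorem for the local notion of integrability: a leaf through each point.\<close>

theorem frobenius:
  assumes "smooth_atlas B" "distribution B r E"
  shows "integrable_distribution B E \<longleftrightarrow> involutive B E"
  using assms involutive_imp_integrable integrable_imp_involutive
  unfolding smooth_subbundle_def by blast

section \<open>The pullback connection\<close>

locale pullback_setting =
  fixes A :: "('a::{t2_space,second_countable_topology}, 'm::euclidean_space) chart set"
    and B :: "('b::{t2_space,second_countable_topology}, 'n::euclidean_space) chart set"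
    and \<iota> :: "'b \<Rightarrow> 'a"
    and nabla :: "('a \<Rightarrow> 'm) \<Rightarrow> ('a \<Rightarrow> 'm) \<Rightarrow> 'a \<Rightarrow> 'm"
    and D :: "('b \<Rightarrow> 'n) \<Rightarrow> ('b \<Rightarrow> 'm) \<Rightarrow> 'b \<Rightarrow> 'm"
  assumes atlas_A: "smooth_atlas A" and atlas_B: "smooth_atlas B"
    and map: "smooth_map B A \<iota>" and pullback: "pullback_connection B A \<iota> nabla D"
begin

lemmas section_iff = smooth_section_iff[OF atlas_B atlas_A map]
lemmas field_iff_A = vector_field_iff[OF atlas_A]
lemmas field_iff_B = vector_field_iff[OF atlas_B]
lemmas function_iff_B = smooth_function_iff[OF atlas_B]

lemma D_add:
  assumes "vector_field B W" "smooth_section B A \<iota> V" "smooth_section B A \<iota> V'"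
  shows "D W (\<lambda>q. V q + V' q) p = D W V p + D W V' p"
  using pullback assms unfolding pullback_connection_def by blast

lemma D_scale:
  assumes "vector_field B W" "smooth_section B A \<iota> V" "smooth_function B f"
  shows "D W (\<lambda>q. f q *\<^sub>R V q) p = derivation B W f p *\<^sub>R V p + f p *\<^sub>R D W V p"
  using pullback assms unfolding pullback_connection_def by blast

lemma D_restriction:
  assumes "vector_field B W" "vector_field A X" "vector_field A Y" "X (\<iota> p) = pushforward B A \<iota> W p"
  shows "D W (\<lambda>q. Y (\<iota> q)) p = nabla X Y (\<iota> p)"
  using pullback assms unfolding pullback_connection_def by blast

lemma section_scale:
  "smooth_section B A \<iota> V \<Longrightarrow> smooth_function B f \<Longrightarrow> smooth_section B A \<iota> (\<lambda>q. f q *\<^sub>R V q)"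
  unfolding section_iff function_iff_B using section_at_scaleR[OF atlas_B atlas_A map] by blast

lemma section_add:
  "smooth_section B A \<iota> V \<Longrightarrow> smooth_section B A \<iota> W \<Longrightarrow> smooth_section B A \<iota> (\<lambda>q. V q + W q)"
  unfolding section_iff using section_at_add[OF atlas_B atlas_A map] by blast

lemma section_restriction: "vector_field A Y \<Longrightarrow> smooth_section B A \<iota> (\<lambda>q. Y (\<iota> q))"
  unfolding section_iff field_iff_A using restriction_section_at[OF atlas_B atlas_A map] by blast

lemma section_pushforward: "vector_field B W \<Longrightarrow> smooth_section B A \<iota> (pushforward B A \<iota> W)"
  unfolding section_iff field_iff_B using pushforward_section_at[OF atlas_B atlas_A map] by blast

lemma derivation_cong:
  assumes "\<forall>\<^sub>F q in nhds p. f q = f' q"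
  shows "derivation B W f p = derivation B W f' p"
proof -
  have "\<forall>\<^sub>F x in nhds (snd (chart_at B p) p). f (chart_inv (chart_at B p) x) = f' (chart_inv (chart_at B p) x)"
    by (rule eventually_chart_inv[OF atlas_B chart_at_in[OF atlas_B] chart_at_mem[OF atlas_B] assms])
  from frechet_derivative_cong[OF this] show ?thesis unfolding derivation_def comp_def by metis
qed

lemma derivation_const [simp]: "derivation B W (\<lambda>q. k) p = 0"
  unfolding derivation_def comp_def by simp

lemma smooth_function_const [simp]: "smooth_function B (\<lambda>q. k)"
  unfolding function_iff_B by (rule allI) simp

lemma D_zero: "vector_field B W \<Longrightarrow> D W (\<lambda>q. 0) p = 0"
proof -
  assume W: "vector_field B W"
  have "smooth_section B A \<iota> (\<lambda>q. 0)"
    unfolding section_iff using section_at_zero[OF atlas_B atlas_A map] by blast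
  from D_scale[OF W this, of "\<lambda>q. 0"] show ?thesis by simp
qed

text \<open>If \<open>Z\<close> vanishes near \<open>p\<close>, then \<open>Z = f Z\<close> for a function \<open>f\<close> that vanishes at \<open>p\<close>, and the Leibniz rule gives
\<open>D W (f Z) p = 0\<close>.\<close>

lemma D_local:
  assumes W: "vector_field B W" and V: "smooth_section B A \<iota> V" "smooth_section B A \<iota> V'"
    and ev: "\<forall>\<^sub>F q in nhds p. V q = V' q"
  shows "D W V p = D W V' p"
proof -
  obtain U where U: "open U" "p \<in> U" "\<And>q. q \<in> U \<Longrightarrow> V q = V' q"
    using ev unfolding eventually_nhds by blast
  obtain \<rho> K where \<rho>: "\<And>q. function_at B \<rho> q" "\<forall>\<^sub>F q in nhds p. \<rho> q = 1"
    "closed K" "K \<subseteq> U" "\<And>q. q \<notin> K \<Longrightarrow> \<rho> q = 0"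
    using manifold_bump[OF atlas_B U(1,2)] by metis
  define f where "f = (\<lambda>q. 1 - \<rho> q)"
  define Z where "Z = (\<lambda>q. V q + (-1) *\<^sub>R V' q)"
  have Z: "smooth_section B A \<iota> Z"
    unfolding Z_def by (intro section_add section_scale V smooth_function_const)
  have f: "smooth_function B f"
    using \<rho>(1) unfolding function_iff_B f_def function_at_def by (auto intro!: smooth_near_diff)
  have "V q = V' q + f q *\<^sub>R Z q" for q
  proof (cases "q \<in> U")
    case False
    then have "\<rho> q = 0" using \<rho>(4,5) by blast
    then show ?thesis by (simp add: f_def Z_def)
  qed (simp add: U(3) Z_def)
  then have "D W V p = D W (\<lambda>q. V' q + f q *\<^sub>R Z q) p" by presburger
  also have "\<dots> = D W V' p + D W (\<lambda>q. f q *\<^sub>R Z q) p"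
    by (intro D_add W V section_scale Z f)
  also have "D W (\<lambda>q. f q *\<^sub>R Z q) p = 0"
    unfolding D_scale[OF W Z f]
    using eventually_nhds_x_imp_x[OF \<rho>(2)] U(2,3) by (simp add: f_def Z_def)
  finally show ?thesis by simp
qed

lemma section_sum:
  assumes "\<And>i. i \<in> I \<Longrightarrow> smooth_section B A \<iota> (V i)"
  shows "smooth_section B A \<iota> (\<lambda>q. \<Sum>i\<in>I. V i q)"
  using assms section_at_sum[OF atlas_B atlas_A map, of I V] unfolding section_iff by blast

lemma D_sum:
  assumes "vector_field B W" "\<And>i. i \<in> I \<Longrightarrow> smooth_section B A \<iota> (V i)"
  shows "D W (\<lambda>q. \<Sum>i\<in>I. V i q) p = (\<Sum>i\<in>I. D W (V i) p)"
  using assms(2)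
proof (induction I rule: infinite_finite_induct)
  case (insert i I)
  then show ?case using D_add[OF assms(1), of "V i" "\<lambda>q. \<Sum>i\<in>I. V i q" p] section_sum[of I V] by simp
qed (simp_all add: D_zero[OF assms(1)])

lemma D_expansion:
  assumes W: "vector_field B W" and X: "vector_field A X" "X (\<iota> p) = pushforward B A \<iota> W p"
    and f: "\<And>i. i \<in> I \<Longrightarrow> smooth_function B (f i)" and Y: "\<And>i. i \<in> I \<Longrightarrow> vector_field A (Y i)"
  shows "D W (\<lambda>q. \<Sum>i\<in>I. f i q *\<^sub>R Y i (\<iota> q)) p =
    (\<Sum>i\<in>I. derivation B W (f i) p *\<^sub>R Y i (\<iota> p) + f i p *\<^sub>R nabla X (Y i) (\<iota> p))"
proof -
  have "D W (\<lambda>q. \<Sum>i\<in>I. f i q *\<^sub>R Y i (\<iota> q)) p = (\<Sum>i\<in>I. D W (\<lambda>q. f i q *\<^sub>R Y i (\<iota> q)) p)"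
    by (intro D_sum W section_scale section_restriction f Y)
  also have "\<dots> = (\<Sum>i\<in>I. derivation B W (f i) p *\<^sub>R Y i (\<iota> p) + f i p *\<^sub>R nabla X (Y i) (\<iota> p))"
    by (intro sum.cong refl) (simp add: D_scale[OF W section_restriction f] Y D_restriction[OF W X(1) _ X(2)])
  finally show ?thesis .
qed

text \<open>The frame has constant components near the image point, so the coefficients of a section along \<open>\<iota>\<close>
are its components. They are cut off to become global functions, to which the axioms of the
connection apply.\<close>

lemma section_expansion:
  assumes E: "\<forall>\<^sub>F z in nhds (\<iota> p). \<forall>i. components A (chart_at A (\<iota> p)) z (E i z) = i"
    and V: "smooth_section B A \<iota> V"
  obtains f where "\<And>i. smooth_function B (f i)"
    "\<forall>\<^sub>F q in nhds p. V q = (\<Sum>i\<in>Basis. f i q *\<^sub>R E i (\<iota> q))"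
    "\<forall>\<^sub>F q in nhds p. \<forall>i. f i q = components A (chart_at A (\<iota> p)) (\<iota> q) (V q) \<bullet> i"
proof -
  let ?a = "chart_at A (\<iota> p)"
  note a = chart_at_in[OF atlas_A, of "\<iota> p"] chart_at_mem[OF atlas_A, of "\<iota> p"]
  define U where "U = \<iota> -` fst ?a"
  have U: "open U" "p \<in> U"
    using map atlas_openD[OF atlas_A a(1)] a(2) unfolding smooth_map_def U_def by (auto intro: open_vimage)
  obtain \<rho> K where \<rho>: "\<And>q. function_at B \<rho> q" "\<forall>\<^sub>F q in nhds p. \<rho> q = 1"
    "closed K" "K \<subseteq> U" "\<And>q. q \<notin> K \<Longrightarrow> \<rho> q = 0"
    using manifold_bump[OF atlas_B U] by metis
  define f where "f = (\<lambda>i q. \<rho> q * (components A ?a (\<iota> q) (V q) \<bullet> i))"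
  have "function_at B (\<lambda>q. components A ?a (\<iota> q) (V q) \<bullet> i) q" if "q \<in> U" for i q
    unfolding function_at_def
  proof (intro ballI impI)
    fix c assume c: "c \<in> B" "q \<in> fst c"
    have "smooth_near (sec_rep A \<iota> c ?a V) (snd c q)"
      using V that c a unfolding section_iff section_at_def U_def by blast
    from smooth_near_bounded_linear[OF bounded_linear_inner_left this]
    show "smooth_near (\<lambda>x. components A ?a (\<iota> (chart_inv c x)) (V (chart_inv c x)) \<bullet> i) (snd c q)"
      unfolding sec_rep_def .
  qed
  then have f: "smooth_function B (f i)" for i
    unfolding function_iff_B f_def using cutoff_function[OF atlas_B \<rho>(1,3-5)] by blast
  have f1: "\<forall>\<^sub>F q in nhds p. \<forall>i. f i q = components A ?a (\<iota> q) (V q) \<bullet> i"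
    using \<rho>(2) by eventually_elim (simp add: f_def)
  have "\<forall>\<^sub>F q in nhds p. \<iota> q \<in> fst ?a"
    using U unfolding U_def eventually_nhds by blast
  moreover have "\<forall>\<^sub>F q in nhds p. \<forall>i. components A ?a (\<iota> q) (E i (\<iota> q)) = i"
    by (rule eventually_compose_filterlim[OF E smooth_map_tendsto[OF map]])
  ultimately have "\<forall>\<^sub>F q in nhds p. V q = (\<Sum>i\<in>Basis. f i q *\<^sub>R E i (\<iota> q))"
    using f1
  proof eventually_elim
    case (elim q)
    have l: "linear (components A ?a (\<iota> q))"
      by (rule components_linear[OF atlas_A order_refl atlas_A a(1) elim(1)])
    have "components A ?a (\<iota> q) (\<Sum>i\<in>Basis. f i q *\<^sub>R E i (\<iota> q)) = (\<Sum>i\<in>Basis. f i q *\<^sub>R i)"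
      using elim(2) by (simp add: linear_sum[OF l] linear_scale[OF l])
    also have "\<dots> = components A ?a (\<iota> q) (V q)"
      using elim(3) by (simp add: euclidean_representation)
    finally show ?case
      using components_inj[OF atlas_A order_refl atlas_A a(1) elim(1)] by metis
  qed
  then show thesis using that f f1 by blast
qed

text \<open>The usual formula for a connection in coordinates. The ambient fields \<open>X\<close> and \<open>Y\<close> have constant
coefficients and the values \<open>d\<iota> W\<close> and \<open>V\<close> at the point; the term \<open>nabla X Y\<close> collects the Christoffel
symbols.\<close>

lemma D_coordinates:
  fixes E :: "'m \<Rightarrow> 'a \<Rightarrow> 'm"
  assumes E: "\<And>i. vector_field A (E i)"
      "\<forall>\<^sub>F z in nhds (\<iota> p). \<forall>i. components A (chart_at A (\<iota> p)) z (E i z) = i"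
    and W: "vector_field B W" and V: "smooth_section B A \<iota> V"
    and X: "vector_field A X" "X (\<iota> p) = pushforward B A \<iota> W p"
  defines "Y \<equiv> \<lambda>z. \<Sum>i\<in>Basis. (V p \<bullet> i) *\<^sub>R E i z"
  assumes Y: "vector_field A Y"
  shows "D W V p = fderiv (sec_rep A \<iota> (chart_at B p) (chart_at A (\<iota> p)) V)
    (snd (chart_at B p) p) (W p) + nabla X Y (\<iota> p)"
proof -
  let ?a = "chart_at A (\<iota> p)" and ?b = "chart_at B p"
  note b = chart_at_in[OF atlas_B, of p] chart_at_mem[OF atlas_B, of p]
  note a = chart_at_in[OF atlas_A, of "\<iota> p"] chart_at_mem[OF atlas_A, of "\<iota> p"]
  obtain f where f: "\<And>i. smooth_function B (f i)"
    "\<forall>\<^sub>F q in nhds p. V q = (\<Sum>i\<in>Basis. f i q *\<^sub>R E i (\<iota> q))"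
    "\<forall>\<^sub>F q in nhds p. \<forall>i. f i q = components A ?a (\<iota> q) (V q) \<bullet> i"
    using section_expansion[OF E(2) V] by blast
  have Ep: "E i (\<iota> p) = i" for i
    using eventually_nhds_x_imp_x[OF E(2)] by (simp add: components_chart_at[OF atlas_A])
  have fp: "f i p = V p \<bullet> i" for i
    using eventually_nhds_x_imp_x[OF f(3)] by (simp add: components_chart_at[OF atlas_A])
  have sm: "smooth_near (sec_rep A \<iota> ?b ?a V) (snd ?b p)"
    using V b a unfolding section_iff section_at_def by blast
  have df: "derivation B W (f i) p = fderiv (sec_rep A \<iota> ?b ?a V) (snd ?b p) (W p) \<bullet> i" for i
  proof -
    have "\<forall>\<^sub>F q in nhds p. f i q = components A ?a (\<iota> q) (V q) \<bullet> i"
      using f(3) by eventually_elim blast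
    then have "derivation B W (f i) p = derivation B W (\<lambda>q. components A ?a (\<iota> q) (V q) \<bullet> i) p"
      by (rule derivation_cong)
    also have "\<dots> = fderiv (\<lambda>x. sec_rep A \<iota> ?b ?a V x \<bullet> i) (snd ?b p) (W p)"
      unfolding derivation_def comp_def sec_rep_def ..
    also have "\<dots> = fderiv (sec_rep A \<iota> ?b ?a V) (snd ?b p) (W p) \<bullet> i"
      by (rule frechet_derivative_bounded_linear[OF bounded_linear_inner_left smooth_near_differentiable[OF sm]])
    finally show ?thesis .
  qed
  have "D W V p = D W (\<lambda>q. \<Sum>i\<in>Basis. f i q *\<^sub>R E i (\<iota> q)) p"
    by (intro D_local W V section_sum section_scale section_restriction E f)
  also have "\<dots> = (\<Sum>i\<in>Basis. derivation B W (f i) p *\<^sub>R i) + (\<Sum>i\<in>Basis. (V p \<bullet> i) *\<^sub>R nabla X (E i) (\<iota> p))"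
    using D_expansion[OF W X, of Basis f E] f(1) E(1) by (simp add: Ep fp sum.distrib)
  also have "(\<Sum>i\<in>Basis. derivation B W (f i) p *\<^sub>R i) =
      fderiv (sec_rep A \<iota> ?b ?a V) (snd ?b p) (W p)"
    unfolding df by (rule euclidean_representation)
  also have "(\<Sum>i\<in>Basis. (V p \<bullet> i) *\<^sub>R nabla X (E i) (\<iota> p)) = D W (\<lambda>q. Y (\<iota> q)) p"
    using D_expansion[OF W X, of Basis "\<lambda>i q. V p \<bullet> i" E] E(1) unfolding Y_def by simp
  also have "\<dots> = nabla X Y (\<iota> p)" by (rule D_restriction[OF W X(1) Y X(2)])
  finally show ?thesis .
qed

lemma vector_field_A_combination:
  assumes "\<And>i. vector_field A (E i)"
  shows "vector_field A (\<lambda>z. \<Sum>i\<in>I. c i *\<^sub>R E i z)"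
  unfolding field_iff_A
  using assms[unfolded field_iff_A]
  by (intro allI section_at_sum[OF atlas_A atlas_A smooth_map_ident[OF atlas_A]]
      section_at_scaleR[OF atlas_A atlas_A smooth_map_ident[OF atlas_A]]) auto

text \<open>The Christoffel terms are symmetric because the coordinate fields commute and \<open>nabla\<close> has no torsion.
The remaining terms are derivatives of the coordinate expressions of \<open>d\<iota> U\<close> and \<open>d\<iota> W\<close>, and
\<open>bracket_pushforward\<close> evaluates their difference.\<close>

lemma torsion_free:
  assumes "levi_civita_connection A g nabla" and W: "vector_field B W" and U: "vector_field B U"
  shows "D W (pushforward B A \<iota> U) p - D U (pushforward B A \<iota> W) p
    = differential B A \<iota> p (lie_bracket B W U p)"
proof -
  let ?a = "chart_at A (\<iota> p)" and ?b = "chart_at B p"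
  note a = chart_at_in[OF atlas_A, of "\<iota> p"] chart_at_mem[OF atlas_A, of "\<iota> p"]
  obtain E :: "'m \<Rightarrow> 'a \<Rightarrow> 'm" where E: "\<And>i. vector_field A (E i)"
    "\<forall>\<^sub>F z in nhds (\<iota> p). \<forall>i. components A ?a z (E i z) = i"
    using ambient_frame[OF atlas_A, of "\<iota> p"] by blast
  have Ep: "E i (\<iota> p) = i" for i
    using eventually_nhds_x_imp_x[OF E(2)] by (simp add: components_chart_at[OF atlas_A])
  define F where "F = (\<lambda>V z. \<Sum>i\<in>Basis. (pushforward B A \<iota> V p \<bullet> i) *\<^sub>R E i z)"
  have FV: "(\<lambda>z. \<Sum>i\<in>Basis. (pushforward B A \<iota> V p \<bullet> i) *\<^sub>R E i z) = F V" for V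
    by (simp add: F_def)
  have F: "vector_field A (F V)" for V
    unfolding F_def by (rule vector_field_A_combination[OF E(1)])
  have Fp: "F V (\<iota> p) = pushforward B A \<iota> V p" for V
    unfolding F_def Ep by (rule euclidean_representation)
  have rep: "\<forall>\<^sub>F x in nhds (snd ?a (\<iota> p)). sec_rep A (\<lambda>p. p) ?a ?a (F V) x = pushforward B A \<iota> V p" for V
  proof -
    have "\<forall>\<^sub>F z in nhds (\<iota> p). components A ?a z (F V z) = pushforward B A \<iota> V p"
      using E(2) eventually_in_chart[OF atlas_A a]
    proof eventually_elim
      case (elim z)
      have l: "linear (components A ?a z)"
        by (rule components_linear[OF atlas_A order_refl atlas_A a(1) elim(2)])
      show ?case using elim(1)
        by (simp add: F_def linear_sum[OF l] linear_scale[OF l] euclidean_representation)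
    qed
    from eventually_chart_inv[OF atlas_A a this] show ?thesis unfolding sec_rep_def .
  qed
  have "lie_bracket A (F W) (F U) (\<iota> p) = 0"
    unfolding lie_bracket_eq[OF atlas_A] frechet_derivative_cong[OF rep] by simp
  then have sym: "nabla (F W) (F U) (\<iota> p) = nabla (F U) (F W) (\<iota> p)"
    using assms(1) F unfolding levi_civita_connection_def by (metis eq_iff_diff_eq_0)
  have "D W (pushforward B A \<iota> U) p - D U (pushforward B A \<iota> W) p =
    fderiv (sec_rep A \<iota> ?b ?a (pushforward B A \<iota> U)) (snd ?b p) (W p) -
    fderiv (sec_rep A \<iota> ?b ?a (pushforward B A \<iota> W)) (snd ?b p) (U p)"
    using D_coordinates[OF E W section_pushforward[OF U] F Fp, unfolded FV, OF F]
      D_coordinates[OF E U section_pushforward[OF W] F Fp, unfolded FV, OF F] sym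
    by simp
  also have "\<dots> = components A ?a (\<iota> p) (differential B A \<iota> p (lie_bracket B W U p))"
    using W U unfolding field_iff_B by (intro bracket_pushforward[OF atlas_B atlas_A map _ _ a]) auto
  finally show ?thesis by (simp add: components_chart_at[OF atlas_A])
qed

text \<open>Near each point \<open>V\<close> is a combination of restrictions of ambient fields \<open>E\<close>, and \<open>P V\<close> is the same
combination of the restrictions of the ambient fields \<open>P E\<close>, for which everything is known.\<close>

lemma parallel_endomorphism:
  assumes lin: "\<And>z. linear (P z)" and P: "\<And>X. vector_field A X \<Longrightarrow> vector_field A (\<lambda>z. P z (X z))"
    and V: "smooth_section B A \<iota> V"
  shows "smooth_section B A \<iota> (\<lambda>q. P (\<iota> q) (V q))"
    and "\<lbrakk>vector_field B W; \<And>X Y z. vector_field A X \<Longrightarrow> vector_field A Y \<Longrightarrow>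
       nabla X (\<lambda>z. P z (Y z)) z = P z (nabla X Y z)\<rbrakk> \<Longrightarrow>
       D W (\<lambda>q. P (\<iota> q) (V q)) p = P (\<iota> p) (D W V p)"
proof -
  have ex: "\<exists>E f. (\<forall>i. vector_field A (E i)) \<and> (\<forall>i::'m. smooth_function B (f i)) \<and> (\<forall>i. E i (\<iota> p) = i) \<and>
     (\<forall>\<^sub>F q in nhds p. V q = (\<Sum>i\<in>Basis. f i q *\<^sub>R E i (\<iota> q))) \<and>
     (\<forall>\<^sub>F q in nhds p. (\<Sum>i\<in>Basis. f i q *\<^sub>R P (\<iota> q) (E i (\<iota> q))) = P (\<iota> q) (V q))" for p
  proof -
    obtain E :: "'m \<Rightarrow> 'a \<Rightarrow> 'm" where E: "\<And>i. vector_field A (E i)"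
      "\<forall>\<^sub>F z in nhds (\<iota> p). \<forall>i. components A (chart_at A (\<iota> p)) z (E i z) = i"
      using ambient_frame[OF atlas_A, of "\<iota> p"] by blast
    obtain f where f: "\<And>i. smooth_function B (f i)"
      "\<forall>\<^sub>F q in nhds p. V q = (\<Sum>i\<in>Basis. f i q *\<^sub>R E i (\<iota> q))"
      using section_expansion[OF E(2) V] by blast
    have "\<forall>\<^sub>F q in nhds p. (\<Sum>i\<in>Basis. f i q *\<^sub>R P (\<iota> q) (E i (\<iota> q))) = P (\<iota> q) (V q)"
      using f(2) by eventually_elim (simp add: linear_sum[OF lin] linear_scale[OF lin])
    moreover have "E i (\<iota> p) = i" for i
      using eventually_nhds_x_imp_x[OF E(2)] by (simp add: components_chart_at[OF atlas_A])
    ultimately show ?thesis using E(1) f by blast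
  qed
  show PV: "smooth_section B A \<iota> (\<lambda>q. P (\<iota> q) (V q))"
    unfolding section_iff
  proof
    fix p
    obtain E :: "'m \<Rightarrow> 'a \<Rightarrow> 'm" and f where E: "\<And>i. vector_field A (E i)" "\<And>i. smooth_function B (f i)"
       and ev: "\<forall>\<^sub>F q in nhds p. (\<Sum>i\<in>Basis. f i q *\<^sub>R P (\<iota> q) (E i (\<iota> q))) = P (\<iota> q) (V q)"
      using ex[of p] by blast
    have "smooth_section B A \<iota> (\<lambda>q. \<Sum>i\<in>Basis. f i q *\<^sub>R P (\<iota> q) (E i (\<iota> q)))"
      using section_restriction[OF P[OF E(1)]] by (intro section_sum section_scale E(2))
    then show "section_at B A \<iota> (\<lambda>q. P (\<iota> q) (V q)) p"
      unfolding section_iff using section_at_cong[OF atlas_B _ ev] by blast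
  qed
  show "D W (\<lambda>q. P (\<iota> q) (V q)) p = P (\<iota> p) (D W V p)" if W: "vector_field B W"
    and par: "\<And>X Y z. vector_field A X \<Longrightarrow> vector_field A Y \<Longrightarrow>
       nabla X (\<lambda>z. P z (Y z)) z = P z (nabla X Y z)"
  proof -
    obtain E :: "'m \<Rightarrow> 'a \<Rightarrow> 'm" and f where E: "\<And>i. vector_field A (E i)" "\<And>i. smooth_function B (f i)"
       and Ep: "\<And>i. E i (\<iota> p) = i"
       and ev: "\<forall>\<^sub>F q in nhds p. V q = (\<Sum>i\<in>Basis. f i q *\<^sub>R E i (\<iota> q))"
         "\<forall>\<^sub>F q in nhds p. (\<Sum>i\<in>Basis. f i q *\<^sub>R P (\<iota> q) (E i (\<iota> q))) = P (\<iota> q) (V q)"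
      using ex[of p] by blast
    define X where "X = (\<lambda>z. \<Sum>i\<in>Basis. (pushforward B A \<iota> W p \<bullet> i) *\<^sub>R E i z)"
    have X: "vector_field A X" "X (\<iota> p) = pushforward B A \<iota> W p"
      unfolding X_def Ep by (rule vector_field_A_combination[OF E(1)], rule euclidean_representation)
    have PE: "vector_field A (\<lambda>z. P z (E i z))" for i by (rule P[OF E(1)])
    have "D W (\<lambda>q. P (\<iota> q) (V q)) p = D W (\<lambda>q. \<Sum>i\<in>Basis. f i q *\<^sub>R P (\<iota> q) (E i (\<iota> q))) p"
      using section_restriction[OF PE]
      by (intro D_local[symmetric] W PV section_sum section_scale E(2) ev(2))
    also have "\<dots> = (\<Sum>i\<in>Basis. derivation B W (f i) p *\<^sub>R P (\<iota> p) (E i (\<iota> p))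
        + f i p *\<^sub>R nabla X (\<lambda>z. P z (E i z)) (\<iota> p))"
      using D_expansion[OF W X, of Basis f "\<lambda>i z. P z (E i z)"] E(2) PE by simp
    also have "\<dots> = P (\<iota> p) (\<Sum>i\<in>Basis. derivation B W (f i) p *\<^sub>R E i (\<iota> p) + f i p *\<^sub>R nabla X (E i) (\<iota> p))"
      by (simp add: par[OF X(1) E(1)] linear_sum[OF lin] linear_scale[OF lin] linear_add[OF lin])
    also have "(\<Sum>i\<in>Basis. derivation B W (f i) p *\<^sub>R E i (\<iota> p) + f i p *\<^sub>R nabla X (E i) (\<iota> p)) =
        D W (\<lambda>q. \<Sum>i\<in>Basis. f i q *\<^sub>R E i (\<iota> q)) p"
      using D_expansion[OF W X, of Basis f E] E by simp
    also have "\<dots> = D W V p"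
      by (intro D_local[symmetric] W V section_sum section_scale section_restriction E ev(1))
    finally show ?thesis .
  qed
qed

end

section \<open>Decomposition of the ambient tangent spaces\<close>

lemma projection_along_eq:
  assumes "subspace E" "subspace F" "E \<inter> F = {0}" "e \<in> E" "v - e \<in> F"
  shows "projection_along E F v = e"
  unfolding projection_along_def
proof (rule the_equality)
  fix e' assume e': "e' \<in> E \<and> v - e' \<in> F"
  have "e' - e \<in> E" by (rule subspace_diff[OF assms(1) _ assms(4)]) (use e' in simp)
  moreover have "(v - e) - (v - e') \<in> F"
    by (rule subspace_diff[OF assms(2,5)]) (use e' in simp)
  then have "e' - e \<in> F" by (simp add: algebra_simps)
  ultimately have "e' - e \<in> {0}" unfolding assms(3)[symmetric] by (rule IntI)
  then show "e' = e" by simp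
qed (simp add: assms(4,5))

lemma projection_along_direct:
  assumes "subspace E" "subspace F" "E \<inter> F = {0}" "v \<in> span (E \<union> F)"
  shows "projection_along E F v \<in> E" "v - projection_along E F v \<in> F"
proof -
  obtain e f where ef: "e \<in> E" "f \<in> F" "v = e + f"
    using assms(4) unfolding span_Un span_eq_iff[THEN iffD2, OF assms(1)] span_eq_iff[THEN iffD2, OF assms(2)]
    by blast
  then have "projection_along E F v = e" by (intro projection_along_eq assms(1-3)) auto
  then show "projection_along E F v \<in> E" "v - projection_along E F v \<in> F" using ef by auto
qed

lemma projection_along_diff:
  assumes "subspace E" "subspace F" "E \<inter> F = {0}" "v \<in> span (E \<union> F)" "w \<in> span (E \<union> F)"
  shows "projection_along E F (v - w) = projection_along E F v - projection_along E F w"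
proof (rule projection_along_eq[OF assms(1-3)])
  note v = projection_along_direct[OF assms(1-3,4)] and w = projection_along_direct[OF assms(1-3,5)]
  show "projection_along E F v - projection_along E F w \<in> E"
    by (rule subspace_diff[OF assms(1) v(1) w(1)])
  have "(v - projection_along E F v) - (w - projection_along E F w) \<in> F"
    by (rule subspace_diff[OF assms(2) v(2) w(2)])
  then show "v - w - (projection_along E F v - projection_along E F w) \<in> F"
    by (simp add: algebra_simps)
qed

text \<open>Forms on a Euclidean space are represented by operators by means of the inner product, even
indefinite ones.\<close>

lemma bilinear_representer:
  fixes b :: "'m::euclidean_space \<Rightarrow> 'm \<Rightarrow> real"
  assumes "bilinear b"
  obtains G where "linear G" "\<And>v w. b v w = G v \<bullet> w"
proof
  have l: "linear (\<lambda>v. b v w)" "linear (b v)" for v w using assms unfolding bilinear_def by auto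
  show "linear (\<lambda>v. \<Sum>i\<in>Basis. b v i *\<^sub>R i)"
    by (rule linearI) (simp_all add: linear_add[OF l(1)] linear_scale[OF l(1)] scaleR_add_left
        sum.distrib scaleR_sum_right)
  show "b v w = (\<Sum>i\<in>Basis. b v i *\<^sub>R i) \<bullet> w" for v w
  proof -
    have "b v w = b v (\<Sum>i\<in>Basis. (w \<bullet> i) *\<^sub>R i)" by (simp add: euclidean_representation)
    also have "\<dots> = (\<Sum>i\<in>Basis. b v i *\<^sub>R i) \<bullet> w"
      by (simp add: linear_sum[OF l(2)] linear_scale[OF l(2)] inner_sum_left)
        (simp add: inner_commute mult.commute)
    finally show ?thesis .
  qed
qed

text \<open>Orthogonal projection onto a nondegenerate subspace of an indefinite form: let \<open>G\<close> represent the form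
and \<open>q\<close> be the Euclidean projection onto \<open>V\<close>. Nondegeneracy says that \<open>q G\<close> is injective on \<open>V\<close>, hence it is
onto \<open>V\<close>, and \<open>s\<close> is a preimage of \<open>q (G v)\<close>.\<close>

lemma nondegenerate_projection:
  fixes b :: "'m::euclidean_space \<Rightarrow> 'm \<Rightarrow> real"
  assumes "bilinear b" "subspace V" "nondegenerate_on V b"
  obtains s where "s \<in> V" "\<And>w. w \<in> V \<Longrightarrow> b (v - s) w = 0"
proof -
  obtain G where G: "linear G" "\<And>v w. b v w = G v \<bullet> w" using bilinear_representer[OF assms(1)] by blast
  have "\<exists>y. y \<in> V \<and> (\<forall>w\<in>V. (x - y) \<bullet> w = 0)" for x
  proof -
    obtain y z where "y \<in> span V" "\<And>w. w \<in> span V \<Longrightarrow> orthogonal z w" "x = y + z"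
      using orthogonal_subspace_decomp_exists[of V x] by metis
    then show ?thesis
      using assms(2) by (intro exI[of _ y]) (auto simp: orthogonal_def span_eq_iff[THEN iffD2])
  qed
  then obtain q where q: "\<And>x. q x \<in> V" "\<And>x w. w \<in> V \<Longrightarrow> (x - q x) \<bullet> w = 0" by metis
  have q_eqI: "q x = y" if "y \<in> V" "\<And>w. w \<in> V \<Longrightarrow> (x - y) \<bullet> w = 0" for x y
  proof -
    have m: "q x - y \<in> V" using that q assms(2) by (auto intro: subspace_diff)
    have "(q x - y) \<bullet> (q x - y) = (x - y) \<bullet> (q x - y) - (x - q x) \<bullet> (q x - y)"
      by (simp add: algebra_simps)
    also have "\<dots> = 0" using q(2)[OF m] that(2)[OF m] by simp
    finally show ?thesis by simp
  qed
  have lq: "linear q"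
  proof (rule linearI)
    show "q (x + y) = q x + q y" for x y
    proof (rule q_eqI)
      show "q x + q y \<in> V" using q(1) assms(2) by (intro subspace_add)
      show "(x + y - (q x + q y)) \<bullet> w = 0" if "w \<in> V" for w
        using q(2)[OF that, of x] q(2)[OF that, of y] by (simp add: inner_diff_left inner_add_left)
    qed
    show "q (c *\<^sub>R x) = c *\<^sub>R q x" for c x
    proof (rule q_eqI)
      show "c *\<^sub>R q x \<in> V" using q(1) assms(2) by (intro subspace_scale)
      show "(c *\<^sub>R x - c *\<^sub>R q x) \<bullet> w = 0" if "w \<in> V" for w
        using q(2)[OF that, of x] by (simp add: inner_diff_left)
    qed
  qed
  have qw: "q x \<bullet> w = x \<bullet> w" if "w \<in> V" for x w using q(2)[OF that, of x] by (simp add: inner_diff_left)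
  have lin: "linear (q \<circ> G)" by (rule linear_compose[OF G(1) lq])
  have "inj_on (q \<circ> G) V"
  proof (subst linear_injective_on_subspace_0[OF lin assms(2)], intro ballI impI)
    fix x assume x: "x \<in> V" "(q \<circ> G) x = 0"
    then have "b x w = 0" if "w \<in> V" for w using qw[OF that, of "G x"] G(2) by simp
    then show "x = 0" using assms(3) x(1) unfolding nondegenerate_on_def by blast
  qed
  then have "dim ((q \<circ> G) ` V) = dim V"
    using assms(2) by (intro dim_image_eq lin) (simp add: span_eq_iff[THEN iffD2])
  then have "(q \<circ> G) ` V = V"
    using q(1) by (intro subspace_dim_equal linear_subspace_image lin assms(2)) auto
  then have "q (G v) \<in> (\<lambda>x. q (G x)) ` V" using q(1)[of "G v"] by (simp add: comp_def)
  then obtain s where s: "s \<in> V" "q (G s) = q (G v)" by auto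
  have "b (v - s) w = 0" if "w \<in> V" for w
    using qw[OF that, of "G s"] qw[OF that, of "G v"] s(2) by (simp add: G(2) linear_diff[OF G(1)] inner_diff_left)
  then show thesis using that s(1) by blast
qed

lemma dual_basis_expansion:
  fixes b :: "'m::real_vector \<Rightarrow> 'm \<Rightarrow> real" and r :: nat
  assumes "\<And>w. linear (\<lambda>v. b v w)"
    and dual: "\<And>i j. i < r \<Longrightarrow> j < r \<Longrightarrow> b (N i) (\<xi> j) = (if i = j then 1 else 0)"
    and l: "l \<in> span (N ` {..<r})"
  shows "l = (\<Sum>i<r. b l (\<xi> i) *\<^sub>R N i)"
proof (rule linear_eq_on_span[of "\<lambda>l. l" "\<lambda>l. \<Sum>i<r. b l (\<xi> i) *\<^sub>R N i", OF _ _ _ l])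
  show "linear (\<lambda>l. \<Sum>i<r. b l (\<xi> i) *\<^sub>R N i)"
    by (rule linearI) (simp_all add: linear_add[OF assms(1)] linear_scale[OF assms(1)]
        scaleR_add_left sum.distrib scaleR_sum_right)
  show "x = (\<Sum>i<r. b x (\<xi> i) *\<^sub>R N i)" if "x \<in> N ` {..<r}" for x
  proof -
    obtain j where j: "j < r" "x = N j" using \<open>x \<in> N ` {..<r}\<close> by auto
    have "(\<Sum>i<r. b x (\<xi> i) *\<^sub>R N i) = (\<Sum>i<r. if j = i then N i else 0)"
      using j by (intro sum.cong refl) (simp add: dual)
    then show ?thesis using j by simp
  qed
qed (rule linear_ident)

text \<open>The tangent space \<open>T\<close> is complementary to the sum of the transversal bundles; \<open>Q\<close> is the normal space,
so that \<open>T \<inter> Q\<close> is the radical. Pairing with the \<open>\<xi> j\<close> detects the \<open>ltr\<close> part of a vector, because \<open>T\<close> and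
\<open>St\<close> are orthogonal to the radical: this gives the trivial intersection. To decompose \<open>v\<close>, subtract
its \<open>ltr\<close> part and then its projection to \<open>S\<close>; the rest is orthogonal to the radical and to \<open>S\<close>, so
it lies in \<open>Q\<close>, which is the sum of the radical and \<open>St\<close>.\<close>

lemma transversal_decomposition:
  fixes b :: "'m::euclidean_space \<Rightarrow> 'm \<Rightarrow> real" and r :: nat
  assumes bil: "bilinear b" and sym: "\<And>v w. b v w = b w v"
    and T: "subspace T" and Q: "Q = {v. \<forall>w\<in>T. b v w = 0}"
    and S: "direct_sum T (T \<inter> Q) S" "nondegenerate_on S b"
    and St: "direct_sum Q (T \<inter> Q) St"
    and \<xi>: "T \<inter> Q = span (\<xi> ` {..<r})" and N: "ltr = span (N ` {..<r})"
    and dual: "\<And>i j. i < r \<Longrightarrow> j < r \<Longrightarrow> b (N i) (\<xi> j) = (if i = j then 1 else 0)"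
    and NS: "\<And>i v. i < r \<Longrightarrow> v \<in> S \<Longrightarrow> b (N i) v = 0"
  shows "T \<inter> span (ltr \<union> St) = {0}" "span (T \<union> span (ltr \<union> St)) = UNIV"
proof -
  have lin: "linear (\<lambda>v. b v w)" "linear (b v)" for v w using bil unfolding bilinear_def by auto
  have \<xi>R: "\<xi> j \<in> T" "\<xi> j \<in> Q" if "j < r" for j using \<xi> that span_base[of "\<xi> j" "\<xi> ` {..<r}"] by auto
  have ST: "S \<subseteq> T" and StQ: "St \<subseteq> Q" and TS: "T = span ((T \<inter> Q) \<union> S)" and QS: "Q = span ((T \<inter> Q) \<union> St)"
    and sSt: "subspace St" and RSt: "(T \<inter> Q) \<inter> St = {0}" and sS: "subspace S"
    using S(1) St unfolding direct_sum_def by (auto intro: span_base)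
  show "T \<inter> span (ltr \<union> St) = {0}"
  proof (intro equalityI subsetI)
    fix t assume "t \<in> T \<inter> span (ltr \<union> St)"
    then have t: "t \<in> T" "t \<in> span (ltr \<union> St)" by auto
    have sl: "span ltr = ltr" unfolding N by (rule span_span)
    obtain l z where lz: "l \<in> ltr" "z \<in> St" "t = l + z"
      using t(2) unfolding span_Un sl span_eq_iff[THEN iffD2, OF sSt] by blast
    have "b l (\<xi> j) = 0" if j: "j < r" for j
    proof -
      have "b t (\<xi> j) = 0" using \<xi>R(2)[OF j] t(1) sym unfolding Q by auto
      moreover have "b z (\<xi> j) = 0" using lz(2) StQ \<xi>R(1)[OF j] unfolding Q by auto
      ultimately show ?thesis unfolding lz(3) linear_add[OF lin(1)] by simp
    qed
    then have "l = 0"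
      using dual_basis_expansion[of b r N \<xi> l, OF lin(1) dual] lz(1) unfolding N by simp
    then have "t = z" using lz(3) by simp
    then show "t \<in> {0}" using t(1) lz(2) StQ RSt by auto
  qed (use T in \<open>auto simp: subspace_0 span_0\<close>)
  show "span (T \<union> span (ltr \<union> St)) = UNIV"
  proof (intro equalityI subsetI UNIV_I)
    fix v :: 'm
    let ?Z = "span (T \<union> span (ltr \<union> St))"
    have TZ: "T \<subseteq> ?Z" by (auto intro: span_base)
    have FZ: "ltr \<union> St \<subseteq> ?Z" by (auto intro: span_base)
    define l where "l = (\<Sum>i<r. b v (\<xi> i) *\<^sub>R N i)"
    have lZ: "l \<in> ?Z"
      unfolding l_def
    proof (intro span_sum span_scale)
      fix i assume "i \<in> {..<r}"
      then have "N i \<in> ltr" unfolding N by (intro span_base imageI)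
      then show "N i \<in> ?Z" using FZ by blast
    qed
    obtain s where s: "s \<in> S" "\<And>w. w \<in> S \<Longrightarrow> b ((v - l) - s) w = 0"
      using nondegenerate_projection[OF bil sS S(2)] by blast
    let ?u = "(v - l) - s"
    have u\<xi>: "b ?u (\<xi> j) = 0" if j: "j < r" for j
    proof -
      have "b l (\<xi> j) = (\<Sum>i<r. b v (\<xi> i) * b (N i) (\<xi> j))"
        unfolding l_def by (simp add: linear_sum[OF lin(1)] linear_scale[OF lin(1)])
      also have "\<dots> = (\<Sum>i<r. if i = j then b v (\<xi> i) else 0)"
        by (intro sum.cong refl) (simp add: dual j)
      also have "\<dots> = b v (\<xi> j)" using j by simp
      finally have "b l (\<xi> j) = b v (\<xi> j)" .
      moreover have "b s (\<xi> j) = 0" using s(1) ST \<xi>R(2)[OF j] sym unfolding Q by auto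
      ultimately show ?thesis by (simp add: linear_diff[OF lin(1)])
    qed
    have ker: "subspace {w. b ?u w = 0}"
      by (rule subspaceI) (simp_all add: linear_0[OF lin(2)] linear_add[OF lin(2)] linear_scale[OF lin(2)])
    have "span (\<xi> ` {..<r}) \<subseteq> {w. b ?u w = 0}"
      by (rule span_minimal[OF _ ker]) (use u\<xi> in auto)
    then have "span ((T \<inter> Q) \<union> S) \<subseteq> {w. b ?u w = 0}"
      using s(2) unfolding \<xi> by (intro span_minimal[OF _ ker]) auto
    then have "T \<subseteq> {w. b ?u w = 0}" unfolding TS[symmetric] .
    then have "?u \<in> Q" unfolding Q by blast
    then have "?u \<in> span ((T \<inter> Q) \<union> St)" using QS by simp
    moreover have "span ((T \<inter> Q) \<union> St) \<subseteq> ?Z"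
      using TZ FZ by (intro span_minimal subspace_span) auto
    ultimately have "?u \<in> ?Z" by blast
    moreover have "s \<in> ?Z" using s(1) ST TZ by blast
    ultimately have "l + s + ?u \<in> ?Z" using lZ by (intro span_add)
    then show "v \<in> ?Z" by (simp add: algebra_simps)
  qed
qed

section \<open>Integrability of the radical distribution\<close>

lemma differential_linear:
  assumes "smooth_atlas B" "smooth_atlas A" "smooth_map B A \<iota>"
  shows "linear (differential B A \<iota> p)"
  unfolding differential_def[abs_def] comp_def
  using smooth_map_near[OF assms chart_at_in[OF assms(1)] chart_at_in[OF assms(2)]
      chart_at_mem[OF assms(1)] chart_at_mem[OF assms(2)]]
  by (intro linear_frechet_derivative smooth_near_differentiable) 

theorem theorem4p2:
  fixes A :: "('a::{t2_space,second_countable_topology}, 'm::euclidean_space) chart set"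
    and g :: "'a \<Rightarrow> 'm \<Rightarrow> 'm \<Rightarrow> real"
    and P :: "'a \<Rightarrow> 'm \<Rightarrow> 'm"
    and nabla :: "('a \<Rightarrow> 'm) \<Rightarrow> ('a \<Rightarrow> 'm) \<Rightarrow> 'a \<Rightarrow> 'm"
    and B :: "('b::{t2_space,second_countable_topology}, 'n::euclidean_space) chart set"
    and \<iota> :: "'b \<Rightarrow> 'a"
    and S St ltr :: "'b \<Rightarrow> 'm set"
    and D :: "('b \<Rightarrow> 'n) \<Rightarrow> ('b \<Rightarrow> 'm) \<Rightarrow> 'b \<Rightarrow> 'm"
  assumes "golden_semi_riemannian_manifold A g P nabla"
    and "radical_screen_transversal_lightlike_submanifold B A g P \<iota> S St ltr"
    and "pullback_connection B A \<iota> nabla D"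
  shows "integrable_distribution B (radical_distribution B A g \<iota>) \<longleftrightarrow>
    (\<forall>W U. radical_section B A g \<iota> W \<longrightarrow> radical_section B A g \<iota> U \<longrightarrow>
      (\<forall>p. shape_operator B A \<iota> D St ltr (\<lambda>q. P (\<iota> q) (pushforward B A \<iota> U q)) W p
           - shape_operator B A \<iota> D St ltr (\<lambda>q. P (\<iota> q) (pushforward B A \<iota> W q)) U p
         = screen_shape_operator B A g \<iota> D S St ltr W U p
           - screen_shape_operator B A g \<iota> D S St ltr U W p))"
proof -
  have golden: "smooth_atlas A" "semi_riemannian_metric A g" "levi_civita_connection A g nabla"
      "\<And>z. linear (P z)" "\<And>X. vector_field A X \<Longrightarrow> vector_field A (\<lambda>z. P z (X z))"
      "\<And>z v. P z (P z v) = P z v + v"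
      "\<And>X Y z. vector_field A X \<Longrightarrow> vector_field A Y \<Longrightarrow> nabla X (\<lambda>z. P z (Y z)) z = P z (nabla X Y z)"
    using assms(1) unfolding golden_semi_riemannian_manifold_def by blast+
  have stl: "lightlike_submanifold B A g \<iota> S St ltr" "\<And>p. P (\<iota> p) ` Rad B A g \<iota> p \<subseteq> St p" "\<And>p. P (\<iota> p) ` S p = S p"
    using assms(2) unfolding radical_screen_transversal_lightlike_submanifold_def
      screen_transversal_lightlike_submanifold_def by blast+
  have ll: "smooth_atlas B" "smooth_map B A \<iota>"
      "screen_distribution B A g \<iota> S" "screen_transversal_bundle B A g \<iota> St"
    using stl(1) unfolding lightlike_submanifold_def immersion_def by blast+
  obtain r where r: "distribution B r (radical_distribution B A g \<iota>)"
      "lightlike_transversal_bundle B A g \<iota> r S St ltr"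
    using stl(1) unfolding lightlike_submanifold_def by blast
  interpret pullback_setting A B \<iota> nabla D
    by unfold_locales (use golden ll assms(3) in auto)
  let ?T = "tangent_space B A \<iota>" and ?R = "Rad B A g \<iota>" and ?F = "\<lambda>p. span (ltr p \<union> St p)"
  have sT: "subspace (?T p)" for p
    unfolding tangent_space_def by (rule linear_subspace_image[OF differential_linear[OF ll(1) golden(1) ll(2)] subspace_UNIV])
  have dsS: "direct_sum (?T p) (?R p) (S p)" "nondegenerate_on (S p) (g (\<iota> p))" for p
    using ll(3) unfolding screen_distribution_def by blast+
  have dsSt: "direct_sum (normal_space B A g \<iota> p) (?R p) (St p)" for p
    using ll(4) unfolding screen_transversal_bundle_def by blast
  have dec: "?T p \<inter> ?F p = {0}" "span (?T p \<union> ?F p) = UNIV" for p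
  proof -
    have m: "bilinear (g (\<iota> p))" "\<And>v w. g (\<iota> p) v w = g (\<iota> p) w v"
      using golden(2) unfolding semi_riemannian_metric_def by blast+
    obtain U \<xi> N where U: "p \<in> U" "\<forall>q\<in>U. Rad B A g \<iota> q = span ((\<lambda>i. \<xi> i q) ` {..<r}) \<and>
                ltr q = span ((\<lambda>i. N i q) ` {..<r}) \<and>
                (\<forall>i<r. \<forall>j<r. g (\<iota> q) (N i q) (\<xi> j q) = (if i = j then 1 else 0)) \<and>
                (\<forall>i<r. \<forall>j<r. g (\<iota> q) (N i q) (N j q) = 0) \<and>
                (\<forall>i<r. \<forall>v\<in>S q \<union> St q. g (\<iota> q) (N i q) v = 0)"
      using r(2)[unfolded lightlike_transversal_bundle_def, rule_format, of p] by (elim exE conjE) (rule that; assumption)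
    note Up = bspec[OF U(2,1)]
    have e: "?R p = ?T p \<inter> normal_space B A g \<iota> p" unfolding Rad_def ..
    show "?T p \<inter> ?F p = {0}" "span (?T p \<union> ?F p) = UNIV"
      using transversal_decomposition[of "g (\<iota> p)" "?T p" "normal_space B A g \<iota> p" "S p" "St p" "\<lambda>i. \<xi> i p" r "ltr p" "\<lambda>i. N i p",
          folded e, OF m sT normal_space_def dsS dsSt] Up by auto
  qed
  have st: "subspace (?T p)" "subspace (?F p)" "?T p \<inter> ?F p = {0}" "v \<in> span (?T p \<union> ?F p)" for p v
    using sT dec by auto
  note tang_eq = projection_along_eq[OF st(1-3)]
  note tang_diff = projection_along_diff[OF st(1-4) st(4)]
  have tang_T: "projection_along (?T p) (?F p) v \<in> ?T p" for p v
    by (rule projection_along_direct(1)[OF st])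
  have sS: "subspace (S p)" "subspace (?R p)" "S p \<inter> ?R p = {0}" "span (S p \<union> ?R p) = ?T p" for p
    using dsS(1)[of p] unfolding direct_sum_def by (auto simp: Int_commute Un_commute)
  have ST: "S p \<subseteq> ?T p" for p using sS(4)[of p] span_superset[of "S p \<union> ?R p"] by blast
  \<comment> \<open>both sides at \<open>p\<close> depend only on the screen part \<open>s\<close> of the bracket: they are \<open>- P s\<close> and \<open>s\<close>\<close>
  have key: "shape_operator B A \<iota> D St ltr (\<lambda>q. P (\<iota> q) (pushforward B A \<iota> U q)) W p
           - shape_operator B A \<iota> D St ltr (\<lambda>q. P (\<iota> q) (pushforward B A \<iota> W q)) U p
         = screen_shape_operator B A g \<iota> D S St ltr W U p
           - screen_shape_operator B A g \<iota> D S St ltr U W p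
       \<longleftrightarrow> lie_bracket B W U p \<in> radical_distribution B A g \<iota> p"
    if W: "vector_field B W" and U: "vector_field B U" for W U p
  proof -
    let ?tang = "projection_along (?T p) (?F p)" and ?scr = "projection_along (S p) (?R p)"
    define V1 where "V1 = D W (pushforward B A \<iota> U) p"
    define V2 where "V2 = D U (pushforward B A \<iota> W) p"
    define t where "t = differential B A \<iota> p (lie_bracket B W U p)"
    have tT: "t \<in> ?T p" unfolding t_def tangent_space_def by blast
    have t: "V1 - V2 = t" unfolding V1_def V2_def t_def by (rule torsion_free[OF golden(3) W U])
    have par: "D W (\<lambda>q. P (\<iota> q) (pushforward B A \<iota> U q)) p = P (\<iota> p) (D W (pushforward B A \<iota> U) p)"
      if "vector_field B W" "vector_field B U" for W U
      by (rule parallel_endomorphism(2))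
        (use golden(4,5,7) section_pushforward that in blast)+
    have PV: "D W (\<lambda>q. P (\<iota> q) (pushforward B A \<iota> U q)) p = P (\<iota> p) V1"
        "D U (\<lambda>q. P (\<iota> q) (pushforward B A \<iota> W q)) p = P (\<iota> p) V2"
      unfolding V1_def V2_def by (rule par[OF W U], rule par[OF U W])
    define s where "s = ?scr t"
    have s: "s \<in> S p" "t - s \<in> ?R p"
      unfolding s_def using projection_along_direct[OF sS(1-3), of t p] tT sS(4)[of p] by auto
    have Pt: "?tang (P (\<iota> p) t) = P (\<iota> p) s"
    proof (rule tang_eq)
      show "P (\<iota> p) s \<in> ?T p" using stl(3)[of p] s(1) ST[of p] by blast
      have "P (\<iota> p) (t - s) \<in> St p" using stl(2)[of p] s(2) by blast
      then show "P (\<iota> p) t - P (\<iota> p) s \<in> ?F p"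
        unfolding linear_diff[OF golden(4), symmetric] by (intro span_base) simp
    qed
    have "shape_operator B A \<iota> D St ltr (\<lambda>q. P (\<iota> q) (pushforward B A \<iota> U q)) W p
           - shape_operator B A \<iota> D St ltr (\<lambda>q. P (\<iota> q) (pushforward B A \<iota> W q)) U p
         = - (?tang (P (\<iota> p) V1) - ?tang (P (\<iota> p) V2))"
      unfolding shape_operator_def tangential_part_def PV by simp
    also have "\<dots> = - P (\<iota> p) s"
      unfolding tang_diff[symmetric] linear_diff[OF golden(4), symmetric] t Pt ..
    finally have lhs: "shape_operator B A \<iota> D St ltr (\<lambda>q. P (\<iota> q) (pushforward B A \<iota> U q)) W p
           - shape_operator B A \<iota> D St ltr (\<lambda>q. P (\<iota> q) (pushforward B A \<iota> W q)) U p = - P (\<iota> p) s" .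
    have "screen_shape_operator B A g \<iota> D S St ltr W U p
           - screen_shape_operator B A g \<iota> D S St ltr U W p = ?scr (?tang V1) - ?scr (?tang V2)"
      unfolding screen_shape_operator_def induced_connection_def tangential_part_def V1_def V2_def by simp
    also have "\<dots> = ?scr (?tang V1 - ?tang V2)"
      by (rule projection_along_diff[OF sS(1-3), symmetric]) (simp_all add: sS(4) tang_T)
    also have "?tang V1 - ?tang V2 = ?tang t" unfolding tang_diff[symmetric] t ..
    also have "?tang t = t" by (rule tang_eq[OF tT]) (simp add: span_0)
    finally have rhs: "screen_shape_operator B A g \<iota> D S St ltr W U p
           - screen_shape_operator B A g \<iota> D S St ltr U W p = s" unfolding s_def .
    have P0: "P (\<iota> p) 0 = 0" by (rule linear_0[OF golden(4)])
    have "- P (\<iota> p) s = s \<longleftrightarrow> s = 0"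
    proof
      \<comment> \<open>\<open>P (P s) = P s + s = 0\<close>, and \<open>P\<close> is injective because \<open>v = P (P v) - P v\<close>\<close>
      assume "- P (\<iota> p) s = s"
      then have "P (\<iota> p) (P (\<iota> p) s) = 0" unfolding golden(6) by (metis add.right_inverse)
      then show "s = 0" using golden(6)[of "\<iota> p" "P (\<iota> p) s"] P0 golden(6)[of "\<iota> p" s] by simp
    qed (simp add: P0)
    also have "s = 0 \<longleftrightarrow> t \<in> ?R p"
    proof
      assume "t \<in> ?R p"
      from subspace_diff[OF sS(2) this s(2)] have "s \<in> ?R p" by simp
      then show "s = 0" using s(1) sS(3)[of p] by auto
    qed (use s in simp)
    also have "t \<in> ?R p \<longleftrightarrow> lie_bracket B W U p \<in> radical_distribution B A g \<iota> p"
      unfolding t_def radical_distribution_def by simp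
    finally show ?thesis unfolding lhs rhs .
  qed
  have "integrable_distribution B (radical_distribution B A g \<iota>) \<longleftrightarrow> involutive B (radical_distribution B A g \<iota>)"
    by (rule frobenius[OF ll(1) r(1)])
  also have "\<dots> \<longleftrightarrow> (\<forall>W U. radical_section B A g \<iota> W \<longrightarrow> radical_section B A g \<iota> U \<longrightarrow>
      (\<forall>p. lie_bracket B W U p \<in> radical_distribution B A g \<iota> p))"
    unfolding involutive_def field_in_def radical_section_def ..
  finally show ?thesis using key unfolding radical_section_def by blast
qed

end
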